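(* For every finite non-trivial abelian group $G$, $$ s_{\max}(G)=\begin{cases} |G| & \text{if } \Sigma(G)=0 \text{ and } G \text{ is not an elementary abelian } 2\text{-group},\\ |G|-1 & \text{if } \Sigma(G)\neq 0,\\ |G|-2 & \text{if } G \text{ is an elementary abelian } 2\text{-group and } |G|>2.\end{cases}$$
   Context: For a finite abelian group $G$ with $n=|G|$, let $\mathcal C(G)$ be the set of Hamiltonian cycles in the complete digraph on vertex set $G$; a cycle is written $C=(g_1,\ldots,g_n)$, a listing of all elements of $G$, indices modulo $n$. Let $S(C)=\{g_i+g_{i+1} : 1\le i\le n\}$ (indices mod $n$) and $s_{\max}(G)=\max\{|S(C)| : C\in\mathcal C(G)\}$. $\Sigma(G)$ denotes the sum of all elements of $G$. *)

theory Defs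
  imports "HOL-Algebra.Algebra"
begin

text \<open>
  Abelian groups are written multiplicatively, as in HOL-Algebra: the sum of two elements
  is \<open>x \<otimes>\<^bsub>G\<^esub> y\<close> and the zero element is \<open>\<one>\<^bsub>G\<^esub>\<close>.
\<close>

definition complete_arcs :: "'a set \<Rightarrow> ('a \<times> 'a) set" where
  "complete_arcs V = {(x, y). x \<in> V \<and> y \<in> V \<and> x \<noteq> y}"

text \<open>
  A cycle is represented by a list of its vertices in cyclic order. Different rotations of a
  list represent the same cycle; everything below is invariant under rotation.
\<close>

definition hamiltonian_cycles :: "'a set \<Rightarrow> ('a \<times> 'a) set \<Rightarrow> 'a list set" where
  "hamiltonian_cycles V E =
    {C. distinct C \<and> set C = V \<and>
        (\<forall>i<length C. (C ! i, C ! (Suc i mod length C)) \<in> E)}"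

definition group_cycles :: "('a, 'b) monoid_scheme \<Rightarrow> 'a list set" where
  "group_cycles G = hamiltonian_cycles (carrier G) (complete_arcs (carrier G))"

definition cycle_sums :: "('a, 'b) monoid_scheme \<Rightarrow> 'a list \<Rightarrow> 'a set" where
  "cycle_sums G C = {C ! i \<otimes>\<^bsub>G\<^esub> C ! (Suc i mod length C) | i. i < length C}"

text \<open>
  The maximum is over a nonempty finite set when \<open>G\<close> is finite with at least two elements;
  a one-element group has no Hamiltonian cycle in this sense (there are no loops).
\<close>

definition s_max :: "('a, 'b) monoid_scheme \<Rightarrow> nat" where
  "s_max G = Max ((\<lambda>C. card (cycle_sums G C)) ` group_cycles G)"

definition total_sum :: "('a, 'b) monoid_scheme \<Rightarrow> 'a" where
  "total_sum G = (\<Otimes>\<^bsub>G\<^esub>x\<in>carrier G. x)"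

definition elementary_abelian_2_group :: "('a, 'b) monoid_scheme \<Rightarrow> bool" where
  "elementary_abelian_2_group G \<longleftrightarrow>
    comm_group G \<and> (\<forall>x\<in>carrier G. x \<noteq> \<one>\<^bsub>G\<^esub> \<longrightarrow> group.ord G x = 2)"

end

theory Submission
  imports Defs
begin

text \<open>
  Upper bounds: the product of all sums along a Hamiltonian cycle is the square of \<open>total_sum G\<close>; and in
  an elementary abelian 2-group the identity is never a sum. By pairing elements with their
  inverses, \<open>total_sum G\<close> is nontrivial iff \<open>G\<close> has exactly one involution.

  Constructions: induction along quotients \<open>G \<rightarrow> K\<close>. A cyclic sequence of \<open>K\<close> is run through
  several times while labels in the kernel change. If the kernel is cyclic of odd order, the powers
  of a generator serve as labels, as \<open>g\<^sup>i g\<^sup>i\<close> runs through all powers. If the kernel is \<open>Z\<^sub>2\<^sup>2\<close> or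
  \<open>Z\<^sub>2\<^sup>3\<close>, the passes alternate in direction; this avoids the obstruction that products of complete
  mappings of \<open>Z\<^sub>2\<^sup>2\<close> are even permutations while a cycle through four labels is odd. The groups
  not reached this way are \<open>Z\<^sub>2 \<times> Z\<^bsub>2^a\<^esub>\<close> (a doubling recursion), \<open>Z\<^sub>4 \<times> Z\<^sub>4\<close> and \<open>Z\<^sub>4 \<times> Z\<^sub>2\<^sup>2\<close>
  (explicit cycles). With one involution \<open>\<iota>\<close> the cycle is \<open>x\<^sub>0, x\<^sub>0\<iota>, x\<^sub>1, x\<^sub>1\<iota>, \<dots>\<close>, where \<open>x\<^sub>i = c\<^sup>i\<close>
  in the cyclic case; only the closing sum repeats. In an elementary abelian 2-group one inserts
  the identity into a cyclic arrangement of the other elements with distinct sums.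
\<close>

unbundle bit_operations_syntax

section \<open>Quotients and cyclic sequences\<close>

text \<open>What governs the induction is which quotients are admissible. A group with exactly one
  involution has no harmonious sequence, because the product of all sums is wrong, and a nontrivial
  elementary abelian 2-group has none, because the identity is never a sum. So the quotient by a
  Klein kernel should either have odd order or keep at least four solutions of
  \<open>y \<otimes> y = \<one>\<close> together with a nontrivial square. If \<open>G\<close> has
  sixteen or more such solutions, a Klein subgroup avoiding one given square is enough. With eight
  or four the choice can fail, and the failure itself pins down the group: too few squares force
  order 8 or 16, and a cyclic quotient by the two-torsion leaves Z_2 x Z_{2^a}. This is where the
  families treated by hand come from.\<close>

definition harmonious :: "('a, 'b) monoid_scheme \<Rightarrow> bool" where
  "harmonious G \<longleftrightarrow> (\<exists>x. (\<forall>i < order G. x i \<in> carrier G) \<and> inj_on x {..<order G} \<and>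
     inj_on (\<lambda>i. x i \<otimes>\<^bsub>G\<^esub> x (Suc i mod order G)) {..<order G})"

definition two_torsion :: "('a, 'b) monoid_scheme \<Rightarrow> 'a set" where
  "two_torsion G = {x \<in> carrier G. x \<otimes>\<^bsub>G\<^esub> x = \<one>\<^bsub>G\<^esub>}"

text \<open>The kernel is a parameter \<open>H\<close> tied to \<open>\<pi>\<close> by
  \<open>ker\<close>, so that the powers of an element, a Klein subgroup or the two-torsion can be
  inserted as explicit sets.\<close>

locale finite_quotient =
  G: comm_group G + K: comm_group K
  for G :: "('a, 'b) monoid_scheme" (structure) and K :: "('c, 'd) monoid_scheme" +
  fixes \<pi> :: "'a \<Rightarrow> 'c" and H :: "'a set"
  assumes finite_G: "finite (carrier G)"
    and hom: "\<pi> \<in> hom G K"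
    and surj: "\<pi> ` carrier G = carrier K"
    and H_subset: "H \<subseteq> carrier G"
    and ker: "x \<in> carrier G \<Longrightarrow> \<pi> x = \<one>\<^bsub>K\<^esub> \<longleftrightarrow> x \<in> H"
begin

sublocale group_hom G K \<pi>
  by unfold_locales (rule hom)

lemma proj_eq_iff:
  assumes "x \<in> carrier G" "y \<in> carrier G"
  shows "\<pi> x = \<pi> y \<longleftrightarrow> x \<otimes> inv y \<in> H"
proof -
  have "\<pi> x = \<pi> y \<longleftrightarrow> \<pi> x \<otimes>\<^bsub>K\<^esub> inv\<^bsub>K\<^esub> \<pi> y = \<one>\<^bsub>K\<^esub>"
    using assms K.inv_solve_right'[of "\<one>\<^bsub>K\<^esub>" "\<pi> x" "\<pi> y"] by auto
  also have "\<dots> \<longleftrightarrow> \<pi> (x \<otimes> inv y) = \<one>\<^bsub>K\<^esub>" using assms by simp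
  also have "\<dots> \<longleftrightarrow> x \<otimes> inv y \<in> H" using assms by (intro ker) simp
  finally show ?thesis .
qed

lemma kernel_eq: "kernel G K \<pi> = H"
  using H_subset ker by (auto simp: kernel_def)

lemma subgroup_H: "subgroup H G"
  using subgroup_kernel kernel_eq by simp

lemma proj_H: "h \<in> H \<Longrightarrow> \<pi> h = \<one>\<^bsub>K\<^esub>"
  using H_subset ker by blast

lemma finite_K: "finite (carrier K)"
  using finite_G surj by (metis finite_imageI)

lemma order_eq: "order G = order K * card H"
proof -
  have "(G Mod H) \<cong> K"
    using FactGroup_iso[OF surj] kernel_eq by simp
  then have "card (rcosets H) = order K"
    using iso_same_card by (fastforce simp: FactGroup_def order_def)
  then show ?thesis
    using G.lagrange[OF subgroup_H] by simp
qed

lemma order_K_pos: "order K > 0"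
  using finite_K K.order_gt_0_iff_finite by blast

lemma lift_exists: "y \<in> carrier K \<Longrightarrow> \<exists>x\<in>carrier G. \<pi> x = y"
  unfolding surj[symmetric] by blast

text \<open>Applying \<open>\<pi>\<close> removes the label, so equal products have equal coset
  indices; cancelling the representative then compares the labels. It serves for the terms of a
  cycle and, with edge sums as \<open>u\<close>, for its sums.\<close>

lemma coset_label_inj:
  assumes "\<And>j. j \<in> J \<Longrightarrow> c j \<in> C" "\<And>p. p \<in> C \<Longrightarrow> u p \<in> carrier G" "inj_on (\<lambda>p. \<pi> (u p)) C"
    and lab: "\<And>j. j \<in> J \<Longrightarrow> lab j \<in> H" and inj: "inj_on (\<lambda>j. (c j, lab j)) J"
  shows "inj_on (\<lambda>j. u (c j) \<otimes> lab j) J"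
proof (rule inj_onI)
  fix i j assume ij: "i \<in> J" "j \<in> J" "u (c i) \<otimes> lab i = u (c j) \<otimes> lab j"
  have cl: "u (c k) \<in> carrier G" "lab k \<in> carrier G" if "k \<in> J" for k
    using assms that H_subset by blast+
  have "\<pi> (u (c k) \<otimes> lab k) = \<pi> (u (c k))" if "k \<in> J" for k
    using cl[OF that] proj_H[OF lab[OF that]] by simp
  then have "\<pi> (u (c i)) = \<pi> (u (c j))" using ij by metis
  then have c: "c i = c j" using inj_onD[OF assms(3)] assms(1) ij by blast
  then have "lab i = lab j" using ij cl by simp
  then show "i = j" using inj_onD[OF inj] c ij by blast
qed

text \<open>The sum of two consecutive lifted terms is the sum along an edge of the cycle below,
  times the product of two labels. Hence it suffices to separate the pairs (coset, label) and the
  pairs (edge, label product). The edge \<open>ed t\<close> is recorded apart from the coset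
  \<open>c t\<close> because an edge may be run through in either direction.\<close>

lemma harmonious_lift:
  assumes x: "\<And>i. i < m \<Longrightarrow> x i \<in> carrier G" "inj_on (\<lambda>i. \<pi> (x i)) {..<m}"
      "inj_on (\<lambda>i. \<pi> (x i \<otimes> x (Suc i mod m))) {..<m}"
    and c: "\<And>t. t < n \<Longrightarrow> c t < m" and ed: "\<And>t. t < n \<Longrightarrow> ed t < m"
    and adj: "\<And>t. t < n \<Longrightarrow> c t = ed t \<and> c (Suc t mod n) = Suc (ed t) mod m \<or>
               c (Suc t mod n) = ed t \<and> c t = Suc (ed t) mod m"
    and lab: "\<And>t. t < n \<Longrightarrow> lab t \<in> H"
    and inj: "inj_on (\<lambda>t. (c t, lab t)) {..<n}"
    and inj_sum: "inj_on (\<lambda>t. (ed t, lab t \<otimes> lab (Suc t mod n))) {..<n}"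
    and n: "order G = n"
  shows "harmonious G"
proof -
  define y where "y t = x (c t) \<otimes> lab t" for t
  have labG: "lab t \<in> carrier G" if "t < n" for t
    using lab[OF that] H_subset by blast
  have xc: "x (c t) \<in> carrier G" if "t < n" for t
    using x(1) c that by blast
  have suc: "Suc t mod n < n" if "t < n" for t
    using that by simp
  have yG: "y t \<in> carrier G" if "t < n" for t
    using labG[OF that] xc[OF that] by (simp add: y_def)
  have edG: "x (ed t) \<in> carrier G" "x (Suc (ed t) mod m) \<in> carrier G" if "t < n" for t
  proof -
    have "0 < m" using ed[OF that] by simp
    then show "x (ed t) \<in> carrier G" "x (Suc (ed t) mod m) \<in> carrier G"
      using x(1) ed[OF that] by simp_all
  qed
  have ysum: "y t \<otimes> y (Suc t mod n) =
      (x (ed t) \<otimes> x (Suc (ed t) mod m)) \<otimes> (lab t \<otimes> lab (Suc t mod n))" if "t < n" for t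
    using adj[OF that]
  proof
    assume a: "c t = ed t \<and> c (Suc t mod n) = Suc (ed t) mod m"
    show ?thesis
      using a labG[OF that] labG[OF suc[OF that]] edG[OF that] by (simp add: y_def G.m_ac)
  next
    assume a: "c (Suc t mod n) = ed t \<and> c t = Suc (ed t) mod m"
    show ?thesis
      using a labG[OF that] labG[OF suc[OF that]] edG[OF that] by (simp add: y_def G.m_ac)
  qed
  have inj_y: "inj_on y {..<n}"
    unfolding y_def by (rule coset_label_inj[where C = "{..<m}"]) (use c x(1,2) lab inj in auto)
  have inj_s: "inj_on (\<lambda>t. y t \<otimes> y (Suc t mod n)) {..<n}"
  proof -
    have G: "x p \<otimes> x (Suc p mod m) \<in> carrier G" if "p < m" for p
      using that x(1) by simp
    have H: "lab t \<otimes> lab (Suc t mod n) \<in> H" if "t < n" for t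
      using lab[OF that] lab[OF suc[OF that]] subgroup_H by (rule subgroup.m_closed[rotated])
    have inj: "inj_on (\<lambda>t. (x (ed t) \<otimes> x (Suc (ed t) mod m)) \<otimes> (lab t \<otimes> lab (Suc t mod n))) {..<n}"
      by (rule coset_label_inj[where C = "{..<m}" and u = "\<lambda>p. x p \<otimes> x (Suc p mod m)"])
        (use ed x(3) G H inj_sum in auto)
    show ?thesis by (rule iffD2[OF inj_on_cong inj]) (use ysum in simp)
  qed
  show ?thesis
    unfolding harmonious_def n using yG inj_y inj_s by blast
qed

lemma harmonious_reps:
  assumes "harmonious K"
  obtains x where "\<And>i. i < order K \<Longrightarrow> x i \<in> carrier G" "inj_on (\<lambda>i. \<pi> (x i)) {..<order K}"
      "inj_on (\<lambda>i. \<pi> (x i \<otimes> x (Suc i mod order K))) {..<order K}"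
proof -
  let ?m = "order K"
  obtain k where k: "\<And>i. i < ?m \<Longrightarrow> k i \<in> carrier K" "inj_on k {..<?m}"
      "inj_on (\<lambda>i. k i \<otimes>\<^bsub>K\<^esub> k (Suc i mod ?m)) {..<?m}"
    using assms by (auto simp: harmonious_def)
  define x where "x i = (SOME x. x \<in> carrier G \<and> \<pi> x = k i)" for i
  have x: "x i \<in> carrier G \<and> \<pi> (x i) = k i" if "i < ?m" for i
    unfolding x_def using someI_ex[OF lift_exists[OF k(1)[OF that], unfolded Bex_def]] by simp
  have suc: "Suc i mod ?m < ?m" for i
    using order_K_pos by simp
  show ?thesis
  proof
    show "inj_on (\<lambda>i. \<pi> (x i)) {..<order K}"
      using k(2) x by (auto simp: inj_on_def)
    show "inj_on (\<lambda>i. \<pi> (x i \<otimes> x (Suc i mod ?m))) {..<?m}"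
      using k(3) x suc by (auto simp: inj_on_def)
  qed (use x in blast)
qed

text \<open>Dividing by a fixed member moves each fibre of \<open>\<pi>\<close> on \<open>S\<close>
  injectively into \<open>H\<close>. The bound guarantees that enough two-torsion survives in a
  quotient.\<close>

lemma card_le_image:
  assumes "S \<subseteq> carrier G"
  shows "card S \<le> card (\<pi> ` S) * card H"
proof -
  have fin: "finite S" using assms finite_G finite_subset by blast
  have "card {x \<in> S. \<pi> x = y} \<le> card H" if "y \<in> \<pi> ` S" for y
  proof -
    obtain z where z: "z \<in> S" "\<pi> z = y" using \<open>y \<in> \<pi> ` S\<close> by blast
    have "inj_on (\<lambda>x. x \<otimes> inv z) {x \<in> S. \<pi> x = y}"
    proof (rule inj_onI)
      fix a b assume ab: "a \<in> {x \<in> S. \<pi> x = y}" "b \<in> {x \<in> S. \<pi> x = y}" "a \<otimes> inv z = b \<otimes> inv z"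
      then have "a \<in> carrier G" "b \<in> carrier G" "inv z \<in> carrier G" using z assms by auto
      with ab(3) show "a = b" by simp
    qed
    moreover have "(\<lambda>x. x \<otimes> inv z) ` {x \<in> S. \<pi> x = y} \<subseteq> H"
    proof
      fix w assume "w \<in> (\<lambda>x. x \<otimes> inv z) ` {x \<in> S. \<pi> x = y}"
      then obtain x where "x \<in> S" "\<pi> x = y" "w = x \<otimes> inv z" by blast
      then show "w \<in> H" using z assms proj_eq_iff[of x z] by (simp add: subsetD)
    qed
    moreover have "finite H" using H_subset finite_G finite_subset by blast
    ultimately show ?thesis by (rule card_inj_on_le)
  qed
  then have "(\<Sum>y\<in>\<pi> ` S. card {x \<in> S. \<pi> x = y}) \<le> card (\<pi> ` S) * card H"
    using sum_bounded_above[of "\<pi> ` S" "\<lambda>y. card {x \<in> S. \<pi> x = y}" "card H"] by simp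
  moreover have "card S = (\<Sum>y\<in>\<pi> ` S. card {x \<in> S. \<pi> x = y})"
    using fin by (subst card_UN_disjoint[symmetric]) (auto intro!: arg_cong[where f = card])
  ultimately show ?thesis by simp
qed

end

text \<open>Replacing each coset by a chosen member keeps the quotient on the type
  \<open>'a\<close>. The group of cosets would live on \<open>'a set\<close>, where an induction
  hypothesis about groups on \<open>'a\<close> does not apply.\<close>

lemma (in comm_group) quotient_copy:
  assumes fin: "finite (carrier G)" and H: "subgroup H G"
  obtains K :: "'a monoid" and \<pi> where "finite_quotient G K \<pi> H"
proof -
  define \<pi> where "\<pi> x = (SOME y. y \<in> H #> x)" for x
  have mem: "\<pi> x \<in> H #> x" if "x \<in> carrier G" for x
    unfolding \<pi>_def using rcos_self[OF that H] by (rule someI)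
  have nH: "H \<lhd> G"
    using H by (simp add: normal_iff_subgroup)
  have w: "weak_group_morphism \<pi> H G"
  proof (rule weak_group_morphismsI[OF nH])
    fix a b assume ab: "a \<in> carrier G" "b \<in> carrier G"
    show "\<pi> a = \<pi> b \<longleftrightarrow> a \<otimes> inv b \<in> H"
    proof
      assume "\<pi> a = \<pi> b"
      then have "H #> a = H #> b"
        using repr_independence[OF mem[OF ab(1)] ab(1) H] repr_independence[OF mem[OF ab(2)] ab(2) H]
        by simp
      then have "a \<in> H #> b"
        using rcos_self[OF ab(1) H] by simp
      then show "a \<otimes> inv b \<in> H"
        using subgroup.rcos_module[OF H is_group ab(2,1)] by simp
    next
      assume "a \<otimes> inv b \<in> H"
      then have "a \<in> H #> b"
        using subgroup.rcos_module[OF H is_group ab(2,1)] by simp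
      then have "H #> b = H #> a"
        using repr_independence[OF _ ab(2) H] by simp
      then show "\<pi> a = \<pi> b" by (simp add: \<pi>_def)
    qed
  qed
  let ?K = "image_group \<pi> G"
  have hom: "group_hom G ?K \<pi>" by (rule weak_group_morphism_group_hom[OF w])
  interpret h: group_hom G ?K \<pi> by (rule hom)
  have surj: "\<pi> ` carrier G = carrier ?K" by (simp add: image_group_carrier)
  have "comm_group ?K"
  proof (rule group.group_comm_groupI)
    show "group ?K" by (rule h.H.is_group)
    fix x y assume "x \<in> carrier ?K" "y \<in> carrier ?K"
    then obtain a b where "a \<in> carrier G" "x = \<pi> a" "b \<in> carrier G" "y = \<pi> b"
      using surj by blast
    then show "x \<otimes>\<^bsub>?K\<^esub> y = y \<otimes>\<^bsub>?K\<^esub> x"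
      using m_comm[of a b] by (simp flip: h.hom_mult)
  qed
  moreover have "\<pi> x = \<one>\<^bsub>?K\<^esub> \<longleftrightarrow> x \<in> H" if "x \<in> carrier G" for x
    using weak_group_morphism_ker[OF w] that by (auto simp: kernel_def)
  ultimately have "finite_quotient G ?K \<pi> H"
    using fin surj subgroup.subset[OF H] h.homh comm_group_axioms
    by (intro finite_quotient.intro finite_quotient_axioms.intro) auto
  then show thesis by (rule that)
qed

section \<open>Cyclic kernels of odd order\<close>

lemma (in group) pow_eq_iff_cong:
  assumes "x \<in> carrier G" "ord x > 0"
  shows "x [^] (a::nat) = x [^] (b::nat) \<longleftrightarrow> a mod ord x = b mod ord x"
proof -
  have *: "x [^] a = x [^] b \<longleftrightarrow> a mod ord x = b mod ord x" if "a \<le> b" for a b :: nat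
  proof -
    have "x [^] b = x [^] a \<otimes> x [^] (b - a)"
      using that assms(1) by (simp add: nat_pow_mult)
    then have "x [^] a = x [^] b \<longleftrightarrow> x [^] (b - a) = \<one>"
      using assms(1) by (metis l_cancel_one' nat_pow_closed)
    also have "\<dots> \<longleftrightarrow> ord x dvd b - a"
      using assms(1) by (simp add: pow_eq_id)
    also have "\<dots> \<longleftrightarrow> a mod ord x = b mod ord x"
      using that by (metis mod_eq_dvd_iff_nat)
    finally show ?thesis .
  qed
  show ?thesis
    using *[of a b] *[of b a] by (cases "a \<le> b") auto
qed

lemma (in group) pow_mod_ord: "x \<in> carrier G \<Longrightarrow> x [^] (a mod ord x) = x [^] (a::nat)"
  using pow_eq_iff_cong[of x "a mod ord x" a] by (cases "ord x = 0") auto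

text \<open>An odd modulus allows 2 to be cancelled; the offset \<open>k\<close> absorbs the extra
  power of the generator on an edge that joins two passes.\<close>

lemma odd_double_mod_cancel:
  fixes a b q :: nat
  assumes "odd q" "(2 * a + k) mod q = (2 * b + k) mod q" "a < q" "b < q"
  shows "a = b"
proof -
  have *: "a = b" if "a \<le> b" "(2 * a + k) mod q = (2 * b + k) mod q" "b < q" for a b
  proof -
    have "q dvd 2 * b + k - (2 * a + k)"
      using that by (metis mod_eq_dvd_iff_nat add_le_mono1 mult_le_mono2)
    then have "q dvd 2 * (b - a)" by (simp add: diff_mult_distrib2)
    then have "q dvd b - a"
      using assms(1) by (simp add: coprime_dvd_mult_right_iff)
    then show ?thesis
      using that by (metis dvd_imp_le diff_is_0_eq le_antisym less_imp_diff_less not_less not_gr_zero)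
  qed
  show ?thesis
    using *[of a b] *[of b a] assms by (cases "a \<le> b") auto
qed

lemma (in finite_quotient) harmonious_odd_cyclic_kernel:
  assumes K: "harmonious K" and g: "g \<in> carrier G" "odd (G.ord g)"
    and H: "H = (\<lambda>i::nat. g [^] i) ` UNIV"
  shows "harmonious G"
proof -
  define m q where "m = order K" and "q = G.ord g"
  have m: "0 < m" using order_K_pos by (simp add: m_def)
  have q: "0 < q" "odd q" using g(2) by (auto simp: q_def intro: Nat.gr0I)
  have "H = (\<lambda>i::nat. g [^] i) ` {..<q}"
  proof
    show "H \<subseteq> (\<lambda>i::nat. g [^] i) ` {..<q}"
      using H G.pow_mod_ord[OF g(1)] q(1) unfolding q_def
      by (metis (no_types, lifting) image_subset_iff lessThan_iff mod_less_divisor rev_image_eqI)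
  qed (use H in auto)
  moreover have "inj_on (\<lambda>i::nat. g [^] i) {..<q}"
    by (rule inj_onI) (use G.pow_eq_iff_cong[OF g(1)] q in \<open>auto simp: q_def\<close>)
  ultimately have "card H = q" by (simp add: card_image)
  then have n: "order G = q * m" using order_eq by (simp add: m_def mult.commute)
  obtain x where x: "\<And>i. i < m \<Longrightarrow> x i \<in> carrier G" "inj_on (\<lambda>i. \<pi> (x i)) {..<m}"
      "inj_on (\<lambda>i. \<pi> (x i \<otimes> x (Suc i mod m))) {..<m}"
    using harmonious_reps[OF K] unfolding m_def by blast
  let ?n = "q * m"
  define lab where "lab t = g [^] (t div m)" for t :: nat
  \<comment> \<open>The exponent rises only on the closing edge of a pass. At the very last step the
    return to exponent 0 counts as one more rise, because \<open>g [^] q = \<one>\<close>.\<close>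
  have lab_suc: "lab (Suc t mod ?n) = g [^] ((t div m) + (if t mod m = m - 1 then 1 else 0))"
    if "t < ?n" for t
  proof -
    have "lab (Suc t mod ?n) = g [^] (Suc t div m)"
    proof (cases "Suc t < ?n")
      case False
      then have "Suc t = q * m" using that by simp
      then show ?thesis using q m g(1) G.pow_ord_eq_1 by (simp add: lab_def q_def)
    qed (simp add: lab_def)
    moreover have "Suc t div m = t div m + (if t mod m = m - 1 then 1 else 0)"
      using m by (auto simp: div_Suc mod_Suc)
    ultimately show ?thesis by simp
  qed
  show ?thesis
  proof (rule harmonious_lift[OF x, where n = ?n and c = "\<lambda>t. t mod m" and ed = "\<lambda>t. t mod m"
          and lab = lab])
    fix t assume t: "t < ?n"
    show "t mod m < m" using m by simp
    then show "t mod m < m" .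
    have "Suc t mod ?n mod m = Suc t mod m"
      by (simp add: mod_mod_cancel)
    then show "t mod m = t mod m \<and> Suc t mod ?n mod m = Suc (t mod m) mod m \<or>
        Suc t mod ?n mod m = t mod m \<and> t mod m = Suc (t mod m) mod m"
      by (simp add: mod_Suc_eq)
    show "lab t \<in> H" using H by (simp add: lab_def)
  next
    show "inj_on (\<lambda>t. (t mod m, lab t)) {..<?n}"
    proof (rule inj_onI)
      fix s t assume st: "s \<in> {..<?n}" "t \<in> {..<?n}" "(s mod m, lab s) = (t mod m, lab t)"
      then have "s div m < q" "t div m < q" by (simp_all add: less_mult_imp_div_less)
      then have "s div m = t div m"
        using st G.pow_eq_iff_cong[OF g(1)] q by (auto simp: lab_def q_def)
      then show "s = t" using st by (metis Pair_inject div_mult_mod_eq)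
    qed
    show "inj_on (\<lambda>t. (t mod m, lab t \<otimes> lab (Suc t mod ?n))) {..<?n}"
    proof (rule inj_onI)
      fix s t assume st: "s \<in> {..<?n}" "t \<in> {..<?n}"
        "(s mod m, lab s \<otimes> lab (Suc s mod ?n)) = (t mod m, lab t \<otimes> lab (Suc t mod ?n))"
      define k :: nat where "k = (if t mod m = m - 1 then 1 else 0)"
      have "lab s \<otimes> lab (Suc s mod ?n) = g [^] (2 * (s div m) + k)"
           "lab t \<otimes> lab (Suc t mod ?n) = g [^] (2 * (t div m) + k)"
        using st lab_suc g(1) by (auto simp: k_def lab_def G.nat_pow_mult mult_2)
      then have "(2 * (s div m) + k) mod q = (2 * (t div m) + k) mod q"
        using st G.pow_eq_iff_cong[OF g(1)] q by (simp add: q_def)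
      moreover have "s div m < q" "t div m < q" using st by (simp_all add: less_mult_imp_div_less)
      ultimately have "s div m = t div m"
        using odd_double_mod_cancel q(2) by blast
      then show "s = t" using st by (metis Pair_inject div_mult_mod_eq)
    qed
  qed (simp_all add: n)
qed

text \<open>
  In the zigzag lift the cycle runs through the cosets \<open>1, \<dots>, m - 1\<close> alternately upwards and
  downwards, visiting coset \<open>0\<close> between two passes. Every sum coset is hit once per pass, whatever
  the parity of the number of cosets.
\<close>

lemma (in finite_quotient) harmonious_zigzag:
  assumes K: "harmonious K" and m: "m = order K" "2 \<le> m" and S: "even S" "0 < S" "card H = S"
    and pH: "\<And>s. s < S \<Longrightarrow> p s \<in> H" and TH: "\<And>i s. s < S \<Longrightarrow> T i s \<in> H"
    and p_inj: "inj_on p {..<S}"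
    and T_inj: "\<And>i. 1 \<le> i \<Longrightarrow> i < m \<Longrightarrow> inj_on (T i) {..<S}"
    and mid: "\<And>i. 1 \<le> i \<Longrightarrow> Suc i < m \<Longrightarrow> inj_on (\<lambda>s. T i s \<otimes> T (Suc i) s) {..<S}"
    and bot: "inj_on (\<lambda>s. (if even s then p s else p (Suc s mod S)) \<otimes> T 1 s) {..<S}"
    and top: "inj_on (\<lambda>s. (if even s then p (Suc s mod S) else p s) \<otimes> T (m - 1) s) {..<S}"
  shows "harmonious G"
proof -
  obtain x where x: "\<And>i. i < m \<Longrightarrow> x i \<in> carrier G" "inj_on (\<lambda>i. \<pi> (x i)) {..<m}"
      "inj_on (\<lambda>i. \<pi> (x i \<otimes> x (Suc i mod m))) {..<m}"
    using harmonious_reps[OF K] unfolding m(1) by blast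
  let ?n = "S * m"
  have n: "order G = ?n" using order_eq S(3) m(1) by (simp add: mult.commute)
  have m0: "0 < m" using m by simp
  \<comment> \<open>Pass \<open>s\<close> starts in coset 0 with label \<open>p s\<close> and then
    meets coset \<open>j\<close> with label \<open>T j s\<close>, upwards for even \<open>s\<close>
    and downwards for odd \<open>s\<close>. Edge \<open>e\<close> joins the cosets \<open>e\<close>
    and \<open>e + 1\<close> modulo \<open>m\<close>, hence the reflection \<open>m - 1 - i\<close>
    on a downward pass.\<close>
  define pos where "pos s i = (if i = 0 then 0 else if even s then i else m - i)" for s i :: nat
  define edg where "edg s i = (if even s then i else m - 1 - i)" for s i :: nat
  define L where "L s i = (if i = 0 then p s else T (pos s i) s)" for s i :: nat
  define nx where "nx s i = (if Suc i < m then (s, Suc i) else (Suc s mod S, 0))" for s i :: nat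
  let ?f = "\<lambda>h t. h (t div m) (t mod m)"
  have dm: "t div m < S" "t mod m < m" if "t < ?n" for t
    using that m0 by (simp_all add: less_mult_imp_div_less)
  have suc: "(Suc t mod ?n) div m = fst (?f nx t)" "(Suc t mod ?n) mod m = snd (?f nx t)"
    if "t < ?n" for t
  proof -
    have 1: "Suc t mod ?n mod m = Suc t mod m" by (simp add: mod_mod_cancel)
    then show "(Suc t mod ?n) mod m = snd (?f nx t)"
      using m0 dm(2)[OF that] by (auto simp: nx_def mod_Suc split: if_splits)
    have "(Suc t mod ?n) div m = (Suc t div m) mod S"
    proof (cases "Suc t < ?n")
      case True
      then show ?thesis using less_mult_imp_div_less[of "Suc t" S m] by simp
    next
      case False
      then have "Suc t = S * m" using that by simp
      then show ?thesis using m0 by simp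
    qed
    moreover have "Suc t div m = (if Suc (t mod m) < m then t div m else Suc (t div m))"
      using m0 dm(2)[OF that] by (auto simp: div_Suc mod_Suc)
    ultimately show "(Suc t mod ?n) div m = fst (?f nx t)"
      using dm[OF that] by (auto simp: nx_def)
  qed
  have pos_inj: "i = j" if "pos s i = pos s j" "i < m" "j < m" for s i j
    using that by (auto simp: pos_def split: if_splits)
  have edg_inj: "i = j" if "edg s i = edg s j" "i < m" "j < m" for s i j
    using that by (auto simp: edg_def split: if_splits)
  \<comment> \<open>An even number of passes keeps the directions alternating across the wrap-around
    from the last pass to the first.\<close>
  have parity: "even (Suc s mod S) \<longleftrightarrow> odd s" if "s < S" for s
  proof (cases "Suc s = S")
    case True
    then have "odd s" using S(1) by (metis even_Suc)
    with True show ?thesis by simp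
  qed (use that in simp)
  \<comment> \<open>Only the edges 0 and \<open>m - 1\<close> touch coset 0. An upward pass leaves
    it by edge 0 and returns by edge \<open>m - 1\<close> to the label of the next pass; a downward
    pass does the opposite. This is the origin of the case distinctions in \<open>bot\<close> and
    \<open>top\<close>.\<close>
  have edge_sum: "L s i \<otimes> (case nx s i of (s', i') \<Rightarrow> L s' i') =
      (if edg s i = 0 then (if even s then p s else p (Suc s mod S)) \<otimes> T 1 s
       else if edg s i = m - 1 then (if even s then p (Suc s mod S) else p s) \<otimes> T (m - 1) s
       else T (edg s i) s \<otimes> T (Suc (edg s i)) s)" if "s < S" "i < m" for s i
  proof -
    have G: "p s \<in> carrier G" "p (Suc s mod S) \<in> carrier G" "T j s \<in> carrier G" for j
      using pH TH that H_subset S(2) by (auto simp: subset_iff)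
    have "Suc i < m \<or> Suc i = m" using that by linarith
    then consider "even s" "i = 0" | "even s" "i \<noteq> 0" "Suc i < m" | "even s" "i \<noteq> 0" "Suc i = m"
      | "odd s" "i = 0" | "odd s" "i \<noteq> 0" "Suc i < m" | "odd s" "i \<noteq> 0" "Suc i = m"
      by blast
    then show ?thesis
    proof cases
      case 5
      then have "m - i = Suc (m - Suc i)" "m - Suc i \<noteq> 0" "m - Suc i \<noteq> m - 1" by auto
      with 5 show ?thesis using G m by (simp add: L_def nx_def pos_def edg_def G.m_comm)
    next
      case 6
      then have "m - i = 1" by auto
      with 6 show ?thesis using G m by (simp add: L_def nx_def pos_def edg_def G.m_comm)
    qed (use G m in \<open>auto simp: L_def nx_def pos_def edg_def G.m_comm\<close>)
  qed
  have edge_inj: "s = s'"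
    if "s < S" "s' < S" "i < m" "i' < m" "edg s i = edg s' i'"
      "L s i \<otimes> (case nx s i of (s', i') \<Rightarrow> L s' i') = L s' i' \<otimes> (case nx s' i' of (s', i') \<Rightarrow> L s' i')"
    for s s' i i'
  proof -
    have e: "edg s i < m" using that by (auto simp: edg_def)
    consider "edg s i = 0" | "edg s i \<noteq> 0" "edg s i = m - 1" | "edg s i \<noteq> 0" "Suc (edg s i) < m"
      using e by linarith
    then show ?thesis
    proof cases
      case 1
      then show ?thesis
        using that edge_sum[of s i] edge_sum[of s' i'] bot by (auto dest: inj_onD)
    next
      case 2
      then show ?thesis
        using that edge_sum[of s i] edge_sum[of s' i'] top by (auto dest: inj_onD)
    next
      case 3
      then have "inj_on (\<lambda>s. T (edg s' i') s \<otimes> T (Suc (edg s' i')) s) {..<S}"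
        using that mid by simp
      moreover have "edg s' i' \<noteq> 0" "edg s' i' \<noteq> m - 1" using 3 that by auto
      ultimately show ?thesis
        using that edge_sum[of s i] edge_sum[of s' i'] by (auto dest: inj_onD)
    qed
  qed
  show ?thesis
  proof (rule harmonious_lift[OF x, where n = ?n and c = "?f pos" and ed = "?f edg" and lab = "?f L"])
    fix t assume t: "t < ?n"
    note st = dm[OF t]
    show "?f pos t < m" "?f edg t < m" using st m0 by (auto simp: pos_def edg_def)
    show "?f L t \<in> H" using st pH TH by (simp add: L_def)
    have "\<exists>s' i'. nx s i = (s', i') \<and> (pos s i = edg s i \<and> pos s' i' = Suc (edg s i) mod m \<or>
        pos s' i' = edg s i \<and> pos s i = Suc (edg s i) mod m)" if "s < S" "i < m" for s i
    proof (cases "Suc i < m")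
      case True
      then show ?thesis by (auto simp: nx_def pos_def edg_def Suc_diff_Suc)
    next
      case False
      then have "Suc i = m" using that by simp
      then show ?thesis using m by (auto simp: nx_def pos_def edg_def)
    qed
    from this[OF st] show "?f pos t = ?f edg t \<and> ?f pos (Suc t mod ?n) = Suc (?f edg t) mod m \<or>
        ?f pos (Suc t mod ?n) = ?f edg t \<and> ?f pos t = Suc (?f edg t) mod m"
      using suc[OF t] by auto
  next
    show "inj_on (\<lambda>t. (?f pos t, ?f L t)) {..<?n}"
    proof (rule inj_onI)
      fix t t' assume a: "t \<in> {..<?n}" "t' \<in> {..<?n}" "(?f pos t, ?f L t) = (?f pos t', ?f L t')"
      have d: "t div m < S" "t mod m < m" "t' div m < S" "t' mod m < m" using a dm by auto
      have p0: "pos s i = 0 \<longleftrightarrow> i = 0" if "i < m" for s i using that by (auto simp: pos_def)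
      have "t div m = t' div m"
      proof (cases "t mod m = 0")
        case True
        then have "t' mod m = 0" using a p0 d by (metis Pair_inject)
        then show ?thesis using True a d p_inj by (auto simp: L_def dest: inj_onD)
      next
        case False
        then have 2: "t' mod m \<noteq> 0" using a p0 d by (metis Pair_inject)
        have "1 \<le> pos s i \<and> pos s i < m" if "i \<noteq> 0" "i < m" for s i
          using that by (auto simp: pos_def)
        then have "1 \<le> ?f pos t" "?f pos t < m" using False d by blast+
        then have "inj_on (T (?f pos t)) {..<S}" using T_inj by blast
        then show ?thesis using 2 False a d by (auto simp: L_def dest: inj_onD)
      qed
      moreover from this have "t mod m = t' mod m"
        using a d pos_inj by (metis Pair_inject)
      ultimately show "t = t'" by (metis div_mult_mod_eq)
    qed
    show "inj_on (\<lambda>t. (?f edg t, ?f L t \<otimes> ?f L (Suc t mod ?n))) {..<?n}"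
    proof (rule inj_onI)
      fix t t' assume a: "t \<in> {..<?n}" "t' \<in> {..<?n}"
        "(?f edg t, ?f L t \<otimes> ?f L (Suc t mod ?n)) = (?f edg t', ?f L t' \<otimes> ?f L (Suc t' mod ?n))"
      have d: "t div m < S" "t mod m < m" "t' div m < S" "t' mod m < m" using a dm by auto
      have "?f L (Suc t mod ?n) = (case ?f nx t of (s', i') \<Rightarrow> L s' i')"
           "?f L (Suc t' mod ?n) = (case ?f nx t' of (s', i') \<Rightarrow> L s' i')"
        using suc a by (simp_all add: case_prod_beta)
      then have "t div m = t' div m"
        using edge_inj[OF d(1,3,2,4)] a by simp
      moreover from this have "t mod m = t' mod m"
        using a d edg_inj by (metis Pair_inject)
      ultimately show "t = t'" by (metis div_mult_mod_eq)
    qed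
  qed (simp_all add: n)
qed

text \<open>Coordinates on a part of \<open>G\<close>: a computable operation \<open>madd\<close>
  embedded by \<open>\<phi>\<close>, whose image may be proper. Distinctness of explicit sums
  becomes a computation on numbers.\<close>

definition group_model ::
  "('a, 'b) monoid_scheme \<Rightarrow> 'c set \<Rightarrow> ('c \<Rightarrow> 'c \<Rightarrow> 'c) \<Rightarrow> ('c \<Rightarrow> 'a) \<Rightarrow> bool" where
  "group_model G D madd \<phi> \<longleftrightarrow> inj_on \<phi> D \<and> \<phi> ` D \<subseteq> carrier G \<and>
     (\<forall>x\<in>D. \<forall>y\<in>D. madd x y \<in> D \<and> \<phi> (madd x y) = \<phi> x \<otimes>\<^bsub>G\<^esub> \<phi> y)"

lemma inj_on_nth_lessThan: "distinct xs \<Longrightarrow> length xs = n \<Longrightarrow> inj_on (\<lambda>s. xs ! s) {..<n}"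
  by (auto simp: inj_on_def nth_eq_iff_index_eq)

lemma inj_on_nth_map2:
  assumes "distinct (map2 f xs ys)" "length xs = n" "length ys = n"
  shows "inj_on (\<lambda>s. f (xs ! s) (ys ! s)) {..<n}"
proof (rule inj_onI)
  fix i j assume "i \<in> {..<n}" "j \<in> {..<n}" "f (xs ! i) (ys ! i) = f (xs ! j) (ys ! j)"
  then have "map2 f xs ys ! i = map2 f xs ys ! j" "i < length (map2 f xs ys)" "j < length (map2 f xs ys)"
    using assms by auto
  then show "i = j" using nth_eq_iff_index_eq[OF assms(1), of i j] by blast
qed

lemma harmonious_model:
  assumes model: "group_model G D madd \<phi>"
    and D: "\<And>i. i < order G \<Longrightarrow> x i \<in> D" and x: "inj_on x {..<order G}"
      "inj_on (\<lambda>i. madd (x i) (x (Suc i mod order G))) {..<order G}"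
  shows "harmonious G"
proof -
  let ?n = "order G" and ?x = "\<lambda>i. \<phi> (x i)"
  have suc: "Suc i mod ?n < ?n" if "i < ?n" for i using that by simp
  have inj: "a = b" if "\<phi> a = \<phi> b" "a \<in> D" "b \<in> D" for a b
    using model that by (auto simp: group_model_def dest: inj_onD)
  have "inj_on ?x {..<?n}"
    using inj D x(1) by (auto simp: inj_on_def)
  moreover have "inj_on (\<lambda>i. ?x i \<otimes>\<^bsub>G\<^esub> ?x (Suc i mod ?n)) {..<?n}"
  proof (rule inj_onI)
    fix i j assume ij: "i \<in> {..<?n}" "j \<in> {..<?n}"
      "?x i \<otimes>\<^bsub>G\<^esub> ?x (Suc i mod ?n) = ?x j \<otimes>\<^bsub>G\<^esub> ?x (Suc j mod ?n)"
    let ?a = "\<lambda>i. madd (x i) (x (Suc i mod ?n))"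
    have "?a k \<in> D \<and> \<phi> (?a k) = ?x k \<otimes>\<^bsub>G\<^esub> ?x (Suc k mod ?n)" if "k < ?n" for k
      using model D[OF that] D[OF suc[OF that]] by (simp add: group_model_def)
    then have "?a i = ?a j" using inj ij by auto
    then show "i = j" using x(2) ij by (auto dest: inj_onD)
  qed
  moreover have "\<forall>i<?n. ?x i \<in> carrier G"
    using model D by (auto simp: group_model_def)
  ultimately show ?thesis unfolding harmonious_def by (intro exI[of _ ?x] conjI)
qed

lemma cyclic_list_inj:
  assumes "distinct xs" "length xs = n" "distinct (map2 f xs (rotate1 xs))"
  shows "inj_on (\<lambda>i. xs ! i) {..<n}" "inj_on (\<lambda>i. f (xs ! i) (xs ! (Suc i mod n))) {..<n}"
proof -
  show "inj_on (\<lambda>i. xs ! i) {..<n}" using assms inj_on_nth_lessThan by blast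
  have "inj_on (\<lambda>i. f (xs ! i) (rotate1 xs ! i)) {..<n}"
    by (rule inj_on_nth_map2) (use assms in auto)
  then show "inj_on (\<lambda>i. f (xs ! i) (xs ! (Suc i mod n))) {..<n}"
    using assms(2) by (auto simp: inj_on_def nth_rotate1)
qed

lemma harmonious_model_list:
  assumes "group_model G D madd \<phi>" "set xs \<subseteq> D" "length xs = order G"
    "distinct xs" "distinct (map2 madd xs (rotate1 xs))"
  shows "harmonious G"
  using assms(2,3) by (intro harmonious_model[OF assms(1) _ cyclic_list_inj[OF assms(4,3,5)]]) auto

lemma (in group) cyclic_model:
  assumes "x \<in> carrier G" "ord x > 0"
  shows "group_model G {..<ord x} (\<lambda>i j. (i + j) mod ord x) (\<lambda>i::nat. x [^] i)"
proof -
  have "inj_on (\<lambda>i::nat. x [^] i) {..<ord x}"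
    by (rule inj_onI) (use pow_eq_iff_cong[OF assms] in auto)
  then show ?thesis
    using assms by (auto simp: group_model_def pow_mod_ord nat_pow_mult)
qed

text \<open>The condition \<open>indep\<close> makes the sum of the two parts direct: it is stated
  for quotients of values because these are what remains when two factorisations of one element are
  compared.\<close>

lemma (in comm_group) product_model:
  assumes \<phi>: "group_model G D madd \<phi>" and \<psi>: "group_model G E nadd \<psi>"
    and indep: "\<And>x x' y y'. \<lbrakk>x \<in> D; x' \<in> D; y \<in> E; y' \<in> E; \<phi> x \<otimes> inv \<phi> x' = \<psi> y' \<otimes> inv \<psi> y\<rbrakk>
        \<Longrightarrow> \<phi> x = \<phi> x'"
  shows "group_model G (D \<times> E) (\<lambda>(a, b) (c, d). (madd a c, nadd b d)) (\<lambda>(a, b). \<phi> a \<otimes> \<psi> b)"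
proof -
  have cl: "x \<in> D \<Longrightarrow> \<phi> x \<in> carrier G" "y \<in> E \<Longrightarrow> \<psi> y \<in> carrier G" for x y
    using \<phi> \<psi> by (auto simp: group_model_def)
  have "inj_on (\<lambda>(a, b). \<phi> a \<otimes> \<psi> b) (D \<times> E)"
  proof (rule inj_onI, clarify)
    fix x y x' y' assume *: "x \<in> D" "y \<in> E" "x' \<in> D" "y' \<in> E" "\<phi> x \<otimes> \<psi> y = \<phi> x' \<otimes> \<psi> y'"
    have "\<phi> x = \<phi> x' \<otimes> \<psi> y' \<otimes> inv \<psi> y"
      using * cl by (simp add: inv_solve_right)
    then have "\<phi> x = (\<psi> y' \<otimes> inv \<psi> y) \<otimes> \<phi> x'"
      using * cl by (simp add: m_ac)
    then have "\<phi> x \<otimes> inv \<phi> x' = \<psi> y' \<otimes> inv \<psi> y"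
      using * cl by (simp add: m_assoc)
    then have "\<phi> x = \<phi> x'" using indep * by blast
    moreover from this have "\<psi> y = \<psi> y'" using * cl by simp
    ultimately show "x = x' \<and> y = y'"
      using \<phi> \<psi> * by (auto simp: group_model_def dest: inj_onD)
  qed
  then show ?thesis
    using \<phi> \<psi> cl unfolding group_model_def by (auto simp: m_ac)
qed

text \<open>Bit strings of length \<open>d\<close> under exclusive or form Z_2^d; encoding them as
  numbers lets label tables be plain lists of naturals.\<close>

abbreviation xor_model :: "('a, 'b) monoid_scheme \<Rightarrow> nat \<Rightarrow> (nat \<Rightarrow> 'a) \<Rightarrow> bool" where
  "xor_model G d \<phi> \<equiv> group_model G {..<2 ^ d} (\<lambda>a b. a XOR b) \<phi>"

lemma (in group) xor_modelD:
  assumes \<phi>: "xor_model G d \<phi>"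
  shows "a < 2 ^ d \<Longrightarrow> \<phi> a \<in> carrier G" "a < 2 ^ d \<Longrightarrow> b < 2 ^ d \<Longrightarrow> \<phi> (a XOR b) = \<phi> a \<otimes> \<phi> b"
    "\<phi> a = \<phi> b \<Longrightarrow> a < 2 ^ d \<Longrightarrow> b < 2 ^ d \<Longrightarrow> a = b" "\<phi> 0 = \<one>" "card (\<phi> ` {..<2 ^ d}) = 2 ^ d"
proof -
  show 1: "a < 2 ^ d \<Longrightarrow> \<phi> a \<in> carrier G" for a using \<phi> by (auto simp: group_model_def)
  show 2: "a < 2 ^ d \<Longrightarrow> b < 2 ^ d \<Longrightarrow> \<phi> (a XOR b) = \<phi> a \<otimes> \<phi> b" for a b
    using \<phi> by (simp add: group_model_def)
  show "\<phi> a = \<phi> b \<Longrightarrow> a < 2 ^ d \<Longrightarrow> b < 2 ^ d \<Longrightarrow> a = b"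
    using \<phi> by (auto simp: group_model_def dest: inj_onD)
  have "\<phi> 0 \<otimes> \<phi> 0 = \<phi> 0" using 2[of 0 0] by simp
  then show "\<phi> 0 = \<one>" using 1[of 0] by simp
  show "card (\<phi> ` {..<2 ^ d}) = 2 ^ d" using \<phi> by (simp add: group_model_def card_image)
qed

lemma xor_nat_less: "a < 2 ^ d \<Longrightarrow> b < 2 ^ d \<Longrightarrow> a XOR b < (2::nat) ^ d"
  by (metis take_bit_nat_eq_self_iff take_bit_xor)

text \<open>The new involution becomes the top bit: bit \<open>d\<close> decides whether the factor
  \<open>e\<close> occurs, and \<open>take_bit d\<close> feeds the old coordinates.\<close>

lemma (in comm_group) xor_model_extend:
  assumes \<phi>: "xor_model G d \<phi>" and e: "e \<in> carrier G" "e \<otimes> e = \<one>" "e \<notin> \<phi> ` {..<2 ^ d}"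
  shows "xor_model G (Suc d) (\<lambda>a. \<phi> (take_bit d a) \<otimes> (if bit a d then e else \<one>))"
proof -
  let ?\<phi> = "\<lambda>a. \<phi> (take_bit d a) \<otimes> (if bit a d then e else \<one>)"
  have tb: "take_bit d a < 2 ^ d" for a :: nat by simp
  have cl: "\<phi> (take_bit d a) \<in> carrier G" for a :: nat
    using \<phi> by (auto simp: group_model_def)
  have hom: "\<phi> (take_bit d (a XOR b)) = \<phi> (take_bit d a) \<otimes> \<phi> (take_bit d b)" for a b :: nat
    using \<phi> by (auto simp: group_model_def take_bit_xor)
  have sq: "\<phi> (take_bit d a) \<otimes> \<phi> (take_bit d a) = \<one>" for a :: nat
  proof -
    have "\<phi> (take_bit d (0 XOR 0)) = \<phi> 0 \<otimes> \<phi> 0" using hom[of 0 0] by simp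
    then have "\<phi> 0 = \<one>" using cl[of 0] by simp
    then show ?thesis using hom[of a a] by simp
  qed
  have neq: "\<phi> (take_bit d a) \<otimes> e \<noteq> \<phi> (take_bit d b)" for a b :: nat
  proof
    assume eq: "\<phi> (take_bit d a) \<otimes> e = \<phi> (take_bit d b)"
    have "e = \<phi> (take_bit d a) \<otimes> (\<phi> (take_bit d a) \<otimes> e)"
      using sq[of a] cl[of a] e by (simp flip: m_assoc)
    also have "\<dots> = \<phi> (take_bit d (a XOR b))" using eq hom by simp
    finally show False using e(3) tb by (metis imageI lessThan_iff)
  qed
  have "inj_on ?\<phi> {..<2 ^ Suc d}"
  proof (rule inj_onI)
    fix a b :: nat assume ab: "a \<in> {..<2 ^ Suc d}" "b \<in> {..<2 ^ Suc d}" "?\<phi> a = ?\<phi> b"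
    then have bits: "bit a d = bit b d"
      using neq[of a b] neq[of b a] cl by (auto split: if_splits)
    then have "\<phi> (take_bit d a) = \<phi> (take_bit d b)"
      using ab(3) cl e(1) by (auto split: if_splits)
    then have tt: "take_bit d a = take_bit d b"
      using \<phi> tb by (auto simp: group_model_def dest: inj_onD)
    have "take_bit (Suc d) a = take_bit (Suc d) b"
      using tt bits by (simp add: take_bit_Suc_from_most)
    then show "a = b"
      using ab by (simp add: take_bit_nat_eq_self)
  qed
  moreover have "?\<phi> (a XOR b) = ?\<phi> a \<otimes> ?\<phi> b" for a b :: nat
  proof -
    have "e \<otimes> (e \<otimes> x) = x" if "x \<in> carrier G" for x
      using e that by (simp flip: m_assoc)
    then show ?thesis
      using cl[of a] cl[of b] e(1) by (auto simp: hom[unfolded take_bit_xor] bit_xor_iff m_ac)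
  qed
  ultimately show ?thesis
    using cl e(1) unfolding group_model_def by (auto intro!: xor_nat_less[where d = "Suc d", simplified])
qed

text \<open>A model of greatest dimension exists because its \<open>2 ^ d\<close> values are
  distinct solutions of \<open>x \<otimes> x = \<one>\<close>. It exhausts the two-torsion, for any
  element outside its image would extend it. This amounts to choosing a basis over the field with
  two elements.\<close>

lemma (in comm_group) xor_model_two_torsion:
  assumes fin: "finite (carrier G)"
  obtains d \<phi> where "xor_model G d \<phi>" "\<phi> ` {..<2 ^ d} = two_torsion G"
proof -
  let ?P = "\<lambda>d. \<exists>\<phi>. xor_model G d \<phi> \<and> \<phi> ` {..<2 ^ d} \<subseteq> two_torsion G"
  have finV: "finite (two_torsion G)" using fin by (simp add: two_torsion_def)
  have P0: "?P 0"
    by (rule exI[of _ "\<lambda>_. \<one>"]) (auto simp: group_model_def two_torsion_def inj_on_def)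
  have bound: "d \<le> card (two_torsion G)" if "?P d" for d
  proof -
    from that obtain \<phi> :: "nat \<Rightarrow> 'a" where "inj_on \<phi> {..<2 ^ d}" "\<phi> ` {..<2 ^ d} \<subseteq> two_torsion G"
      by (auto simp: group_model_def)
    then have "2 ^ d \<le> card (two_torsion G)"
      using card_inj_on_le finV by (metis card_lessThan)
    then show ?thesis using less_exp[of d] by linarith
  qed
  define d where "d = (GREATEST d. ?P d)"
  have "?P d" unfolding d_def by (rule GreatestI_nat[of ?P, OF P0]) (use bound in blast)
  then obtain \<phi> where \<phi>: "xor_model G d \<phi>" "\<phi> ` {..<2 ^ d} \<subseteq> two_torsion G" by blast
  have "two_torsion G \<subseteq> \<phi> ` {..<2 ^ d}"
  proof (rule ccontr)
    assume "\<not> two_torsion G \<subseteq> \<phi> ` {..<2 ^ d}"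
    then obtain e where e: "e \<in> carrier G" "e \<otimes> e = \<one>" "e \<notin> \<phi> ` {..<2 ^ d}"
      by (auto simp: two_torsion_def)
    let ?\<phi> = "\<lambda>a. \<phi> (take_bit d a) \<otimes> (if bit a d then e else \<one>)"
    have "?\<phi> ` {..<2 ^ Suc d} \<subseteq> two_torsion G"
    proof
      fix y assume "y \<in> ?\<phi> ` {..<2 ^ Suc d}"
      then obtain a where y: "y = ?\<phi> a" by blast
      have f: "\<phi> (take_bit d a) \<in> carrier G" "\<phi> (take_bit d a) \<otimes> \<phi> (take_bit d a) = \<one>"
        using subsetD[OF \<phi>(2) imageI[of "take_bit d a"]] by (auto simp: two_torsion_def)
      have "e \<otimes> (\<phi> (take_bit d a) \<otimes> (e \<otimes> \<phi> (take_bit d a))) = \<one>"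
        using f e by (metis m_assoc m_comm m_closed l_one)
      then show "y \<in> two_torsion G"
        using y f e by (auto simp: two_torsion_def m_ac)
    qed
    then have "?P (Suc d)" using xor_model_extend[OF \<phi>(1) e] by blast
    then have "Suc d \<le> d" unfolding d_def by (rule Greatest_le_nat) (use bound in blast)
    then show False by simp
  qed
  with \<phi> show thesis by (intro that[of d \<phi>]) auto
qed

text \<open>The zigzag conditions are pulled back along \<open>\<phi>\<close>, so that kernel labels
  become numbers and their products exclusive ors.\<close>

lemma (in finite_quotient) harmonious_xor_kernel:
  fixes p :: "nat \<Rightarrow> nat" and T :: "nat \<Rightarrow> nat \<Rightarrow> nat"
  assumes K: "harmonious K" and m: "m = order K" "2 \<le> m"
    and \<phi>: "xor_model G d \<phi>" "H = \<phi> ` {..<2 ^ d}" and d: "0 < d"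
    and p: "\<And>s. s < 2 ^ d \<Longrightarrow> p s < 2 ^ d" and T: "\<And>i s. s < 2 ^ d \<Longrightarrow> T i s < 2 ^ d"
    and p_inj: "inj_on p {..<2 ^ d}"
    and T_inj: "\<And>i. 1 \<le> i \<Longrightarrow> i < m \<Longrightarrow> inj_on (T i) {..<2 ^ d}"
    and mid: "\<And>i. 1 \<le> i \<Longrightarrow> Suc i < m \<Longrightarrow> inj_on (\<lambda>s. T i s XOR T (Suc i) s) {..<2 ^ d}"
    and bot: "inj_on (\<lambda>s. (if even s then p s else p (Suc s mod 2 ^ d)) XOR T 1 s) {..<2 ^ d}"
    and top: "inj_on (\<lambda>s. (if even s then p (Suc s mod 2 ^ d) else p s) XOR T (m - 1) s) {..<2 ^ d}"
  shows "harmonious G"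
proof -
  let ?D = "{..<2 ^ d :: nat}"
  have inj: "inj_on \<phi> ?D" and hom: "\<And>a b. a \<in> ?D \<Longrightarrow> b \<in> ?D \<Longrightarrow> \<phi> (a XOR b) = \<phi> a \<otimes> \<phi> b"
    using \<phi>(1) by (auto simp: group_model_def)
  have comp: "inj_on (\<lambda>s. \<phi> (f s)) ?D" if "inj_on f ?D" "\<And>s. s \<in> ?D \<Longrightarrow> f s \<in> ?D" for f
    using that inj by (auto simp: inj_on_def)
  have comp2: "inj_on (\<lambda>s. \<phi> (f s) \<otimes> \<phi> (g s)) ?D"
    if "inj_on (\<lambda>s. f s XOR g s) ?D" "\<And>s. s \<in> ?D \<Longrightarrow> f s \<in> ?D" "\<And>s. s \<in> ?D \<Longrightarrow> g s \<in> ?D" for f g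
    using comp[OF that(1)] that(2,3) xor_nat_less hom by (auto simp: inj_on_def)
  have sm: "Suc s mod 2 ^ d < 2 ^ d" for s :: nat by simp
  have bot': "inj_on (\<lambda>s. \<phi> (if even s then p s else p (Suc s mod 2 ^ d)) \<otimes> \<phi> (T 1 s)) ?D"
    by (rule comp2[OF bot]) (use p T sm in auto)
  have top': "inj_on (\<lambda>s. \<phi> (if even s then p (Suc s mod 2 ^ d) else p s) \<otimes> \<phi> (T (m - 1) s)) ?D"
    by (rule comp2[OF top]) (use p T sm in auto)
  show ?thesis
  proof (rule harmonious_zigzag[OF K m, where S = "2 ^ d" and p = "\<lambda>s. \<phi> (p s)" and T = "\<lambda>i s. \<phi> (T i s)"])
    show "card H = 2 ^ d" using \<phi>(2) inj by (simp add: card_image)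
    show "inj_on (\<lambda>s. (if even s then \<phi> (p s) else \<phi> (p (Suc s mod 2 ^ d))) \<otimes> \<phi> (T 1 s)) {..<2 ^ d}"
      using bot' by (simp only: if_distrib[of \<phi>])
    show "inj_on (\<lambda>s. (if even s then \<phi> (p (Suc s mod 2 ^ d)) else \<phi> (p s)) \<otimes> \<phi> (T (m - 1) s)) {..<2 ^ d}"
      using top' by (simp only: if_distrib[of \<phi>])
    show "inj_on (\<lambda>s. \<phi> (T i s) \<otimes> \<phi> (T (Suc i) s)) {..<2 ^ d}" if "1 \<le> i" "Suc i < m" for i
      by (rule comp2[OF mid[OF that]]) (use T in auto)
    show "inj_on (\<lambda>s. \<phi> (T i s)) {..<2 ^ d}" if "1 \<le> i" "i < m" for i
      by (rule comp[OF T_inj[OF that]]) (use T in auto)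
    show "inj_on (\<lambda>s. \<phi> (p s)) {..<2 ^ d}"
      by (rule comp[OF p_inj]) (use p in auto)
  qed (use d p T \<phi>(2) in auto)
qed

section \<open>Label tables for the kernels Z_2^2 and Z_2^3\<close>

lemma inj_on_lessThan_iff_distinct: "inj_on f {..<n} \<longleftrightarrow> distinct (map f [0..<n])"
  by (simp add: distinct_map atLeast_upt)

lemma (in finite_quotient) harmonious_xor_kernel_2:
  assumes K: "harmonious K" "3 \<le> order K" and \<phi>: "xor_model G 2 \<phi>" "H = \<phi> ` {..<2 ^ 2}"
  shows "harmonious G"
proof -
  \<comment> \<open>Read the numbers below 4 as the field with four elements, generated by 2, where
    3 = 2 + 1. Then \<open>t k\<close> is multiplication by the \<open>k\<close>-th power of the
    generator, and the sum of two different such maps is again multiplication by a nonzero element,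
    hence bijective.\<close>
  define t :: "nat \<Rightarrow> nat \<Rightarrow> nat" where
    "t k s = (if k = 0 then [0, 1, 2, 3] else if k = 1 then [0, 2, 3, 1] else [0, 3, 1, 2]) ! s" for k s
  define T where "T i = t (if i = order K - 1 then 0 else if odd i then 1 else 2)" for i
  \<comment> \<open>Since \<open>order K\<close> is at least 3, coset 1 is not the last one and
    carries \<open>t 1\<close>, while the last carries \<open>t 0\<close>. The values of
    \<open>p\<close> fit these two ends: the sums are 0, 3, 2, 1 on the bottom edge and 2, 3, 1, 0
    on the top edge.\<close>
  define p :: "nat \<Rightarrow> nat" where "p s = [0, 2, 1, 3] ! s" for s
  have t: "t k s < 2 ^ 2" if "s < 2 ^ 2" for k s
    using that by (auto simp: t_def less_Suc_eq numeral_eq_Suc)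
  have ti: "inj_on (t k) {..<2 ^ 2}" for k
    unfolding t_def by (rule inj_on_nth_lessThan) auto
  have tt: "inj_on (\<lambda>s. t k s XOR t l s) {..<2 ^ 2}" if "k < 3" "l < 3" "k \<noteq> l" for k l
  proof -
    have "k = 0 \<and> l = 1 \<or> k = 0 \<and> l = 2 \<or> k = 1 \<and> l = 0 \<or> k = 1 \<and> l = 2 \<or> k = 2 \<and> l = 0 \<or> k = 2 \<and> l = 1"
      using that by (auto simp: less_Suc_eq numeral_eq_Suc)
    then show ?thesis
      unfolding t_def by (elim disjE conjE; simp; intro inj_on_nth_map2; simp)
  qed
  show ?thesis
  proof (rule harmonious_xor_kernel[OF K(1) refl _ \<phi>, where p = p and T = T])
    show "p s < 2 ^ 2" if "s < 2 ^ 2" for s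
      using that by (auto simp: p_def less_Suc_eq numeral_eq_Suc)
    show "inj_on p {..<2 ^ 2}"
      by (simp add: p_def inj_on_lessThan_iff_distinct upt_rec)
    show "inj_on (\<lambda>s. T i s XOR T (Suc i) s) {..<2 ^ 2}" if "1 \<le> i" "Suc i < order K" for i
      unfolding T_def using that by (intro tt) auto
    show "inj_on (\<lambda>s. (if even s then p s else p (Suc s mod 2\<^sup>2)) XOR T 1 s) {..<2\<^sup>2}"
      using K(2) by (simp add: T_def t_def p_def inj_on_lessThan_iff_distinct upt_rec)
    show "inj_on (\<lambda>s. (if even s then p (Suc s mod 2\<^sup>2) else p s) XOR T (order K - 1) s) {..<2\<^sup>2}"
      using K(2) by (simp add: T_def t_def p_def inj_on_lessThan_iff_distinct upt_rec)
  qed (use K t ti in \<open>auto simp: T_def\<close>)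
qed

lemma (in finite_quotient) harmonious_xor_kernel_3:
  assumes K: "harmonious K" "3 \<le> order K" "odd (order K)"
    and \<phi>: "xor_model G 3 \<phi>" "H = \<phi> ` {..<2 ^ 3}"
  shows "harmonious G"
proof -
  \<comment> \<open>In the field with eight elements, with bits as coefficients of polynomials in
    \<open>x\<close> and \<open>x ^ 3 = x + 1\<close>, the value \<open>t False s\<close> is
    \<open>x\<close> times \<open>t True s\<close>. Labels of neighbouring cosets therefore add up
    to \<open>x + 1\<close> times \<open>t True s\<close>.\<close>
  define t :: "bool \<Rightarrow> nat \<Rightarrow> nat" where
    "t b s = (if b then [0, 1, 2, 3, 4, 5, 7, 6] else [0, 2, 4, 6, 3, 1, 5, 7]) ! s" for b s
  \<comment> \<open>Alternation by parity gives coset 1 the table \<open>t True\<close> and, since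
    \<open>order K\<close> is odd, the last coset the table \<open>t False\<close>. The values of
    \<open>p\<close> are made for this pair of ends.\<close>
  define T where "T i = t (odd i)" for i :: nat
  define p :: "nat \<Rightarrow> nat" where "p s = [0, 2, 5, 3, 1, 7, 4, 6] ! s" for s
  have t: "t b s < 2 ^ 3" if "s < 2 ^ 3" for b s
    using that by (auto simp: t_def less_Suc_eq numeral_eq_Suc)
  have ti: "inj_on (t b) {..<2 ^ 3}" for b
    unfolding t_def by (rule inj_on_nth_lessThan) auto
  have tt: "inj_on (\<lambda>s. t b s XOR t (\<not> b) s) {..<2 ^ 3}" for b
    unfolding t_def by (cases b; simp; intro inj_on_nth_map2; simp)
  show ?thesis
  proof (rule harmonious_xor_kernel[OF K(1) refl _ \<phi>, where p = p and T = T])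
    show "p s < 2 ^ 3" if "s < 2 ^ 3" for s
      using that by (auto simp: p_def less_Suc_eq numeral_eq_Suc)
    show "inj_on p {..<2 ^ 3}"
      by (simp add: p_def inj_on_lessThan_iff_distinct upt_rec)
    show "inj_on (\<lambda>s. T i s XOR T (Suc i) s) {..<2 ^ 3}" if "1 \<le> i" "Suc i < order K" for i
      unfolding T_def using tt[of "odd i"] by simp
    show "inj_on (\<lambda>s. (if even s then p s else p (Suc s mod 2 ^ 3)) XOR T 1 s) {..<2 ^ 3}"
      by (simp add: T_def t_def p_def inj_on_lessThan_iff_distinct upt_rec)
    show "inj_on (\<lambda>s. (if even s then p (Suc s mod 2 ^ 3) else p s) XOR T (order K - 1) s) {..<2 ^ 3}"
      using K(2,3) by (simp add: T_def t_def p_def inj_on_lessThan_iff_distinct upt_rec)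
  qed (use K t ti in \<open>auto simp: T_def\<close>)
qed

section \<open>Cyclic subgroups and groups of odd order\<close>

lemma (in group) subgroup_powers:
  assumes "finite (carrier G)" "g \<in> carrier G"
  shows "subgroup ((\<lambda>i::nat. g [^] i) ` UNIV) G"
proof -
  have "(\<lambda>i::nat. g [^] i) ` UNIV = generate G {g}"
    using generate_pow_on_finite_carrier[OF assms] by auto
  then show ?thesis using generate_is_subgroup[of "{g}"] assms(2) by simp
qed

lemma (in group) card_powers:
  assumes "finite (carrier G)" "g \<in> carrier G"
  shows "card ((\<lambda>i::nat. g [^] i) ` UNIV) = ord g"
  using generate_pow_card[OF assms(2)] generate_pow_on_finite_carrier[OF assms]
  by (simp add: full_SetCompr_eq)

lemma (in group) powers_pow_ord:
  assumes "g \<in> carrier G" "h \<in> (\<lambda>i::nat. g [^] i) ` UNIV"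
  shows "h [^] ord g = \<one>"
proof -
  obtain i :: nat where "h = g [^] i" using assms(2) by blast
  then show ?thesis using assms(1) by (simp add: nat_pow_pow pow_eq_id)
qed

lemma (in group) ord_pos: "finite (carrier G) \<Longrightarrow> x \<in> carrier G \<Longrightarrow> 0 < ord x"
  using ord_ge_1 by fastforce

text \<open>Any nontrivial element generates a cyclic kernel of odd order, so the cyclic step alone
  leads down to the trivial group, whose sequence of length one is harmonious.\<close>

theorem odd_order_harmonious:
  fixes G :: "'a monoid"
  assumes "comm_group G" "finite (carrier G)" "odd (order G)"
  shows "harmonious G"
  using assms
proof (induction "order G" arbitrary: G rule: less_induct)
  case less
  interpret comm_group G by (rule less.prems(1))
  note fin = less.prems(2)
  show ?case
  proof (cases "order G = 1")
    case True
    then show ?thesis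
      unfolding harmonious_def by (intro exI[of _ "\<lambda>_. \<one>\<^bsub>G\<^esub>"]) (simp add: inj_on_def)
  next
    case False
    then have "carrier G \<noteq> {\<one>\<^bsub>G\<^esub>}" by (auto simp: order_def)
    then obtain g where g: "g \<in> carrier G" "g \<noteq> \<one>\<^bsub>G\<^esub>" using one_closed by blast
    let ?H = "(\<lambda>i::nat. g [^]\<^bsub>G\<^esub> i) ` UNIV"
    obtain K :: "'a monoid" and \<pi> where "finite_quotient G K \<pi> ?H"
      using quotient_copy[OF fin subgroup_powers[OF fin g(1)]] .
    then interpret q: finite_quotient G K \<pi> ?H .
    have "finite ?H" using q.H_subset fin finite_subset by blast
    moreover have "{\<one>\<^bsub>G\<^esub>, g} \<subseteq> ?H"
      using g(1) nat_pow_0[of g] nat_pow_eone[of g] by (metis empty_subsetI insert_subset rangeI)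
    ultimately have "card ?H \<ge> 2"
      using g(2) card_mono[of ?H "{\<one>\<^bsub>G\<^esub>, g}"] by simp
    then have "order K < order G" "odd (order K)"
      using q.order_eq q.order_K_pos less.prems(3) by auto
    then have "harmonious K"
      using less.hyps q.K.comm_group_axioms q.finite_K by blast
    moreover have "odd (ord g)"
      using ord_dvd_group_order[OF g(1)] less.prems(3) dvd_trans by blast
    ultimately show ?thesis
      using q.harmonious_odd_cyclic_kernel[OF _ g(1) _ refl] by blast
  qed
qed

section \<open>Two-torsion\<close>

lemma (in monoid) odd_pow_involution:
  assumes "x \<in> carrier G" "x \<otimes> x = \<one>" "odd (k::nat)"
  shows "x [^] k = x"
proof -
  obtain j where k: "k = Suc (2 * j)" using assms(3) oddE by fastforce
  have "x [^] (2::nat) = \<one>" using assms by (simp add: numeral_2_eq_2)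
  then have "x [^] (2 * j) = \<one>" using assms(1) by (metis nat_pow_one nat_pow_pow)
  then show ?thesis using k assms(1) by simp
qed

lemma (in comm_group) square_distrib:
  "x \<in> carrier G \<Longrightarrow> y \<in> carrier G \<Longrightarrow> (x \<otimes> y) \<otimes> (x \<otimes> y) = (x \<otimes> x) \<otimes> (y \<otimes> y)"
  by (simp add: m_ac)

lemma (in comm_group) subgroup_two_torsion: "subgroup (two_torsion G) G"
proof (rule subgroupI)
  fix a b assume "a \<in> two_torsion G" "b \<in> two_torsion G"
  then show "a \<otimes> b \<in> two_torsion G" "inv a \<in> two_torsion G"
    by (auto simp: two_torsion_def square_distrib simp flip: inv_mult)
qed (auto simp: two_torsion_def)

lemma (in comm_group) two_torsion_inv: "x \<in> two_torsion G \<Longrightarrow> inv x = x"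
  by (auto simp: two_torsion_def inv_equality)

lemma (in comm_group) squares_eq_iff:
  assumes "x \<in> carrier G" "y \<in> carrier G"
  shows "x \<otimes> x = y \<otimes> y \<longleftrightarrow> x \<otimes> inv y \<in> two_torsion G"
proof -
  have "(x \<otimes> inv y) \<otimes> (x \<otimes> inv y) = (x \<otimes> x) \<otimes> inv (y \<otimes> y)"
    using assms by (simp add: square_distrib inv_mult)
  then have "x \<otimes> inv y \<in> two_torsion G \<longleftrightarrow> (x \<otimes> x) \<otimes> inv (y \<otimes> y) = \<one>"
    using assms by (simp add: two_torsion_def)
  also have "\<dots> \<longleftrightarrow> x \<otimes> x = y \<otimes> y"
    using assms inv_solve_right'[of \<one> "x \<otimes> x" "y \<otimes> y"] by auto
  finally show ?thesis by simp
qed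

lemma (in comm_group) card_two_torsion_power:
  assumes "finite (carrier G)"
  obtains d where "card (two_torsion G) = 2 ^ d"
proof -
  obtain d \<phi> where \<phi>: "xor_model G d \<phi>" "\<phi> ` {..<2 ^ d} = two_torsion G"
    using xor_model_two_torsion[OF assms] .
  then show thesis using xor_modelD(5)[OF \<phi>(1)] by (intro that[of d]) simp
qed

lemma (in finite_quotient) proj_two_torsion: "x \<in> two_torsion G \<Longrightarrow> \<pi> x \<in> two_torsion K"
  by (auto simp: two_torsion_def simp flip: hom_mult)

text \<open>An element of \<open>H\<close> whose square is trivial equals its own
  \<open>q\<close>-th power, hence is trivial. Conversely, if \<open>y\<close> has trivial square,
  the \<open>q\<close>-th power of any preimage of \<open>y\<close> has trivial square too, and it
  still lies over \<open>y\<close> because \<open>q\<close> is odd.\<close>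

lemma (in finite_quotient) two_torsion_odd_kernel:
  assumes q: "odd q" "\<And>h. h \<in> H \<Longrightarrow> h [^] (q::nat) = \<one>"
  shows "bij_betw \<pi> (two_torsion G) (two_torsion K)"
proof -
  have "inj_on \<pi> (two_torsion G)"
  proof (rule inj_onI)
    fix x y assume xy: "x \<in> two_torsion G" "y \<in> two_torsion G" "\<pi> x = \<pi> y"
    let ?w = "x \<otimes> inv y"
    have c: "x \<in> carrier G" "y \<in> carrier G" using xy by (auto simp: two_torsion_def)
    have "?w \<in> H" using xy(3) c proj_eq_iff by blast
    moreover have "?w \<in> two_torsion G"
      using xy G.subgroup_two_torsion by (meson subgroup.m_closed subgroup.m_inv_closed)
    ultimately have "?w = \<one>"
      using q G.odd_pow_involution[of ?w q] by (simp add: two_torsion_def)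
    then show "x = y" using c G.inv_solve_right'[of \<one> x y] by auto
  qed
  moreover have "two_torsion K \<subseteq> \<pi> ` two_torsion G"
  proof
    fix y assume y: "y \<in> two_torsion K"
    then obtain x where x: "x \<in> carrier G" "\<pi> x = y"
      using lift_exists by (auto simp: two_torsion_def)
    have "\<pi> (x \<otimes> x) = \<one>\<^bsub>K\<^esub>" using x y by (simp add: two_torsion_def)
    then have "(x \<otimes> x) [^] q = \<one>" using q(2) ker x(1) by blast
    then have "x [^] q \<otimes> x [^] q = \<one>" using x(1) by (simp add: G.pow_mult_distrib G.m_comm)
    then have "x [^] q \<in> two_torsion G" using x(1) by (simp add: two_torsion_def)
    moreover have "\<pi> (x [^] q) = y"
      using x y q(1) K.odd_pow_involution[of y q] hom_nat_pow[of x q] by (simp add: two_torsion_def)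
    ultimately show "y \<in> \<pi> ` two_torsion G" by blast
  qed
  ultimately show ?thesis
    using proj_two_torsion by (auto simp: bij_betw_def)
qed

text \<open>Squaring is a homomorphism with kernel the two-torsion, so cosets correspond to squares.
  Counting squares thus determines the order of the quotient and then that of
  \<open>G\<close>.\<close>

lemma (in finite_quotient) order_two_torsion_quotient:
  assumes "H = two_torsion G"
  shows "order K = card ((\<lambda>x. x \<otimes> x) ` carrier G)"
proof -
  let ?sq = "\<lambda>x. x \<otimes> x"
  define r where "r y = (SOME x. x \<in> carrier G \<and> \<pi> x = y)" for y
  have r: "r y \<in> carrier G" "\<pi> (r y) = y" if "y \<in> carrier K" for y
    unfolding r_def using someI_ex[OF lift_exists[OF that, unfolded Bex_def]] by auto
  have eq: "?sq a = ?sq b \<longleftrightarrow> \<pi> a = \<pi> b" if "a \<in> carrier G" "b \<in> carrier G" for a b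
    using that assms proj_eq_iff G.squares_eq_iff by blast
  have "bij_betw (\<lambda>y. ?sq (r y)) (carrier K) (?sq ` carrier G)"
  proof (rule bij_betwI')
    fix y z assume "y \<in> carrier K" "z \<in> carrier K"
    then show "(?sq (r y) = ?sq (r z)) = (y = z)" using eq r by metis
  next
    fix y assume "y \<in> carrier K"
    then show "?sq (r y) \<in> ?sq ` carrier G" using r by blast
  next
    fix w assume "w \<in> ?sq ` carrier G"
    then obtain x where x: "x \<in> carrier G" "w = ?sq x" by blast
    then have "w = ?sq (r (\<pi> x))" using eq[of x "r (\<pi> x)"] r[of "\<pi> x"] hom_closed by auto
    then show "\<exists>y\<in>carrier K. w = ?sq (r y)" using x(1) hom_closed by blast
  qed
  then show ?thesis by (simp add: bij_betw_same_card order_def)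
qed

text \<open>Bit 0 of the list position stands for \<open>e\<close> and bit 1 for \<open>f\<close>,
  so exclusive or of positions is the product.\<close>

lemma (in comm_group) klein_model:
  assumes "e \<in> two_torsion G" "f \<in> two_torsion G" "e \<noteq> \<one>" "f \<noteq> \<one>" "e \<noteq> f"
  shows "xor_model G 2 (\<lambda>i. [\<one>, e, f, e \<otimes> f] ! i)"
    "(\<lambda>i. [\<one>, e, f, e \<otimes> f] ! i) ` {..<2 ^ 2} = {\<one>, e, f, e \<otimes> f}"
proof -
  have four: "{..<2 ^ 2} = {0, 1, 2, 3::nat}" by auto
  have c: "e \<in> carrier G" "f \<in> carrier G" "e \<otimes> e = \<one>" "f \<otimes> f = \<one>"
    using assms by (auto simp: two_torsion_def)
  have ne: "e \<otimes> f \<noteq> \<one>" "e \<otimes> f \<noteq> e" "e \<otimes> f \<noteq> f"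
    using assms c by (metis inv_equality inv_inv, simp_all)
  have m: "e \<otimes> (e \<otimes> f) = f" "f \<otimes> (e \<otimes> f) = e" "e \<otimes> f \<otimes> e = f" "e \<otimes> f \<otimes> f = e"
      "e \<otimes> f \<otimes> (e \<otimes> f) = \<one>" "f \<otimes> e = e \<otimes> f"
    using c by (simp_all add: square_distrib m_comm[of f e] m_assoc flip: m_assoc[of e e f])
      (simp_all add: m_lcomm[of f e f] m_comm[of f e] flip: m_assoc[of e e f])
  show "(\<lambda>i. [\<one>, e, f, e \<otimes> f] ! i) ` {..<2 ^ 2} = {\<one>, e, f, e \<otimes> f}"
    unfolding four by simp
  show "xor_model G 2 (\<lambda>i. [\<one>, e, f, e \<otimes> f] ! i)"
    unfolding group_model_def four
    using assms c ne m by (auto simp: inj_on_def)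
qed

text \<open>Bundles the quotient with its lifting step, so that later arguments pick a Klein
  subgroup and discuss only what is left of the group.\<close>

lemma (in comm_group) klein_quotient:
  assumes fin: "finite (carrier G)"
    and ef: "e \<in> two_torsion G" "f \<in> two_torsion G" "e \<noteq> \<one>" "f \<noteq> \<one>" "e \<noteq> f"
  obtains K :: "'a monoid" and \<pi> where "finite_quotient G K \<pi> {\<one>, e, f, e \<otimes> f}"
    "order G = order K * 4" "harmonious K \<and> 3 \<le> order K \<longrightarrow> harmonious G"
proof -
  note model = klein_model[OF ef]
  let ?L = "{\<one>, e, f, e \<otimes> f}"
  have L: "?L \<subseteq> two_torsion G"
    using ef subgroup_two_torsion by (auto intro: subgroup.m_closed subgroup.one_closed)
  have cl: "a \<otimes> b \<in> ?L" if "a \<in> ?L" "b \<in> ?L" for a b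
  proof -
    have "a \<in> (\<lambda>i. [\<one>, e, f, e \<otimes> f] ! i) ` {..<2 ^ 2}" "b \<in> (\<lambda>i. [\<one>, e, f, e \<otimes> f] ! i) ` {..<2 ^ 2}"
      unfolding model(2) using that .
    then obtain i j where "i \<in> {..<2 ^ 2}" "a = [\<one>, e, f, e \<otimes> f] ! i" "j \<in> {..<2 ^ 2}" "b = [\<one>, e, f, e \<otimes> f] ! j"
      by (elim imageE) blast
    then have "a \<otimes> b = [\<one>, e, f, e \<otimes> f] ! (i XOR j)" "i XOR j \<in> {..<2 ^ 2}"
      using model(1) by (simp_all add: group_model_def)
    then show ?thesis using imageI[of "i XOR j" "{..<2 ^ 2}" "\<lambda>i. [\<one>, e, f, e \<otimes> f] ! i"]
      unfolding model(2) by simp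
  qed
  have "subgroup ?L G"
  proof (rule subgroupI)
    show "?L \<subseteq> carrier G" using L by (auto simp: two_torsion_def)
    show "inv a \<in> ?L" if "a \<in> ?L" for a
      using two_torsion_inv that L by (metis subsetD)
    show "a \<otimes> b \<in> ?L" if "a \<in> ?L" "b \<in> ?L" for a b by (rule cl[OF that])
  qed simp
  then obtain K :: "'a monoid" and \<pi> where K: "finite_quotient G K \<pi> ?L"
    using quotient_copy[OF fin] by blast
  then interpret q: finite_quotient G K \<pi> ?L .
  have "card ?L = card {..<(2::nat) ^ 2}"
    using model by (metis (no_types, lifting) card_image group_model_def)
  then have "order G = order K * 4" using q.order_eq by simp
  then show thesis
    using that[OF K] q.harmonious_xor_kernel_2[OF _ _ model(1) model(2)[symmetric]] by blast
qed

section \<open>The groups \<open>Z\<^sub>2 \<times> Z\<^sub>n\<close> for \<open>n\<close> a power of two\<close>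

text \<open>Addition in Z_2 x Z_n. Projections instead of pair patterns let it unfold at terms such
  as \<open>x i\<close> that are not literal pairs.\<close>

definition add2 :: "nat \<Rightarrow> nat \<times> nat \<Rightarrow> nat \<times> nat \<Rightarrow> nat \<times> nat" where
  "add2 n p q = ((fst p + fst q) mod 2, (snd p + snd q) mod n)"

lemma double_mod: "(2 * a) mod (2 * n) = 2 * (a mod (n::nat))"
  by (rule mod_mult_mult1)

lemma double_Suc_mod: "Suc (2 * a) mod (2 * n) = Suc (2 * (a mod (n::nat)))" if "0 < n"
proof -
  have "Suc (2 * a) mod (2 * n) = Suc ((2 * a) mod (2 * n)) mod (2 * n)" by (metis mod_Suc_eq)
  also have "\<dots> = Suc (2 * (a mod n)) mod (2 * n)" by (simp add: double_mod)
  also have "\<dots> = Suc (2 * (a mod n))"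
  proof -
    have "a mod n < n" using that by simp
    then show ?thesis by (intro mod_less) linarith
  qed
  finally show ?thesis .
qed

text \<open>
  The parity condition on the sums at odd positions is what makes the doubling step work: those
  sums occur in the doubled sequence both shifted by two and unshifted.
\<close>

lemma alternating_Z2_power:
  assumes "3 \<le> a"
  shows "\<exists>x. (\<forall>i<2 * 2 ^ a. x i \<in> {..<2} \<times> {..<2 ^ a}) \<and> inj_on x {..<2 * 2 ^ a} \<and>
    inj_on (\<lambda>i. add2 (2 ^ a) (x i) (x (Suc i mod (2 * 2 ^ a)))) {..<2 * 2 ^ a} \<and>
    (\<forall>i<2 * 2 ^ a. odd i \<longrightarrow> even (snd (x i) + snd (x (Suc i mod (2 * 2 ^ a)))))"
  using assms
proof (induction a rule: dec_induct)
  case base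
  let ?xs = "[(0, 0), (1, 3), (0, 3), (1, 2), (1, 0), (0, 7), (1, 5), (1, 6), (0, 2), (1, 7), (1, 1),
     (1, 4), (0, 6), (0, 1), (0, 5), (0, 4)] :: (nat \<times> nat) list"
  have lt: "i \<in> {0, 1, 2, 3, 4, 5, 6, 7, 8, 9, 10, 11, 12, 13, 14, 15}" if "i < 16" for i :: nat
    using that by (auto simp: less_Suc_eq numeral_eq_Suc)
  have "\<forall>i\<in>{0, 1, 2, 3, 4, 5, 6, 7, 8, 9, 10, 11, 12, 13, 14, 15::nat}. ?xs ! i \<in> {..<2} \<times> {..<8} \<and>
      (odd i \<longrightarrow> even (snd (?xs ! i) + snd (?xs ! (Suc i mod 16))))"
    by simp
  then have "\<forall>i<16. ?xs ! i \<in> {..<2} \<times> {..<8}"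
    "\<forall>i<16. odd i \<longrightarrow> even (snd (?xs ! i) + snd (?xs ! (Suc i mod 16)))"
    using lt by blast+
  moreover have "inj_on (\<lambda>i. ?xs ! i) {..<16}" "inj_on (\<lambda>i. add2 8 (?xs ! i) (?xs ! (Suc i mod 16))) {..<16}"
    by (rule cyclic_list_inj; simp add: add2_def)+
  ultimately show ?case by (intro exI[of _ "\<lambda>i. ?xs ! i"]) simp
next
  case (step a)
  define n :: nat where "n = 2 ^ a"
  have n: "0 < n" "even n" using step.hyps by (auto simp: n_def)
  obtain x where x: "\<And>i. i < 2 * n \<Longrightarrow> x i \<in> {..<2} \<times> {..<n}" "inj_on x {..<2 * n}"
      "inj_on (\<lambda>i. add2 n (x i) (x (Suc i mod (2 * n)))) {..<2 * n}"
      "\<And>i. i < 2 * n \<Longrightarrow> odd i \<Longrightarrow> even (snd (x i) + snd (x (Suc i mod (2 * n))))"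
    using step.IH unfolding n_def by blast
  define s where "s i = add2 n (x i) (x (Suc i mod (2 * n)))" for i
  \<comment> \<open>The block at \<open>4 * i\<close> runs through the old indices
    \<open>2 * i\<close>, \<open>2 * i + 1\<close>, \<open>2 * i + 2\<close>,
    \<open>2 * i + 1\<close> with new low bits 0, 1, 1, 0, and the next block starts at
    \<open>2 * i + 2\<close> with bit 0. So every old index occurs once with each bit. An old edge
    with even index is used once, its low bits adding to 1; one with odd index is used three times,
    with low bits adding to 2, 1 and 0.\<close>
  define k where "k j = (if j mod 4 = 0 then j div 2 else if j mod 4 = 2 then Suc (j div 2) mod (2 * n) else
      2 * (j div 4) + 1)" for j :: nat
  define b where "b j = (if j mod 4 = 1 \<or> j mod 4 = 2 then 1 else 0 :: nat)" for j :: nat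
  define z where "z j = (fst (x (k j)), 2 * snd (x (k j)) + b j)" for j
  have four: "\<exists>i. j = 4 * i \<or> j = 4 * i + 1 \<or> j = 4 * i + 2 \<or> j = 4 * i + 3" for j :: nat
    by presburger
  have kb: "k (4 * i) = 2 * i" "k (4 * i + 1) = 2 * i + 1" "k (4 * i + 2) = (2 * i + 2) mod (2 * n)"
      "k (4 * i + 3) = 2 * i + 1" "b (4 * i) = 0" "b (4 * i + 1) = 1" "b (4 * i + 2) = 1" "b (4 * i + 3) = 0" for i
  proof -
    have "(4 * i + 1) mod 4 = 1" "(4 * i + 2) mod 4 = 2" "(4 * i + 3) mod 4 = 3"
      "(4 * i + 1) div 4 = i" "(4 * i + 2) div 2 = 2 * i + 1" "(4 * i + 3) div 4 = i" by presburger+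
    then show "k (4 * i) = 2 * i" "k (4 * i + 1) = 2 * i + 1" "k (4 * i + 2) = (2 * i + 2) mod (2 * n)"
      "k (4 * i + 3) = 2 * i + 1" "b (4 * i) = 0" "b (4 * i + 1) = 1" "b (4 * i + 2) = 1" "b (4 * i + 3) = 0"
      unfolding k_def b_def by simp_all
  qed
  have klt: "k j < 2 * n" if "j < 4 * n" for j
  proof -
    obtain i where i: "j = 4 * i \<or> j = 4 * i + 1 \<or> j = 4 * i + 2 \<or> j = 4 * i + 3"
      using four by blast
    then have "i < n" using that by linarith
    then show ?thesis using i by (elim disjE) (simp_all only: kb, auto)
  qed
  have zz: "z j \<in> {..<2} \<times> {..<2 * n}" if "j < 4 * n" for j
    using x(1)[OF klt[OF that]] by (auto simp: z_def b_def mem_Times_iff)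
  \<comment> \<open>Index 0 with low bit 1 is the wrap-around: it occurs in the last block, at
    position \<open>4 * n - 2\<close>.\<close>
  have decode: "j = (if b j = 0 then (if even (k j) then 2 * k j else 2 * k j + 1)
      else if odd (k j) then 2 * k j - 1 else if k j = 0 then 4 * n - 2 else 2 * k j - 2)"
    if "j < 4 * n" for j
  proof -
    obtain i where i: "j = 4 * i \<or> j = 4 * i + 1 \<or> j = 4 * i + 2 \<or> j = 4 * i + 3"
      using four by blast
    have "(2 * i + 2) mod (2 * n) = (if Suc i = n then 0 else 2 * i + 2)" if "i < n"
      using that by auto
    moreover have "i < n" using i that by linarith
    ultimately show ?thesis using i by (elim disjE) (simp_all only: kb, auto)
  qed
  have kb_inj: "i = j" if "i < 4 * n" "j < 4 * n" "k i = k j" "b i = b j" for i j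
    using decode[OF that(1), unfolded that(3,4)] decode[OF that(2)] by (rule trans[OF _ sym])
  have z_inj: "inj_on z {..<4 * n}"
  proof (rule inj_onI)
    fix i j assume ij: "i \<in> {..<4 * n}" "j \<in> {..<4 * n}" "z i = z j"
    have "b l = snd (z l) mod 2" for l by (auto simp: z_def b_def)
    then have "b i = b j" using ij(3) by simp
    moreover from this have "x (k i) = x (k j)" using ij(3) by (simp add: z_def prod_eq_iff)
    then have "k i = k j" using x(2) klt ij by (auto dest: inj_onD)
    ultimately show "i = j" using kb_inj ij by simp
  qed
  have k_next: "Suc (4 * i + 3) mod (4 * n) = (if Suc i = n then 0 else 4 * Suc i)"
      "(2 * i + 2) mod (2 * n) = (if Suc i = n then 0 else 2 * Suc i)" if "i < n" for i
    using that by auto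
  have sums: "add2 (2 * n) (z (2 * j)) (z (Suc (2 * j) mod (4 * n))) = (fst (s j), Suc (2 * snd (s j)))"
    "odd j \<Longrightarrow> add2 (2 * n) (z (2 * j - 1)) (z (Suc (2 * j - 1) mod (4 * n))) =
       (fst (s j), (2 * snd (s j) + 2) mod (2 * n))"
    "odd j \<Longrightarrow> add2 (2 * n) (z (2 * j + 1)) (z (Suc (2 * j + 1) mod (4 * n))) = (fst (s j), 2 * snd (s j))"
    if "j < 2 * n" for j
  proof -
    have "j = 2 * (j div 2) \<or> j = 2 * (j div 2) + 1" by presburger
    then obtain i where i: "j = 2 * i \<or> j = 2 * i + 1" by blast
    have iN: "i < n" using i that by linarith
    have sj: "Suc (2 * j) mod (4 * n) = Suc (2 * j)" using that by simp
    have sj2: "Suc j mod (2 * n) = k (4 * i + 2)" if "j = 2 * i + 1"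
      using that by (simp add: kb[simplified])
    have modn: "(2 * p + 2 * q) mod (2 * n) = 2 * ((p + q) mod n)" for p q
      using double_mod[of "p + q" n] by (simp add: distrib_left)
    have modS: "Suc (2 * p + 2 * q) mod (2 * n) = Suc (2 * ((p + q) mod n))" for p q
      using double_Suc_mod[OF n(1), of "p + q"] by (simp add: distrib_left)
    have mod2: "Suc (Suc (2 * p + 2 * q)) mod (2 * n) = Suc (Suc (2 * ((p + q) mod n))) mod (2 * n)" for p q
      by (metis modn mod_Suc_eq)
    show "add2 (2 * n) (z (2 * j)) (z (Suc (2 * j) mod (4 * n))) = (fst (s j), Suc (2 * snd (s j)))"
    proof (cases "j = 2 * i")
      case True
      have "2 * j = 4 * i" "Suc (2 * j) = 4 * i + 1" "Suc j mod (2 * n) = 2 * i + 1"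
        using True iN by auto
      then show ?thesis
        using True sj by (simp add: z_def add2_def s_def kb[simplified] modS)
    next
      case False
      with i have j: "j = 2 * i + 1" by simp
      have "2 * j = 4 * i + 2" "Suc (2 * j) = 4 * i + 3" using j by auto
      moreover have k3: "k (Suc (Suc (Suc (4 * i)))) = Suc (2 * i)" "b (Suc (Suc (Suc (4 * i)))) = 0"
        using kb(4,8)[of i] by (simp_all add: numeral_3_eq_3)
      ultimately show ?thesis
        using j sj sj2 k3 by (simp add: z_def add2_def s_def kb[simplified] modS) (simp add: add.commute)
    qed
    assume "odd j"
    with i have j: "j = 2 * i + 1" by auto
    have "2 * j - 1 = 4 * i + 1" "Suc (2 * j - 1) mod (4 * n) = 4 * i + 2" using j iN by auto
    then show "add2 (2 * n) (z (2 * j - 1)) (z (Suc (2 * j - 1) mod (4 * n))) =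
       (fst (s j), (2 * snd (s j) + 2) mod (2 * n))"
      using j sj2 by (simp add: z_def add2_def s_def kb[simplified] mod2)
    have j3: "2 * j + 1 = 4 * i + 3" using j by simp
    have "k (Suc (4 * i + 3) mod (4 * n)) = k (4 * i + 2)" "b (Suc (4 * i + 3) mod (4 * n)) = 0"
      using k_next[OF iN] kb[of 0] kb[of "Suc i"] kb(3)[of i] by auto
    then show "add2 (2 * n) (z (2 * j + 1)) (z (Suc (2 * j + 1) mod (4 * n))) = (fst (s j), 2 * snd (s j))"
      unfolding j3 using j sj2 by (simp add: z_def add2_def s_def kb[simplified] modn)
  qed
  have s_inj: "i = j" if "s i = s j" "i < 2 * n" "j < 2 * n" for i j
    using x(3) that by (auto simp: s_def dest: inj_onD)
  have s_even: "even (snd (s j))" if "j < 2 * n" "odd j" for j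
    using x(4)[OF that] n(2) by (simp add: s_def add2_def dvd_mod_iff)
  have s_lt: "snd (s j) < n" for j using n by (simp add: s_def add2_def)
  define \<sigma> where "\<sigma> j = add2 (2 * n) (z j) (z (Suc j mod (4 * n)))" for j
  have \<sigma>0: "\<sigma> j = (fst (s (j div 2)), Suc (2 * snd (s (j div 2))))" if "j < 4 * n" "even j" for j
    using sums(1)[of "j div 2"] that by (simp add: \<sigma>_def)
  have \<sigma>1: "\<sigma> j = (fst (s (Suc (j div 2))), 2 * (Suc (snd (s (Suc (j div 2)))) mod n))"
      "odd (Suc (j div 2))" "Suc (j div 2) < 2 * n" if jj: "j < 4 * n" "j mod 4 = 1" for j
  proof -
    obtain i where i: "j = 4 * i + 1" using jj(2) by (metis div_mult_mod_eq mult.commute)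
    then have J: "Suc (j div 2) = 2 * i + 1" "2 * Suc (j div 2) - 1 = j" by auto
    have "i < n" using jj(1) i by linarith
    then show l: "Suc (j div 2) < 2 * n" "odd (Suc (j div 2))" using J by auto
    show "\<sigma> j = (fst (s (Suc (j div 2))), 2 * (Suc (snd (s (Suc (j div 2)))) mod n))"
      using sums(2)[OF l] double_mod[of "Suc (snd (s (Suc (j div 2))))" n] unfolding J(2) by (simp add: \<sigma>_def)
  qed
  have \<sigma>3: "\<sigma> j = (fst (s (j div 2)), 2 * snd (s (j div 2)))"
      "odd (j div 2)" "j div 2 < 2 * n" if jj: "j < 4 * n" "j mod 4 = 3" for j
  proof -
    obtain i where i: "j = 4 * i + 3" using jj(2) by (metis div_mult_mod_eq mult.commute)
    then have J: "j div 2 = 2 * i + 1" "2 * (j div 2) + 1 = j" by auto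
    have "i < n" using jj(1) i by linarith
    then show l: "j div 2 < 2 * n" "odd (j div 2)" using J by auto
    show "\<sigma> j = (fst (s (j div 2)), 2 * snd (s (j div 2)))"
      using sums(3)[OF l] unfolding J(2) by (simp add: \<sigma>_def)
  qed
  \<comment> \<open>The second coordinate reveals the kind of position. Odd values come from even
    positions, where all old sums appear as \<open>2 * s + 1\<close>. At odd positions the old sum
    is even by the induction hypothesis, so \<open>2 * s\<close> is a multiple of 4 and
    \<open>2 * s + 2\<close> is not; as \<open>n\<close> is even, reduction modulo
    \<open>2 * n\<close> preserves this.\<close>
  have \<sigma>_class: "even j \<longleftrightarrow> odd (snd (\<sigma> j))" "j mod 4 = 3 \<longleftrightarrow> 4 dvd snd (\<sigma> j)" if "j < 4 * n" for j
  proof -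
    have dvd4: "4 dvd 2 * k \<longleftrightarrow> even k" for k :: nat by presburger
    have "even j \<or> j mod 4 = 1 \<or> j mod 4 = 3" by presburger
    then consider "even j" | "j mod 4 = 1" | "j mod 4 = 3" by blast
    then have "(even j \<longleftrightarrow> odd (snd (\<sigma> j))) \<and> (j mod 4 = 3 \<longleftrightarrow> 4 dvd snd (\<sigma> j))"
    proof cases
      case 1
      have "odd (snd (\<sigma> j))" using \<sigma>0[OF that 1] by simp
      moreover from this have "\<not> 4 dvd snd (\<sigma> j)" by presburger
      ultimately show ?thesis using 1 by presburger
    next
      case 2
      then have "odd (Suc (snd (s (Suc (j div 2)))) mod n)"
        using s_even \<sigma>1(2,3)[OF that 2] n(2) by (simp add: dvd_mod_iff)
      moreover have "odd j" using 2 by presburger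
      ultimately show ?thesis using 2 \<sigma>1(1)[OF that 2] by (simp add: dvd4)
    next
      case 3
      moreover from this have "odd j" by presburger
      ultimately show ?thesis using s_even \<sigma>3[OF that 3] by (simp add: dvd4)
    qed
    then show "even j \<longleftrightarrow> odd (snd (\<sigma> j))" "j mod 4 = 3 \<longleftrightarrow> 4 dvd snd (\<sigma> j)" by auto
  qed
  have odd_decomp: "j = 2 * (j div 2) + 1" if "j mod 4 = 1 \<or> j mod 4 = 3" for j :: nat
    using that by presburger
  have "inj_on \<sigma> {..<4 * n}"
  proof (rule inj_onI)
    fix i j assume ij: "i \<in> {..<4 * n}" "j \<in> {..<4 * n}" "\<sigma> i = \<sigma> j"
    then have l: "i < 4 * n" "j < 4 * n" by auto
    have cl: "even i \<longleftrightarrow> even j" "i mod 4 = 3 \<longleftrightarrow> j mod 4 = 3"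
      using \<sigma>_class[OF l(1)] \<sigma>_class[OF l(2)] ij(3) by auto
    have "even i \<and> even j \<or> i mod 4 = 1 \<and> j mod 4 = 1 \<or> i mod 4 = 3 \<and> j mod 4 = 3"
      using cl by presburger
    then consider "even i" "even j" | "i mod 4 = 1" "j mod 4 = 1" | "i mod 4 = 3" "j mod 4 = 3"
      by blast
    then show "i = j"
    proof cases
      case 1
      then have "s (i div 2) = s (j div 2)"
        using \<sigma>0[OF l(1) 1(1)] \<sigma>0[OF l(2) 1(2)] ij(3) by (simp add: prod_eq_iff)
      then have "i div 2 = j div 2" using s_inj[of "i div 2" "j div 2"] l by simp
      then show ?thesis using 1 by (metis dvd_mult_div_cancel)
    next
      case 2
      have mod_eq: "p = q" if "Suc p mod n = Suc q mod n" "p < n" "q < n" for p q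
        using that by (auto simp: mod_Suc split: if_splits)
      have *: "fst (s (Suc (i div 2))) = fst (s (Suc (j div 2)))"
        "Suc (snd (s (Suc (i div 2)))) mod n = Suc (snd (s (Suc (j div 2)))) mod n"
        using \<sigma>1(1)[OF l(1) 2(1)] \<sigma>1(1)[OF l(2) 2(2)] ij(3) by simp_all
      have "s (Suc (i div 2)) = s (Suc (j div 2))"
        by (rule prod_eqI[OF *(1) mod_eq[OF *(2) s_lt s_lt]])
      then have "Suc (i div 2) = Suc (j div 2)"
        using \<sigma>1(3)[OF l(1) 2(1)] \<sigma>1(3)[OF l(2) 2(2)] by (rule s_inj)
      then show ?thesis using odd_decomp[of i] odd_decomp[of j] 2 by simp
    next
      case 3
      then have "s (i div 2) = s (j div 2)"
        using \<sigma>3(1)[OF l(1) 3(1)] \<sigma>3(1)[OF l(2) 3(2)] ij(3) by (simp add: prod_eq_iff)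
      then have "i div 2 = j div 2"
        using \<sigma>3(3)[OF l(1) 3(1)] \<sigma>3(3)[OF l(2) 3(2)] by (rule s_inj)
      then show ?thesis using odd_decomp[of i] odd_decomp[of j] 3 by simp
    qed
  qed
  moreover have "even (snd (z i) + snd (z (Suc i mod (4 * n))))" if "i < 4 * n" "odd i" for i
    using \<sigma>_class(1)[OF that(1)] that(2) by (simp add: \<sigma>_def add2_def dvd_mod_iff)
  ultimately have "(\<forall>i<4 * n. z i \<in> {..<2} \<times> {..<2 * n}) \<and> inj_on z {..<4 * n} \<and>
      inj_on (\<lambda>i. add2 (2 * n) (z i) (z (Suc i mod (4 * n)))) {..<4 * n} \<and>
      (\<forall>i<4 * n. odd i \<longrightarrow> even (snd (z i) + snd (z (Suc i mod (4 * n)))))"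
    using zz z_inj unfolding \<sigma>_def by blast
  moreover have "2 * 2 ^ Suc a = 4 * n" "2 ^ Suc a = 2 * n" by (simp_all add: n_def)
  ultimately show ?case by (simp only:) (rule exI[of _ z])
qed

lemma harmonious_Z2_power:
  assumes "group_model G ({..<2} \<times> {..<2 ^ a}) (add2 (2 ^ a)) \<phi>" "2 \<le> a" "order G = 2 * 2 ^ a"
  shows "harmonious G"
proof (cases "a = 2")
  case True
  \<comment> \<open>The second coordinates at positions 1 and 2 have the odd sum 3, so this sequence
    violates the parity condition and cannot start the recursion, which begins one exponent
    higher.\<close>
  let ?xs = "[(0, 0), (0, 1), (0, 2), (1, 0), (1, 2), (0, 3), (1, 1), (1, 3)] :: (nat \<times> nat) list"
  show ?thesis
    by (rule harmonious_model_list[OF assms(1), where xs = ?xs])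
      (use True assms(3) in \<open>auto simp: add2_def\<close>)
next
  case False
  then obtain x where x: "\<forall>i<2 * 2 ^ a. x i \<in> {..<2} \<times> {..<2 ^ a}" "inj_on x {..<2 * 2 ^ a}"
    "inj_on (\<lambda>i. add2 (2 ^ a) (x i) (x (Suc i mod (2 * 2 ^ a)))) {..<2 * 2 ^ a}"
    using alternating_Z2_power[of a] assms(2) by force
  show ?thesis
    by (rule harmonious_model[OF assms(1), where x = x]) (use x assms(3) in auto)
qed

text \<open>Both \<open>2 * i\<close> and \<open>2 * j\<close> are odd multiples of
  \<open>n\<close>, so \<open>i + j\<close> is a multiple of \<open>n\<close>. The two powers are
  then inverse to each other, hence equal as each is its own inverse.\<close>

lemma (in group) cyclic_involution:
  assumes c: "c \<in> carrier G" "ord c = n" and i: "c [^] (i::nat) \<otimes> c [^] i = \<one>" "c [^] i \<noteq> \<one>"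
    and j: "c [^] (j::nat) \<otimes> c [^] j = \<one>" "c [^] j \<noteq> \<one>"
  shows "c [^] i = c [^] j"
proof -
  have half: "n dvd 2 * k" "\<not> n dvd k" if "c [^] k \<otimes> c [^] k = \<one>" "c [^] k \<noteq> \<one>" for k
    using that c by (auto simp: pow_eq_id nat_pow_mult simp flip: mult_2)
  have ex: "\<exists>u. odd u \<and> 2 * k = n * u" if k: "n dvd 2 * k" "\<not> n dvd k" for k
  proof -
    obtain u where u: "2 * k = n * u" using k(1) by (elim dvdE)
    have "odd u"
    proof
      assume "even u"
      then obtain w where "u = 2 * w" by (elim evenE)
      then have "k = n * w" using u by simp
      then show False using k(2) by simp
    qed
    then show ?thesis using u by blast
  qed
  obtain u v where uv: "odd u" "2 * i = n * u" "odd v" "2 * j = n * v"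
    using ex[OF half[OF i]] ex[OF half[OF j]] by blast
  then have "even (u + v)" by simp
  then obtain w where "u + v = 2 * w" by (elim evenE)
  moreover have "2 * (i + j) = n * (u + v)" using uv by (simp add: distrib_left)
  ultimately have "i + j = n * w" by simp
  then have "c [^] i \<otimes> c [^] j = \<one>" using c by (simp add: nat_pow_mult pow_eq_id)
  then show ?thesis using j(1) c by (metis nat_pow_closed r_cancel)
qed

section \<open>Two-groups with at most one involution\<close>

lemma two_power_odd_factor: "0 < n \<Longrightarrow> \<exists>a r. n = 2 ^ a * r \<and> odd (r::nat)"
proof (induction n rule: less_induct)
  case (less n)
  show ?case
  proof (cases "odd n")
    case True
    then show ?thesis by (intro exI[of _ 0] exI[of _ n]) simp
  next
    case False
    then obtain m where m: "n = 2 * m" by (auto elim: evenE)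
    then obtain a r where "m = 2 ^ a * r" "odd r" using less by (metis mult_pos_pos less_add_same_cancel1 mult_2 nat_0_less_mult_iff)
    then show ?thesis using m by (intro exI[of _ "Suc a"] exI[of _ r]) simp
  qed
qed

text \<open>Raising \<open>x\<close> to the 2-part of its order gives an element of odd order, which
  is trivial by assumption.\<close>

lemma (in comm_group) two_group_pow:
  assumes "finite (carrier G)" and no_odd: "\<And>g. g \<in> carrier G \<Longrightarrow> odd (ord g) \<Longrightarrow> g = \<one>"
    and x: "x \<in> carrier G"
  obtains a where "ord x = 2 ^ a"
proof -
  have pos: "0 < ord x" using ord_pos[OF assms(1) x] .
  obtain a r where ar: "ord x = 2 ^ a * r" "odd r"
    using two_power_odd_factor[OF pos] by blast
  have "ord (x [^] ((2::nat) ^ a)) = r" using ord_pow[OF x, of "2 ^ a"] ar by simp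
  then have "x [^] ((2::nat) ^ a) = \<one>" using no_odd[of "x [^] ((2::nat) ^ a)"] ar(2) x by simp
  then have "2 ^ a * r dvd 2 ^ a * 1" using x ar(1) by (simp add: pow_eq_id)
  then have "2 ^ a * r \<le> 2 ^ a" by (auto dest: dvd_imp_le)
  then have "r \<le> 1" by simp
  then have "r = 1" using ar(2) by (cases r) auto
  then show thesis using ar(1) that[of a] by simp
qed

text \<open>Take \<open>c\<close> of maximal order and \<open>x\<close> outside its powers. Under
  repeated squaring of \<open>x\<close> let \<open>y\<close> be an element still outside whose
  square is some \<open>c [^] j\<close>. If \<open>j\<close> is even, dividing \<open>y\<close> by a
  square root of \<open>c [^] j\<close> gives a third element of the two-torsion, besides the
  identity and the involution among the powers of \<open>c\<close>. If \<open>j\<close> is odd, the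
  square of \<open>y\<close> has the order of \<open>c\<close>, so \<open>y\<close> has twice the
  maximal order.\<close>

lemma (in comm_group) cyclic_of_small_two_torsion:
  assumes fin: "finite (carrier G)"
    and no_odd: "\<And>g. g \<in> carrier G \<Longrightarrow> odd (ord g) \<Longrightarrow> g = \<one>"
    and V: "card (two_torsion G) \<le> 2"
  obtains c where "c \<in> carrier G" "carrier G = (\<lambda>i::nat. c [^] i) ` UNIV"
proof -
  have p2: "\<exists>a. ord x = 2 ^ a" if "x \<in> carrier G" for x
    by (rule two_group_pow[OF fin no_odd that]) auto
  have "ord ` carrier G \<noteq> {}" "finite (ord ` carrier G)" using fin by auto
  then have "Max (ord ` carrier G) \<in> ord ` carrier G" by (intro Max_in) auto
  then obtain c where c: "c \<in> carrier G" "ord c = Max (ord ` carrier G)" by (metis imageE)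
  then have max: "ord x \<le> ord c" if "x \<in> carrier G" for x using that fin by simp
  let ?C = "(\<lambda>i::nat. c [^] i) ` UNIV"
  have C: "subgroup ?C G" by (rule subgroup_powers[OF fin c(1)])
  have finV: "finite (two_torsion G)" using fin by (simp add: two_torsion_def)
  have "x \<in> ?C" if x: "x \<in> carrier G" for x
  proof (rule ccontr)
    assume xC: "x \<notin> ?C"
    obtain b where b: "ord x = 2 ^ b" using p2[OF x] by blast
    let ?P = "\<lambda>k. x [^] ((2::nat) ^ k) \<in> ?C"
    have "?P b" using b x subgroup.one_closed[OF C] by (metis pow_ord_eq_1)
    moreover have "\<not> ?P 0" using xC x by simp
    ultimately obtain k where k: "\<not> ?P k" "?P (Suc k)"
      using ex_least_nat_less[of ?P b] by auto
    define y where "y = x [^] ((2::nat) ^ k)"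
    have y: "y \<in> carrier G" "y \<notin> ?C" "y \<otimes> y \<in> ?C"
      using k x by (auto simp: y_def nat_pow_mult simp flip: mult_2)
    then obtain j :: nat where j: "y \<otimes> y = c [^] j" by blast
    have c1: "c \<noteq> \<one>"
    proof
      assume "c = \<one>"
      then have "ord x \<le> 1" using max[OF x] by simp
      then have "x = \<one>" using ord_eq_1[OF x] ord_pos[OF fin x] by simp
      then show False using xC subgroup.one_closed[OF C] by simp
    qed
    obtain a where a: "ord c = 2 ^ a" using p2[OF c(1)] by blast
    have a0: "a \<noteq> 0" using a c1 ord_eq_1[OF c(1)] by (metis power_0)
    show False
    proof (cases "even j")
      case True
      then obtain i where i: "j = i + i" by (metis evenE mult_2)
      let ?w = "y \<otimes> inv (c [^] i)"
      have "?w \<in> two_torsion G"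
        using squares_eq_iff[OF y(1), of "c [^] i"] j i c(1) by (simp add: nat_pow_mult)
      moreover obtain d where d: "a = Suc d" using a0 by (cases a) auto
      define t where "t = c [^] ((2::nat) ^ d)"
      have tG: "t \<in> carrier G" using c(1) by (simp add: t_def)
      have "t \<otimes> t = c [^] ord c"
        using c(1) a d by (simp add: t_def nat_pow_mult mult_2)
      then have "t \<in> two_torsion G" using c(1) tG by (simp add: two_torsion_def)
      moreover have "t \<noteq> \<one>"
      proof
        assume "t = \<one>"
        then have "2 ^ Suc d dvd (2::nat) ^ d" using c(1) a d by (simp add: t_def pow_eq_id)
        then have "(2::nat) ^ Suc d \<le> 2 ^ d" by (rule dvd_imp_le) simp
        then show False by simp
      qed
      ultimately have "{\<one>, t, ?w} \<subseteq> two_torsion G" "t \<noteq> \<one>"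
        by (auto simp: two_torsion_def)
      moreover have "?w \<notin> ?C"
      proof
        assume "?w \<in> ?C"
        then have "?w \<otimes> c [^] i \<in> ?C" using subgroup.m_closed[OF C] by blast
        then show False using y c(1) by (simp add: m_assoc)
      qed
      then have "?w \<notin> {\<one>, t}" using subgroup.one_closed[OF C] by (auto simp: t_def)
      then have "card {\<one>, t, ?w} = 3" using \<open>t \<noteq> \<one>\<close> by auto
      ultimately have "3 \<le> card (two_torsion G)" using card_mono[OF finV] by metis
      then show False using V by simp
    next
      case False
      obtain e where e: "ord y = 2 ^ e" using p2[OF y(1)] by blast
      have "coprime j (ord c)" using False a by simp
      then have "ord (y \<otimes> y) = ord c" using j pow_ord_eq_ord_iff[OF fin c(1)] by simp
      moreover have "e \<noteq> 0"
      proof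
        assume "e = 0"
        then have "y = \<one>" using e ord_eq_1[OF y(1)] by simp
        then show False using y(2) subgroup.one_closed[OF C] by simp
      qed
      then have "ord (y [^] (2::nat)) = ord y div 2"
        using ord_pow[OF y(1), of 2] e by simp
      moreover have "y [^] (2::nat) = y \<otimes> y" using y(1) by (simp add: numeral_2_eq_2)
      ultimately have "ord y div 2 = ord c" by metis
      moreover have "even (ord y)" using e \<open>e \<noteq> 0\<close> by simp
      ultimately have "ord y = 2 * ord c" by (metis dvd_mult_div_cancel)
      then show False using max[OF y(1)] ord_pos[OF fin c(1)] by simp
    qed
  qed
  moreover have "?C \<subseteq> carrier G" using c(1) by auto
  ultimately have "carrier G = ?C" by (intro equalityI subsetI) auto
  then show thesis by (rule that[OF c(1)])
qed


section \<open>The groups Z_2 x Z_{2^a}, Z_4 x Z_2^2 and Z_4 x Z_4 inside an abstract group\<close>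

lemma (in group) subgroup_div_powers:
  assumes "finite (carrier G)" "c \<in> carrier G"
  shows "\<exists>k::nat. c [^] (i::nat) \<otimes> inv (c [^] (j::nat)) = c [^] k"
proof -
  let ?C = "(\<lambda>i::nat. c [^] i) ` UNIV"
  have "c [^] i \<otimes> inv (c [^] j) \<in> ?C"
    using subgroup_powers[OF assms] by (intro subgroup.m_closed subgroup.m_inv_closed) auto
  then show ?thesis by blast
qed

lemma (in group) ord_eq_4:
  assumes "w \<in> carrier G" "w \<otimes> w \<noteq> \<one>" "(w \<otimes> w) \<otimes> (w \<otimes> w) = \<one>"
  shows "ord w = 4"
proof -
  have "w [^] (4::nat) = \<one>" "w [^] (2::nat) \<noteq> \<one>"
    using assms by (simp_all add: numeral_eq_Suc m_assoc)
  then have d: "ord w dvd 4" "\<not> ord w dvd 2" using assms(1) by (simp_all add: pow_eq_id)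
  then have "ord w \<le> 4" by (auto dest: dvd_imp_le)
  then have "ord w \<in> {0, 1, 2, 3, 4}" by auto
  then show ?thesis using d by auto
qed

lemma (in comm_group) ord_involution:
  assumes "e \<in> two_torsion G" "e \<noteq> \<one>"
  shows "ord e = 2"
proof -
  have "e \<in> carrier G" "e [^] (2::nat) = \<one>" using assms by (auto simp: two_torsion_def numeral_2_eq_2)
  then have "ord e dvd 2" "ord e \<noteq> 1" using assms(2) ord_eq_1 by (auto simp: pow_eq_id)
  then show ?thesis using prime_nat_iff two_is_prime_nat by blast
qed

text \<open>Two different powers of \<open>e\<close> have quotient \<open>e\<close>, which is not a
  power of \<open>c\<close>. So \<open>e\<close> and \<open>c\<close> span a direct product, and the
  order shows that it is all of \<open>G\<close>.\<close>

lemma (in comm_group) harmonious_Z2_times_cyclic: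
  assumes fin: "finite (carrier G)" and c: "c \<in> carrier G" "ord c = 2 ^ a" "2 \<le> a"
    and e: "e \<in> two_torsion G" "e \<notin> (\<lambda>i::nat. c [^] i) ` UNIV" and n: "order G = 2 * 2 ^ a"
  shows "harmonious G"
proof -
  have eG: "e \<in> carrier G" "e \<otimes> e = \<one>" using e by (auto simp: two_torsion_def)
  have e1: "e \<noteq> \<one>" using e(2) nat_pow_0[of c] by (metis rangeI)
  have ord2: "ord e = 2" by (rule ord_involution[OF e(1) e1])
  have "group_model G ({..<ord e} \<times> {..<ord c})
      (\<lambda>(i, j) (i', j'). ((i + i') mod ord e, (j + j') mod ord c)) (\<lambda>(i, j). e [^] i \<otimes> c [^] j)"
  proof (rule product_model)
    show "group_model G {..<ord e} (\<lambda>i j. (i + j) mod ord e) (\<lambda>i::nat. e [^] i)"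
      by (rule cyclic_model) (use eG ord2 in auto)
    show "group_model G {..<ord c} (\<lambda>i j. (i + j) mod ord c) (\<lambda>i::nat. c [^] i)"
      by (rule cyclic_model) (use c in auto)
    fix x x' y y' :: nat assume x: "x \<in> {..<ord e}" "x' \<in> {..<ord e}"
      and eq: "e [^] x \<otimes> inv (e [^] x') = c [^] y' \<otimes> inv (c [^] y)"
    obtain k :: nat where "c [^] y' \<otimes> inv (c [^] y) = c [^] k"
      using subgroup_div_powers[OF fin c(1), of y' y] by blast
    then have k: "e [^] x \<otimes> inv (e [^] x') = c [^] k" using eq by simp
    show "e [^] x = e [^] x'"
    proof (rule ccontr)
      assume ne: "e [^] x \<noteq> e [^] x'"
      have "x \<in> {0, 1}" "x' \<in> {0, 1}" using x ord2 by auto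
      then have "e [^] x \<otimes> inv (e [^] x') = e"
        using ne eG e two_torsion_inv by auto
      then show False using k e(2) by (metis rangeI)
    qed
  qed
  moreover have "(\<lambda>(i, j) (i', j'). ((i + i') mod ord e, (j + j') mod ord c)) = add2 (2 ^ a)"
    using ord2 c(2) by (auto simp: add2_def fun_eq_iff)
  ultimately show ?thesis
    using harmonious_Z2_power[OF _ c(3) n] ord2 c(2) by metis
qed

text \<open>The only involution among the powers of \<open>w\<close> is
  \<open>w \<otimes> w\<close>, which lies outside the Klein subgroup; hence the two meet trivially
  and their product has 16 elements.\<close>

lemma (in comm_group) harmonious_Z4_times_klein:
  assumes fin: "finite (carrier G)" and w: "w \<in> carrier G" "w \<otimes> w \<noteq> \<one>"
      "w \<otimes> w \<in> two_torsion G" "w \<otimes> w \<notin> {\<one>, e, f, e \<otimes> f}"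
    and ef: "e \<in> two_torsion G" "f \<in> two_torsion G" "e \<noteq> \<one>" "f \<noteq> \<one>" "e \<noteq> f"
    and n: "order G = 16"
  shows "harmonious G"
proof -
  have ord4: "ord w = 4" using w by (intro ord_eq_4) (auto simp: two_torsion_def)
  let ?\<psi> = "\<lambda>i. [\<one>, e, f, e \<otimes> f] ! i"
  note km = klein_model[OF ef]
  obtain K :: "'a monoid" and \<pi> where "finite_quotient G K \<pi> {\<one>, e, f, e \<otimes> f}"
    using klein_quotient[OF fin ef] .
  then interpret q: finite_quotient G K \<pi> "{\<one>, e, f, e \<otimes> f}" .
  have "group_model G ({..<ord w} \<times> {..<2 ^ 2})
      (\<lambda>(i, j) (i', j'). ((i + i') mod ord w, j XOR j')) (\<lambda>(i, j). w [^] i \<otimes> ?\<psi> j)"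
  proof (rule product_model)
    show "group_model G {..<ord w} (\<lambda>i j. (i + j) mod ord w) (\<lambda>i::nat. w [^] i)"
      by (rule cyclic_model) (use w ord4 in auto)
    show "xor_model G 2 ?\<psi>" by (rule km(1))
    fix x x' y y' :: nat assume x: "x \<in> {..<ord w}" "x' \<in> {..<ord w}" and y: "y \<in> {..<2 ^ 2}" "y' \<in> {..<2 ^ 2}"
      and eq: "w [^] x \<otimes> inv (w [^] x') = ?\<psi> y' \<otimes> inv (?\<psi> y)"
    obtain k :: nat where k: "w [^] x \<otimes> inv (w [^] x') = w [^] k"
      using subgroup_div_powers[OF fin w(1), of x x'] by blast
    have "?\<psi> y \<in> {\<one>, e, f, e \<otimes> f}" "?\<psi> y' \<in> {\<one>, e, f, e \<otimes> f}" using y km(2) by blast+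
    then have L: "w [^] k \<in> {\<one>, e, f, e \<otimes> f}"
      using q.subgroup_H eq k by (metis subgroup.m_closed subgroup.m_inv_closed)
    moreover have "{\<one>, e, f, e \<otimes> f} \<subseteq> two_torsion G"
      using ef subgroup_two_torsion by (auto intro: subgroup.m_closed subgroup.one_closed)
    ultimately have "w [^] k \<otimes> w [^] k = \<one>" by (auto simp: two_torsion_def)
    moreover have "w [^] (2::nat) = w \<otimes> w" using w(1) by (simp add: numeral_2_eq_2)
    ultimately have "w [^] k = \<one> \<or> w [^] k = w \<otimes> w"
      using cyclic_involution[OF w(1) refl, of k 2] w by (auto simp: two_torsion_def)
    then have "w [^] k = \<one>" using L w(4) by metis
    then show "w [^] x = w [^] x'"
      using k w(1) inv_solve_right'[of \<one> "w [^] x" "w [^] x'"] by simp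
  qed
  then have "group_model G ({..<4::nat} \<times> {..<4::nat}) (\<lambda>(i, j) (i', j'). ((i + i') mod 4, j XOR j'))
      (\<lambda>(i, j). w [^] i \<otimes> ?\<psi> j)"
    using ord4 by simp
  then show ?thesis
    by (rule harmonious_model_list[where xs = "[(2, 2), (1, 1), (3, 2), (3, 1), (2, 0), (2, 1), (2, 3), (0, 3),
        (3, 3), (0, 1), (3, 0), (1, 0), (0, 2), (1, 2), (1, 3), (0, 0)]"]) (use n in simp_all)
qed

text \<open>A common power of \<open>a\<close> and \<open>b\<close> has its square in
  \<open>{\<one>, a \<otimes> a}\<close> and in \<open>{\<one>, b \<otimes> b}\<close>, so the
  square is trivial. Were the power itself nontrivial, it would be the single involution of both
  cyclic subgroups, against \<open>ab\<close>.\<close>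

lemma (in comm_group) harmonious_Z4_times_Z4:
  assumes fin: "finite (carrier G)" and a: "a \<in> carrier G" "a \<otimes> a \<noteq> \<one>" "a \<otimes> a \<in> two_torsion G"
    and b: "b \<in> carrier G" "b \<otimes> b \<noteq> \<one>" "b \<otimes> b \<in> two_torsion G"
    and ab: "a \<otimes> a \<noteq> b \<otimes> b" and n: "order G = 16"
  shows "harmonious G"
proof -
  have ord4: "ord a = 4" "ord b = 4" using a b by (auto intro!: ord_eq_4 simp: two_torsion_def)
  have sq: "w [^] (2::nat) = w \<otimes> w" if "w \<in> carrier G" for w using that by (simp add: numeral_2_eq_2)
  have pow_sq: "w [^] k \<otimes> w [^] k \<in> {\<one>, w \<otimes> w}"
    if "w \<in> carrier G" "w \<otimes> w \<in> two_torsion G" for w and k :: nat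
  proof -
    have "w [^] k \<otimes> w [^] k = (w \<otimes> w) [^] k" using that by (simp add: pow_mult_distrib m_comm)
    moreover have "(w \<otimes> w) [^] k = (if even k then \<one> else w \<otimes> w)"
    proof (cases "even k")
      case True
      then obtain i where "k = 2 * i" by (elim evenE)
      then have "(w \<otimes> w) [^] k = ((w \<otimes> w) [^] (2::nat)) [^] i" using that by (simp add: nat_pow_pow)
      then show ?thesis using True that sq[of "w \<otimes> w"] by (simp add: two_torsion_def)
    next
      case False
      then show ?thesis using that odd_pow_involution[of "w \<otimes> w" k] by (simp add: two_torsion_def)
    qed
    ultimately show ?thesis by auto
  qed
  have inv_pow: "w [^] k = w \<otimes> w" if "w \<in> carrier G" "w \<otimes> w \<noteq> \<one>" "w \<otimes> w \<in> two_torsion G"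
      "w [^] k \<otimes> w [^] k = \<one>" "w [^] k \<noteq> \<one>" for w and k :: nat
    using cyclic_involution[OF that(1) refl that(4,5), of 2] that sq[OF that(1)] by (simp add: two_torsion_def)
  have "group_model G ({..<ord a} \<times> {..<ord b})
      (\<lambda>(i, j) (i', j'). ((i + i') mod ord a, (j + j') mod ord b)) (\<lambda>(i, j). a [^] i \<otimes> b [^] j)"
  proof (rule product_model)
    show "group_model G {..<ord a} (\<lambda>i j. (i + j) mod ord a) (\<lambda>i::nat. a [^] i)"
      "group_model G {..<ord b} (\<lambda>i j. (i + j) mod ord b) (\<lambda>i::nat. b [^] i)"
      by (rule cyclic_model; use a b ord4 in auto)+
    fix x x' y y' :: nat assume eq: "a [^] x \<otimes> inv (a [^] x') = b [^] y' \<otimes> inv (b [^] y)"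
    obtain k :: nat where k: "a [^] x \<otimes> inv (a [^] x') = a [^] k"
      using subgroup_div_powers[OF fin a(1), of x x'] by blast
    obtain l :: nat where l: "b [^] y' \<otimes> inv (b [^] y) = b [^] l"
      using subgroup_div_powers[OF fin b(1), of y' y] by blast
    have kl: "a [^] k = b [^] l" using eq k l by simp
    have "a [^] k = \<one>"
    proof (rule ccontr)
      assume ne: "a [^] k \<noteq> \<one>"
      have "a [^] k \<otimes> a [^] k = \<one>"
        using pow_sq[OF a(1,3), of k] pow_sq[OF b(1,3), of l] kl ab by auto
      then have "a [^] k = a \<otimes> a" "b [^] l = b \<otimes> b"
        using inv_pow[OF a, of k] inv_pow[OF b, of l] kl ne by auto
      then show False using kl ab by simp
    qed
    then show "a [^] x = a [^] x'"
      using k a(1) inv_solve_right'[of \<one> "a [^] x" "a [^] x'"] by simp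
  qed
  then have "group_model G ({..<4::nat} \<times> {..<4::nat}) (\<lambda>(i, j) (i', j'). ((i + i') mod 4, (j + j') mod 4))
      (\<lambda>(i, j). a [^] i \<otimes> b [^] j)"
    using ord4 by simp
  then show ?thesis
    by (rule harmonious_model_list[where xs = "[(3, 0), (3, 3), (2, 2), (1, 1), (0, 2), (1, 0), (2, 0), (0, 1),
        (2, 1), (0, 3), (0, 0), (3, 2), (1, 3), (3, 1), (2, 3), (1, 2)]"]) (use n in simp_all)
qed

section \<open>Groups with at least three involutions\<close>

text \<open>The two-torsion has order a power of two, so four elements mean more than one
  involution. This is the even-order part of the case of trivial total sum, phrased so that it can
  be checked directly in a quotient.\<close>

definition many_involutions_nonelementary :: "('a, 'b) monoid_scheme \<Rightarrow> bool" where
  "many_involutions_nonelementary G \<longleftrightarrow>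
     4 \<le> card (two_torsion G) \<and> (\<exists>s\<in>carrier G. s \<otimes>\<^bsub>G\<^esub> s \<noteq> \<one>\<^bsub>G\<^esub>)"

text \<open>The elements of \<open>S\<close> become two-torsion in the quotient by the Klein
  subgroup and have at least 16 / 4 images, while \<open>s\<close> keeps a nontrivial square. So the
  quotient is covered by the induction hypothesis.\<close>

lemma (in comm_group) klein_step:
  assumes fin: "finite (carrier G)"
    and IH: "\<And>K :: 'a monoid. comm_group K \<Longrightarrow> finite (carrier K) \<Longrightarrow> order K < order G \<Longrightarrow>
      many_involutions_nonelementary K \<Longrightarrow> harmonious K"
    and ef: "e \<in> two_torsion G" "f \<in> two_torsion G" "e \<noteq> \<one>" "f \<noteq> \<one>" "e \<noteq> f"
    and S: "S \<subseteq> carrier G" "16 \<le> card S" "\<And>x. x \<in> S \<Longrightarrow> x \<otimes> x \<in> {\<one>, e, f, e \<otimes> f}"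
    and s: "s \<in> carrier G" "s \<otimes> s \<notin> {\<one>, e, f, e \<otimes> f}"
  shows "harmonious G"
proof -
  let ?L = "{\<one>, e, f, e \<otimes> f}"
  obtain K :: "'a monoid" and \<pi> where K: "finite_quotient G K \<pi> ?L" "order G = order K * 4"
      "harmonious K \<and> 3 \<le> order K \<longrightarrow> harmonious G"
    using klein_quotient[OF fin ef] .
  interpret q: finite_quotient G K \<pi> ?L by (rule K(1))
  have "card ?L = 4"
    using K(2) q.order_eq q.order_K_pos by simp
  then have "4 \<le> card (\<pi> ` S)" using q.card_le_image[OF S(1)] S(2) by simp
  moreover have sub: "\<pi> ` S \<subseteq> two_torsion K"
  proof
    fix y assume "y \<in> \<pi> ` S"
    then obtain x where x: "x \<in> S" "y = \<pi> x" by blast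
    then have xG: "x \<in> carrier G" using S(1) by blast
    have "\<pi> (x \<otimes> x) = \<one>\<^bsub>K\<^esub>" using q.proj_H[OF S(3)[OF x(1)]] .
    then show "y \<in> two_torsion K" using x(2) xG by (simp add: two_torsion_def)
  qed
  moreover have finV: "finite (two_torsion K)" using q.finite_K by (simp add: two_torsion_def)
  ultimately have V: "4 \<le> card (two_torsion K)" using card_mono[OF finV sub] by linarith
  have "\<pi> s \<otimes>\<^bsub>K\<^esub> \<pi> s = \<pi> (s \<otimes> s)" using s(1) by simp
  moreover have "\<pi> (s \<otimes> s) \<noteq> \<one>\<^bsub>K\<^esub>" using s q.ker[of "s \<otimes> s"] by simp
  ultimately have "\<pi> s \<in> carrier K" "\<pi> s \<otimes>\<^bsub>K\<^esub> \<pi> s \<noteq> \<one>\<^bsub>K\<^esub>" using s(1) by simp_all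
  then have "many_involutions_nonelementary K"
    using V unfolding many_involutions_nonelementary_def by blast
  moreover have "order K < order G" using K(2) q.order_K_pos by simp
  ultimately have "harmonious K" using IH q.K.comm_group_axioms q.finite_K by blast
  moreover have "card (two_torsion K) \<le> order K"
    unfolding order_def by (rule card_mono) (use q.finite_K in \<open>auto simp: two_torsion_def\<close>)
  ultimately show ?thesis using K(3) V by simp
qed

text \<open>Dividing by the powers of \<open>g\<close> leaves the two-torsion unchanged. The only
  bad outcome is an elementary quotient. Then the roles are exchanged: the two-torsion becomes the
  kernel and the quotient, of odd order \<open>ord g\<close>, is harmonious. The bound
  \<open>d \<le> 3\<close> leaves dimensions 2 and 3, for which label tables exist.\<close>

lemma (in comm_group) odd_element_step:
  assumes fin: "finite (carrier G)"
    and IH: "\<And>K :: 'a monoid. comm_group K \<Longrightarrow> finite (carrier K) \<Longrightarrow> order K < order G \<Longrightarrow>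
      many_involutions_nonelementary K \<Longrightarrow> harmonious K"
    and V: "4 \<le> card (two_torsion G)" "card (two_torsion G) = 2 ^ d" "d \<le> 3"
    and g: "g \<in> carrier G" "g \<noteq> \<one>" "odd (ord g)"
  shows "harmonious G"
proof -
  let ?H = "(\<lambda>i::nat. g [^] i) ` UNIV"
  obtain K :: "'a monoid" and \<pi> where "finite_quotient G K \<pi> ?H"
    using quotient_copy[OF fin subgroup_powers[OF fin g(1)]] .
  then interpret q: finite_quotient G K \<pi> ?H .
  have bij: "bij_betw \<pi> (two_torsion G) (two_torsion K)"
    by (rule q.two_torsion_odd_kernel[OF g(3) powers_pow_ord[OF g(1)]])
  then have VK: "card (two_torsion K) = card (two_torsion G)" by (simp add: bij_betw_same_card)
  have cardH: "card ?H = ord g"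
    by (rule card_powers[OF fin g(1)])
  have g3: "3 \<le> ord g"
  proof -
    have "ord g \<noteq> 1" "ord g \<noteq> 0" "ord g \<noteq> 2" using g ord_eq_1 ord_pos[OF fin g(1)] by auto
    then show ?thesis by linarith
  qed
  show ?thesis
  proof (cases "\<exists>s\<in>carrier K. s \<otimes>\<^bsub>K\<^esub> s \<noteq> \<one>\<^bsub>K\<^esub>")
    case True
    then have "many_involutions_nonelementary K"
      using V(1) VK unfolding many_involutions_nonelementary_def by simp
    moreover have "order K < order G" using q.order_eq cardH g3 q.order_K_pos by simp
    ultimately have "harmonious K" using IH q.K.comm_group_axioms q.finite_K by blast
    then show ?thesis using q.harmonious_odd_cyclic_kernel[OF _ g(1,3) refl] by blast
  next
    case False
    then have "two_torsion K = carrier K" by (auto simp: two_torsion_def)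
    then have n: "order G = card (two_torsion G) * ord g"
      using VK q.order_eq cardH by (simp add: order_def)
    obtain d' \<phi> where \<phi>: "xor_model G d' \<phi>" "\<phi> ` {..<2 ^ d'} = two_torsion G"
      using xor_model_two_torsion[OF fin] .
    have "(2::nat) ^ d' = 2 ^ d" using xor_modelD(5)[OF \<phi>(1)] \<phi>(2) V(2) by simp
    then have d: "d' = d" by simp
    obtain K' :: "'a monoid" and \<pi>' where "finite_quotient G K' \<pi>' (two_torsion G)"
      using quotient_copy[OF fin subgroup_two_torsion] .
    then interpret q': finite_quotient G K' \<pi>' "two_torsion G" .
    have K': "order K' = ord g" using n q'.order_eq V(1) by simp
    then have "harmonious K'"
      using odd_order_harmonious[OF q'.K.comm_group_axioms q'.finite_K] g(3) by simp
    moreover have "d = 2 \<or> d = 3"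
    proof -
      have "d \<noteq> 0" "d \<noteq> 1" using V(1,2) by (intro notI; simp)+
      then show ?thesis using V(3) by linarith
    qed
    ultimately show ?thesis
      using q'.harmonious_xor_kernel_2 q'.harmonious_xor_kernel_3 \<phi> d g3 g(3) K' by metis
  qed
qed

text \<open>Repeated squaring takes \<open>s\<close> to the identity; \<open>w\<close> is the
  element two squarings before the end.\<close>

lemma (in comm_group) square_involution_exists:
  assumes fin: "finite (carrier G)" and no_odd: "\<And>g. g \<in> carrier G \<Longrightarrow> odd (ord g) \<Longrightarrow> g = \<one>"
    and s: "s \<in> carrier G" "s \<otimes> s \<noteq> \<one>"
  obtains w where "w \<in> carrier G" "w \<otimes> w \<noteq> \<one>" "w \<otimes> w \<in> two_torsion G"
proof -
  obtain a where a: "ord s = 2 ^ a" using two_group_pow[OF fin no_odd s(1)] by blast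
  have "s [^] (2::nat) \<noteq> \<one>" using s by (simp add: numeral_2_eq_2)
  then have "\<not> 2 ^ a dvd (2::nat)" using a s(1) by (simp add: pow_eq_id)
  then have "a \<noteq> 0" "a \<noteq> 1" by (metis one_dvd power_0, metis dvd_refl power_one_right)
  then obtain b where b: "a = Suc (Suc b)" by (metis One_nat_def not0_implies_Suc)
  define w where "w = s [^] ((2::nat) ^ b)"
  have w: "w \<in> carrier G" "w \<otimes> w = s [^] ((2::nat) ^ Suc b)" "(w \<otimes> w) \<otimes> (w \<otimes> w) = s [^] ((2::nat) ^ a)"
    using s(1) by (simp_all add: w_def b nat_pow_mult mult_2)
  have "w \<otimes> w \<noteq> \<one>"
  proof
    assume "w \<otimes> w = \<one>"
    then have "2 ^ a dvd (2::nat) ^ Suc b" using w(2) a s(1) by (simp add: pow_eq_id)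
    then have "(2::nat) ^ a \<le> 2 ^ Suc b" by (rule dvd_imp_le) simp
    then show False using b by simp
  qed
  moreover have "w \<otimes> w \<in> two_torsion G"
    using w s(1) a by (simp add: two_torsion_def pow_eq_id)
  ultimately show thesis using that w(1) by blast
qed

lemma card_not_subset: "finite B \<Longrightarrow> card B < card A \<Longrightarrow> \<exists>x\<in>A. x \<notin> B"
  by (metis card_mono linorder_not_less subsetI)

lemma card_le4: "card {a, b, c, d} \<le> 4" "card {a, b} \<le> 2"
  by (auto simp: card_insert_if)

text \<open>The two-torsion and its translate by \<open>w\<close> give 16 elements with square
  \<open>\<one>\<close> or \<open>t\<close>, so the quotient by any Klein subgroup through
  \<open>t\<close> retains enough two-torsion. The induction can fail only if all squares lie in
  every such Klein subgroup, hence in \<open>{\<one>, t}\<close>; counting squares then gives order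
  16.\<close>

lemma (in comm_group) torsion_8_step:
  assumes fin: "finite (carrier G)"
    and IH: "\<And>K :: 'a monoid. comm_group K \<Longrightarrow> finite (carrier K) \<Longrightarrow> order K < order G \<Longrightarrow>
      many_involutions_nonelementary K \<Longrightarrow> harmonious K"
    and V: "card (two_torsion G) = 8"
    and w: "w \<in> carrier G" "w \<otimes> w \<noteq> \<one>" "w \<otimes> w \<in> two_torsion G"
  shows "harmonious G"
proof -
  define t where "t = w \<otimes> w"
  have finV: "finite (two_torsion G)" using fin by (simp add: two_torsion_def)
  have Vc: "v \<in> carrier G" "v \<otimes> v = \<one>" if "v \<in> two_torsion G" for v
    using that by (auto simp: two_torsion_def)
  have t: "t \<in> two_torsion G" "t \<noteq> \<one>" using w by (auto simp: t_def)
  show ?thesis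
  proof (cases "\<exists>e\<in>two_torsion G - {\<one>, t}. \<exists>s\<in>carrier G. s \<otimes> s \<notin> {\<one>, t, e, t \<otimes> e}")
    case True
    then obtain e s where e: "e \<in> two_torsion G" "e \<noteq> \<one>" "e \<noteq> t"
      and s: "s \<in> carrier G" "s \<otimes> s \<notin> {\<one>, t, e, t \<otimes> e}" by blast
    let ?S = "two_torsion G \<union> (\<lambda>v. w \<otimes> v) ` two_torsion G"
    have "inj_on (\<lambda>v. w \<otimes> v) (two_torsion G)"
      using w(1) Vc(1) by (intro inj_onI) auto
    then have c8: "card ((\<lambda>v. w \<otimes> v) ` two_torsion G) = 8" using V by (simp add: card_image)
    have "two_torsion G \<inter> (\<lambda>v. w \<otimes> v) ` two_torsion G = {}"
    proof (rule ccontr)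
      assume "two_torsion G \<inter> (\<lambda>v. w \<otimes> v) ` two_torsion G \<noteq> {}"
      then obtain v where v: "v \<in> two_torsion G" "w \<otimes> v \<in> two_torsion G" by blast
      then have "(w \<otimes> w) \<otimes> (v \<otimes> v) = \<one>"
        using square_distrib[OF w(1) Vc(1)[OF v(1)]] Vc(2)[OF v(2)] by simp
      then show False using w Vc[OF v(1)] by simp
    qed
    then have c16: "card ?S = 16" using V c8 finV by (simp add: card_Un_disjoint)
    have sq: "x \<otimes> x \<in> {\<one>, t, e, t \<otimes> e}" if x: "x \<in> ?S" for x
    proof (cases "x \<in> two_torsion G")
      case False
      then obtain v where v: "v \<in> two_torsion G" "x = w \<otimes> v" using x by blast
      then have "x \<otimes> x = t"
        using square_distrib[OF w(1) Vc(1)[OF v(1)]] Vc(2)[OF v(1)] w(1) by (simp add: t_def)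
      then show ?thesis by simp
    qed (simp add: Vc)
    have sub: "?S \<subseteq> carrier G" using Vc w(1) by auto
    show ?thesis
      by (rule klein_step[OF fin IH t(1) e(1) t(2) e(2) e(3)[symmetric] sub _ sq s]) (simp_all add: c16)
  next
    case False
    have "\<exists>e\<in>two_torsion G. e \<notin> {\<one>, t}"
      by (rule card_not_subset) (use V card_le4(2)[of \<one> t] in auto)
    then obtain e where e: "e \<in> two_torsion G" "e \<notin> {\<one>, t}" by blast
    have "\<exists>f\<in>two_torsion G. f \<notin> {\<one>, t, e, t \<otimes> e}"
      by (rule card_not_subset) (use V card_le4(1)[of \<one> t e "t \<otimes> e"] in auto)
    then obtain f where f: "f \<in> two_torsion G" "f \<notin> {\<one>, t, e, t \<otimes> e}" by blast
    have ne1: "f \<noteq> t \<otimes> e" "t \<otimes> e \<noteq> t \<otimes> f"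
      using f Vc(1)[OF t(1)] Vc(1)[OF e(1)] Vc(1)[OF f(1)] by auto
    have "t \<otimes> (t \<otimes> f) = f" "t \<otimes> e = e \<otimes> t" "e \<otimes> (e \<otimes> f) = f"
      using m_assoc[of t t f] m_assoc[of e e f] m_comm[of t e] Vc[OF t(1)] Vc[OF e(1)] Vc[OF f(1)]
      by simp_all
    then have ne: "f \<noteq> t \<otimes> e" "t \<otimes> e \<noteq> t \<otimes> f" "e \<noteq> t \<otimes> f" "t \<noteq> e \<otimes> f"
      using ne1 by auto
    \<comment> \<open>The Klein subgroups spanned by \<open>t\<close>, \<open>e\<close> and by
      \<open>t\<close>, \<open>f\<close> have only \<open>{\<one>, t}\<close> in common.\<close>
    have sq: "s \<otimes> s \<in> {\<one>, t}" if "s \<in> carrier G" for s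
    proof -
      have "s \<otimes> s \<in> {\<one>, t, e, t \<otimes> e}" "s \<otimes> s \<in> {\<one>, t, f, t \<otimes> f}"
        using False e f that by blast+
      then show ?thesis using ne f by auto
    qed
    have img: "(\<lambda>x. x \<otimes> x) ` carrier G = {\<one>, t}"
    proof
      show "{\<one>, t} \<subseteq> (\<lambda>x. x \<otimes> x) ` carrier G" using w(1) t_def by (auto intro: rev_image_eqI[of \<one>])
    qed (use sq in blast)
    obtain K :: "'a monoid" and \<pi> where "finite_quotient G K \<pi> (two_torsion G)"
      using quotient_copy[OF fin subgroup_two_torsion] .
    then interpret q: finite_quotient G K \<pi> "two_torsion G" .
    have "order K = 2" using q.order_two_torsion_quotient img t(2) by simp
    then have n: "order G = 16" using q.order_eq V by simp
    \<comment> \<open>Here \<open>e\<close> and \<open>f\<close> span a Klein subgroup that avoids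
      \<open>t\<close>, a complement to the powers of \<open>w\<close>.\<close>
    show ?thesis
      by (rule harmonious_Z4_times_klein[OF fin w, of e f]) (use e f ne t n t_def in auto)
  qed
qed

text \<open>With four elements the whole two-torsion is the Klein kernel, so no choice is left. If
  the quotient is elementary, its order is the number of squares, 2 or 4, and \<open>G\<close> has
  order 8 or 16. If it has at most two solutions of \<open>y \<otimes> y = \<one>\<close>, it is a
  cyclic 2-group and a lift of its generator splits off a factor Z_2. Otherwise the induction
  hypothesis applies.\<close>

lemma (in comm_group) torsion_4_step:
  assumes fin: "finite (carrier G)"
    and IH: "\<And>K :: 'a monoid. comm_group K \<Longrightarrow> finite (carrier K) \<Longrightarrow> order K < order G \<Longrightarrow>
      many_involutions_nonelementary K \<Longrightarrow> harmonious K"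
    and V: "card (two_torsion G) = 4"
    and no_odd: "\<And>g. g \<in> carrier G \<Longrightarrow> odd (ord g) \<Longrightarrow> g = \<one>"
    and w: "w \<in> carrier G" "w \<otimes> w \<noteq> \<one>" "w \<otimes> w \<in> two_torsion G"
  shows "harmonious G"
proof -
  define t where "t = w \<otimes> w"
  have finV: "finite (two_torsion G)" using fin by (simp add: two_torsion_def)
  have Vc: "v \<in> carrier G" "v \<otimes> v = \<one>" if "v \<in> two_torsion G" for v
    using that by (auto simp: two_torsion_def)
  have t: "t \<in> two_torsion G" "t \<noteq> \<one>" using w by (auto simp: t_def)
  have "\<exists>e\<in>two_torsion G. e \<notin> {\<one>, t}"
    by (rule card_not_subset) (use V card_le4(2)[of \<one> t] in auto)
  then obtain e where e: "e \<in> two_torsion G" "e \<noteq> \<one>" "e \<noteq> t" by blast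
  have te: "t \<otimes> e \<in> two_torsion G" "t \<otimes> e \<noteq> \<one>" "t \<otimes> e \<noteq> t" "t \<otimes> e \<noteq> e"
    using t e Vc[OF t(1)] Vc[OF e(1)] subgroup.m_closed[OF subgroup_two_torsion t(1) e(1)]
    by (simp, metis inv_equality two_torsion_inv, simp, simp)
  have "{\<one>, t, e, t \<otimes> e} \<subseteq> two_torsion G"
    using t e te subgroup.one_closed[OF subgroup_two_torsion] by blast
  moreover have "card {\<one>, t, e, t \<otimes> e} = 4" using t e te by auto
  ultimately have Veq: "two_torsion G = {\<one>, t, e, t \<otimes> e}"
    using V finV by (metis card_subset_eq)
  obtain K :: "'a monoid" and \<pi> where K: "finite_quotient G K \<pi> {\<one>, t, e, t \<otimes> e}" "order G = order K * 4"
      "harmonious K \<and> 3 \<le> order K \<longrightarrow> harmonious G"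
    using klein_quotient[OF fin t(1) e(1) t(2) e(2) e(3)[symmetric]] .
  interpret q: finite_quotient G K \<pi> "{\<one>, t, e, t \<otimes> e}" by (rule K(1))
  have sq_card: "order K = card ((\<lambda>x. x \<otimes> x) ` carrier G)"
    using q.order_two_torsion_quotient Veq by simp
  have in_sq: "x \<otimes> x \<in> (\<lambda>x. x \<otimes> x) ` carrier G" if "x \<in> carrier G" for x using that by blast
  consider (elem) "\<forall>y\<in>carrier K. y \<otimes>\<^bsub>K\<^esub> y = \<one>\<^bsub>K\<^esub>"
    | (jump) "4 \<le> card (two_torsion K)" "\<exists>y\<in>carrier K. y \<otimes>\<^bsub>K\<^esub> y \<noteq> \<one>\<^bsub>K\<^esub>"
    | (cyc) "card (two_torsion K) < 4" by (meson not_le)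
  then show ?thesis
  proof cases
    case jump
    then have "many_involutions_nonelementary K" unfolding many_involutions_nonelementary_def by blast
    moreover have "order K < order G" using K(2) q.order_K_pos by simp
    ultimately have "harmonious K" using IH q.K.comm_group_axioms q.finite_K by blast
    moreover have "card (two_torsion K) \<le> order K"
      unfolding order_def by (rule card_mono) (use q.finite_K in \<open>auto simp: two_torsion_def\<close>)
    ultimately show ?thesis using K(3) jump(1) by simp
  next
    case elem
    have sq: "x \<otimes> x \<in> two_torsion G" if "x \<in> carrier G" for x
    proof -
      have "\<pi> (x \<otimes> x) = \<one>\<^bsub>K\<^esub>" using elem that by simp
      then show ?thesis unfolding Veq using q.ker[OF m_closed[OF that that]] by (rule iffD1[rotated])
    qed
    show ?thesis
    proof (cases "(\<lambda>x. x \<otimes> x) ` carrier G \<subseteq> {\<one>, t}")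
      case True
      then have "(\<lambda>x. x \<otimes> x) ` carrier G = {\<one>, t}"
        using in_sq[OF w(1)] in_sq[OF one_closed] by (auto simp: t_def)
      then have n: "order G = 2 * 2 ^ 2" using sq_card t K(2) by simp
      have ord4: "ord w = 2 ^ 2" using ord_eq_4[OF w(1,2)] Vc(2)[OF w(3)] by simp
      have "e \<notin> (\<lambda>i::nat. w [^] i) ` UNIV"
      proof
        assume "e \<in> (\<lambda>i::nat. w [^] i) ` UNIV"
        then obtain i :: nat where "e = w [^] i" by blast
        moreover have "w [^] (2::nat) = w \<otimes> w" using w(1) by (simp add: numeral_2_eq_2)
        ultimately show False
          using cyclic_involution[OF w(1) refl, of i 2] w Vc e t_def by metis
      qed
      then show ?thesis
        by (intro harmonious_Z2_times_cyclic[OF fin w(1) ord4 _ e(1) _ n]) auto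
    next
      case False
      then obtain b where b: "b \<in> carrier G" "b \<otimes> b \<notin> {\<one>, t}" by blast
      have "{\<one>, t, b \<otimes> b, t \<otimes> (b \<otimes> b)} \<subseteq> (\<lambda>x. x \<otimes> x) ` carrier G"
      proof -
        have "t \<otimes> (b \<otimes> b) \<in> (\<lambda>x. x \<otimes> x) ` carrier G"
          using in_sq[OF m_closed[OF w(1) b(1)]] unfolding square_distrib[OF w(1) b(1)] t_def .
        then show ?thesis
          using in_sq[OF w(1)] in_sq[OF one_closed] in_sq[OF b(1)] by (simp add: t_def)
      qed
      moreover have "card {\<one>, t, b \<otimes> b, t \<otimes> (b \<otimes> b)} = 4"
      proof -
        have "t \<otimes> (b \<otimes> b) \<noteq> \<one>" "t \<otimes> (b \<otimes> b) \<noteq> t" "t \<otimes> (b \<otimes> b) \<noteq> b \<otimes> b"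
          using b t Vc[OF t(1)] Vc[OF sq[OF b(1)]] two_torsion_inv[OF sq[OF b(1)]]
          by (metis inv_equality insert_iff, simp_all)
        then show ?thesis using b t by auto
      qed
      moreover have "finite ((\<lambda>x. x \<otimes> x) ` carrier G)" using fin by simp
      ultimately have "4 \<le> order K" using sq_card card_mono by metis
      moreover have "order K \<le> 4"
        using sq_card card_mono[OF finV, of "(\<lambda>x. x \<otimes> x) ` carrier G"] sq V by (auto simp: image_subset_iff)
      ultimately have "order G = 16" using K(2) by simp
      then show ?thesis
        using b sq[OF b(1)] by (intro harmonious_Z4_times_Z4[OF fin w b(1)]) (auto simp: t_def)
    qed
  next
    case cyc
    have "card (two_torsion K) \<le> 2"
    proof -
      obtain d where d: "card (two_torsion K) = 2 ^ d"
        using q.K.card_two_torsion_power[OF q.finite_K] .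
      then have "(2::nat) ^ d < 2 ^ 2" using cyc by simp
      then have "d < 2" by (simp only: power_strict_increasing_iff)
      then show ?thesis using d by (cases d) auto
    qed
    \<comment> \<open>Elements of odd order stay absent in the quotient: if \<open>y\<close> has odd
      order, so does the square of any preimage \<open>x\<close>. Then \<open>x \<otimes> x\<close>
      is trivial and \<open>x\<close> lies in the kernel.\<close>
    moreover have "y = \<one>\<^bsub>K\<^esub>" if y: "y \<in> carrier K" "odd (q.K.ord y)" for y
    proof -
      obtain x where x: "x \<in> carrier G" "\<pi> x = y" using q.lift_exists[OF y(1)] by blast
      let ?r = "q.K.ord y"
      have "\<pi> (x [^] ?r) = \<one>\<^bsub>K\<^esub>" using x y(1) by (simp add: q.hom_nat_pow)
      then have "x [^] ?r \<in> two_torsion G" using q.ker[of "x [^] ?r"] x(1) Veq by simp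
      then have "(x \<otimes> x) [^] ?r = \<one>" using Vc(2) x(1) by (simp add: pow_mult_distrib m_comm)
      then have "ord (x \<otimes> x) dvd ?r" using x(1) by (simp add: pow_eq_id)
      then have "odd (ord (x \<otimes> x))" using y(2) dvd_trans by blast
      then have "x \<otimes> x = \<one>" using no_odd x(1) by simp
      then have "x \<in> two_torsion G" using x(1) by (simp add: two_torsion_def)
      then show ?thesis using q.proj_H x(2) Veq by simp
    qed
    ultimately obtain c' where c': "c' \<in> carrier K" "carrier K = (\<lambda>i::nat. c' [^]\<^bsub>K\<^esub> i) ` UNIV"
      using q.K.cyclic_of_small_two_torsion[OF q.finite_K] by metis
    obtain c where c: "c \<in> carrier G" "\<pi> c = c'" using q.lift_exists[OF c'(1)] by blast
    have dec: "\<exists>i::nat. \<exists>v\<in>two_torsion G. x = c [^] i \<otimes> v" if x: "x \<in> carrier G" for x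
    proof -
      have "\<pi> x \<in> (\<lambda>i::nat. c' [^]\<^bsub>K\<^esub> i) ` UNIV" using c'(2) x by (simp flip: c'(2))
      then obtain i :: nat where "\<pi> x = \<pi> (c [^] i)" using c by (auto simp: q.hom_nat_pow)
      then have "x \<otimes> inv (c [^] i) \<in> two_torsion G"
        using q.proj_eq_iff[OF x, of "c [^] i"] c(1) Veq by simp
      moreover have "x = c [^] i \<otimes> (x \<otimes> inv (c [^] i))"
        using x c(1) by (simp add: m_lcomm)
      ultimately show ?thesis by blast
    qed
    obtain i :: nat and v where iv: "v \<in> two_torsion G" "w = c [^] i \<otimes> v" using dec[OF w(1)] by blast
    \<comment> \<open>The factor \<open>v\<close> vanishes on squaring, so \<open>t\<close> is a
      power of \<open>c\<close>. Being the only involution among these powers, it keeps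
      \<open>e\<close> outside.\<close>
    have ti: "t = c [^] (2 * i)"
      using iv(2) square_distrib[of "c [^] i" v] Vc[OF iv(1)] c(1) by (simp add: t_def nat_pow_mult mult_2)
    have eC: "e \<notin> (\<lambda>i::nat. c [^] i) ` UNIV"
    proof
      assume "e \<in> (\<lambda>i::nat. c [^] i) ` UNIV"
      then obtain j :: nat where "e = c [^] j" by blast
      then show False using cyclic_involution[OF c(1) refl, of j "2 * i"] ti t e Vc by metis
    qed
    obtain a where a: "ord c = 2 ^ a" using two_group_pow[OF fin no_odd c(1)] by blast
    have a2: "2 \<le> a"
    proof (rule ccontr)
      assume "\<not> 2 \<le> a"
      then have "a = 0 \<or> a = 1" by linarith
      then have "ord c dvd 2 * i" using a by auto
      then have "t = \<one>" using ti c(1) by (simp add: pow_eq_id)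
      then show False using t by simp
    qed
    let ?C = "(\<lambda>i::nat. c [^] i) ` UNIV"
    have C: "subgroup ?C G" by (rule subgroup_powers[OF fin c(1)])
    have finC: "finite ?C" using fin subgroup.subset[OF C] finite_subset by blast
    have cardC: "card ?C = 2 ^ a"
      using card_powers[OF fin c(1)] a by simp
    have "carrier G = ?C \<union> (\<lambda>x. x \<otimes> e) ` ?C"
    proof
      show "carrier G \<subseteq> ?C \<union> (\<lambda>x. x \<otimes> e) ` ?C"
      proof
        fix x assume "x \<in> carrier G"
        then obtain k :: nat and v where kv: "v \<in> {\<one>, t, e, t \<otimes> e}" "x = c [^] k \<otimes> v"
          using dec Veq by blast
        have 1: "c [^] k \<otimes> t = c [^] (k + 2 * i)" using ti c(1) by (simp add: nat_pow_mult)
        have 2: "c [^] k \<otimes> (t \<otimes> e) = c [^] (k + 2 * i) \<otimes> e"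
          using 1 c(1) Vc[OF t(1)] Vc[OF e(1)] by (simp flip: m_assoc)
        show "x \<in> ?C \<union> (\<lambda>x. x \<otimes> e) ` ?C"
          using kv 1 2 c(1) by auto
      qed
    qed (use c(1) Vc[OF e(1)] in auto)
    moreover have "?C \<inter> (\<lambda>x. x \<otimes> e) ` ?C = {}"
    proof (rule ccontr)
      assume "?C \<inter> (\<lambda>x. x \<otimes> e) ` ?C \<noteq> {}"
      then obtain y where y: "y \<in> ?C" "y \<in> (\<lambda>x. x \<otimes> e) ` ?C"
        using ex_in_conv[of "?C \<inter> (\<lambda>x. x \<otimes> e) ` ?C"] unfolding Int_iff by metis
      from y(2) obtain x where "y = x \<otimes> e" "x \<in> ?C" by (rule imageE)
      then have x: "x \<in> ?C" "x \<otimes> e \<in> ?C" using y(1) by (simp_all only:)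
      then have "inv x \<otimes> (x \<otimes> e) \<in> ?C"
        by (intro subgroup.m_closed[OF C subgroup.m_inv_closed[OF C x(1)] x(2)])
      moreover have "inv x \<otimes> (x \<otimes> e) = e"
        using subgroup.mem_carrier[OF C x(1)] Vc(1)[OF e(1)] by (simp flip: m_assoc)
      ultimately show False using eC by simp
    qed
    moreover have "inj_on (\<lambda>x. x \<otimes> e) ?C"
      using c(1) Vc[OF e(1)] by (intro inj_onI) auto
    ultimately have n: "order G = 2 * 2 ^ a"
      using finC cardC by (simp add: order_def card_Un_disjoint card_image)
    show ?thesis by (rule harmonious_Z2_times_cyclic[OF fin c(1) a a2 e(1) eC n])
  qed
qed

text \<open>Two-torsion of order 16 or more leaves room for a Klein subgroup avoiding a given
  square. Below that, elements of odd order are divided out, and what remains are 2-groups with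
  two-torsion of order 4 or 8.\<close>

theorem nonelementary_harmonious:
  fixes G :: "'a monoid"
  assumes "comm_group G" "finite (carrier G)" "many_involutions_nonelementary G"
  shows "harmonious G"
  using assms
proof (induction "order G" arbitrary: G rule: less_induct)
  case less
  interpret comm_group G by (rule less.prems(1))
  note fin = less.prems(2)
  have IH: "harmonious K" if "comm_group K" "finite (carrier K)" "order K < order G"
    "many_involutions_nonelementary K" for K :: "'a monoid"
    using less.hyps that by blast
  obtain s where s: "s \<in> carrier G" "s \<otimes>\<^bsub>G\<^esub> s \<noteq> \<one>\<^bsub>G\<^esub>" and V4: "4 \<le> card (two_torsion G)"
    using less.prems(3) by (auto simp: many_involutions_nonelementary_def)
  obtain d where d: "card (two_torsion G) = 2 ^ d" using card_two_torsion_power[OF fin] .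
  show ?case
  proof (cases "d \<le> 3")
    case False
    then have "(2::nat) ^ 4 \<le> 2 ^ d" by (intro power_increasing) auto
    then have V16: "16 \<le> card (two_torsion G)" using d by simp
    let ?q = "s \<otimes>\<^bsub>G\<^esub> s"
    have "\<exists>e\<in>two_torsion G. e \<notin> {\<one>\<^bsub>G\<^esub>, ?q}"
      by (rule card_not_subset) (use V16 card_le4(2)[of "\<one>\<^bsub>G\<^esub>" ?q] in auto)
    then obtain e where e: "e \<in> two_torsion G" "e \<noteq> \<one>\<^bsub>G\<^esub>" "e \<noteq> ?q" by blast
    have "\<exists>f\<in>two_torsion G. f \<notin> {\<one>\<^bsub>G\<^esub>, e, ?q, e \<otimes>\<^bsub>G\<^esub> ?q}"
      by (rule card_not_subset) (use V16 card_le4(1)[of "\<one>\<^bsub>G\<^esub>" e ?q "e \<otimes>\<^bsub>G\<^esub> ?q"] in auto)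
    then obtain f where f: "f \<in> two_torsion G" "f \<notin> {\<one>\<^bsub>G\<^esub>, e, ?q, e \<otimes>\<^bsub>G\<^esub> ?q}" by blast
    have "e \<otimes>\<^bsub>G\<^esub> ?q \<noteq> f" using f by blast
    then have "?q \<noteq> e \<otimes>\<^bsub>G\<^esub> f"
      using e(1) f(1) m_assoc[of e e f] by (auto simp: two_torsion_def)
    then have q: "?q \<notin> {\<one>\<^bsub>G\<^esub>, e, f, e \<otimes>\<^bsub>G\<^esub> f}" using s e f by auto
    show ?thesis
      by (rule klein_step[OF fin IH e(1) f(1) e(2) _ _ _ V16 _ s(1) q])
        (use f in \<open>auto simp: two_torsion_def\<close>)
  next
    case True
    show ?thesis
    proof (cases "\<exists>g\<in>carrier G. odd (ord g) \<and> g \<noteq> \<one>\<^bsub>G\<^esub>")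
      case odd: True
      then show ?thesis using odd_element_step[OF fin IH V4 d True] by blast
    next
      case False
      then have no_odd: "g = \<one>\<^bsub>G\<^esub>" if "g \<in> carrier G" "odd (ord g)" for g using that by blast
      obtain w where w: "w \<in> carrier G" "w \<otimes>\<^bsub>G\<^esub> w \<noteq> \<one>\<^bsub>G\<^esub>" "w \<otimes>\<^bsub>G\<^esub> w \<in> two_torsion G"
        using square_involution_exists[OF fin no_odd s] .
      have "d \<noteq> 0" "d \<noteq> 1" using d V4 by (intro notI; simp)+
      then consider "d = 2" | "d = 3" using True by linarith
      then show ?thesis
      proof cases
        case 1
        then show ?thesis using torsion_4_step[OF fin IH _ no_odd w] d by simp
      next
        case 2
        then show ?thesis using torsion_8_step[OF fin IH _ w] d by simp
      qed
    qed
  qed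
qed

section \<open>A single involution\<close>

lemma inj_on_pairI:
  assumes "\<And>i b i' b'. \<lbrakk>i < l; b < m; i' < l; b' < m; f i b = f i' b'\<rbrakk> \<Longrightarrow> i = i' \<and> b = b'"
  shows "inj_on (\<lambda>(i, b). f i b) ({..<l::nat} \<times> {..<m::nat})"
  using assms by (intro inj_onI) auto

text \<open>The list \<open>x 0\<close>, \<open>x 0 \<otimes> \<iota>\<close>, \<open>x 1\<close>,
  \<open>x 1 \<otimes> \<iota>\<close>, ... runs through \<open>G\<close>; its sums are those with
  \<open>b = 0\<close> inside a pair and \<open>b = 1\<close> between pairs. The value
  \<open>x l = x 0 \<otimes> \<iota>\<close> continues the list instead of closing it: all
  \<open>2 * l\<close> formal sums can then be distinct, and passes of a lift can be chained. The
  actual cycle returns to \<open>x 0\<close>, which changes only the last sum.\<close>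

definition involutive_sequence :: "('a, 'b) monoid_scheme \<Rightarrow> bool" where
  "involutive_sequence G \<longleftrightarrow> (\<exists>\<iota> x l. \<iota> \<in> carrier G \<and> \<iota> \<noteq> \<one>\<^bsub>G\<^esub> \<and> \<iota> \<otimes>\<^bsub>G\<^esub> \<iota> = \<one>\<^bsub>G\<^esub> \<and> order G = 2 * l \<and>
     (\<forall>i\<le>l. x i \<in> carrier G) \<and> x l = x 0 \<otimes>\<^bsub>G\<^esub> \<iota> \<and>
     inj_on (\<lambda>(i, b). x i \<otimes>\<^bsub>G\<^esub> \<iota> [^]\<^bsub>G\<^esub> b) ({..<l} \<times> {..<2::nat}) \<and>
     inj_on (\<lambda>(i, b). x i \<otimes>\<^bsub>G\<^esub> x (i + b) \<otimes>\<^bsub>G\<^esub> \<iota>) ({..<l} \<times> {..<2}))"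

text \<open>Up to the common factor \<open>c [^] l\<close> the formal sums are
  \<open>c [^] (2 * i + b)\<close>, and each exponent below \<open>2 * l\<close> occurs
  once.\<close>

lemma (in comm_group) involutive_sequence_cyclic:
  assumes c: "c \<in> carrier G" "ord c = order G" and l: "order G = 2 * l" "0 < l"
  shows "involutive_sequence G"
proof -
  have pos: "0 < ord c" using c l by simp
  note eq = pow_eq_iff_cong[OF c(1) pos, unfolded c(2) l(1)]
  have inj1: "inj_on (\<lambda>(i, b). c [^] i \<otimes> (c [^] l) [^] b) ({..<l} \<times> {..<2::nat})"
  proof (rule inj_on_pairI)
    fix i b i' b' :: nat assume *: "i < l" "b < 2" "i' < l" "b' < 2"
      "c [^] i \<otimes> (c [^] l) [^] b = c [^] i' \<otimes> (c [^] l) [^] b'"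
    have lt: "i + l * b < 2 * l" "i' + l * b' < 2 * l"
      using * by (auto simp: less_2_cases_iff)
    have "c [^] (i + l * b) = c [^] (i' + l * b')"
      using * c(1) by (simp add: nat_pow_pow nat_pow_mult)
    then have e: "i + l * b = i' + l * b'" using eq lt by simp
    then have "(i + l * b) div l = (i' + l * b') div l" by simp
    then have "b = b'" using * l(2) by simp
    with e show "i = i' \<and> b = b'" by simp
  qed
  have inj2: "inj_on (\<lambda>(i, b). c [^] i \<otimes> c [^] (i + b) \<otimes> c [^] l) ({..<l} \<times> {..<2::nat})"
  proof (rule inj_on_pairI)
    fix i b i' b' :: nat assume *: "i < l" "b < 2" "i' < l" "b' < 2"
      "c [^] i \<otimes> c [^] (i + b) \<otimes> c [^] l = c [^] i' \<otimes> c [^] (i' + b') \<otimes> c [^] l"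
    have "c [^] i \<otimes> c [^] (i + b) = c [^] i' \<otimes> c [^] (i' + b')"
      using *(5) c(1) by simp
    then have "c [^] (2 * i + b) = c [^] (2 * i' + b')"
      using c(1) by (simp add: nat_pow_mult mult_2 add.assoc)
    moreover have "2 * i + b < 2 * l" "2 * i' + b' < 2 * l" using * by auto
    ultimately have e: "2 * i + b = 2 * i' + b'" using eq by simp
    then have "(2 * i + b) div 2 = (2 * i' + b') div 2" by simp
    then have "i = i'" using * by simp
    with e show "i = i' \<and> b = b'" by simp
  qed
  have one: "c [^] l \<noteq> \<one>" using c l by (simp add: pow_eq_id nat_dvd_not_less)
  have two: "c [^] l \<otimes> c [^] l = \<one>" using c l by (simp add: nat_pow_mult pow_eq_id mult_2)
  show ?thesis
    unfolding involutive_sequence_def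
    by (rule exI[of _ "c [^] l"], rule exI[of _ "\<lambda>i::nat. c [^] i"], rule exI[of _ l])
      (use c(1) one two l(1) inj1 inj2 in simp)
qed

text \<open>Each of the \<open>q\<close> passes is shifted by
  \<open>h = \<kappa> \<otimes> g\<close>. Since \<open>h\<close> lies over \<open>\<iota>\<close>,
  the image continues at the end of a pass as the definition prescribes; since \<open>q\<close> is
  odd, \<open>h [^] q = \<kappa>\<close>, so the long sequence again ends at its start times the
  involution.\<close>

lemma (in finite_quotient) involutive_sequence_odd_cyclic_kernel:
  assumes K: "involutive_sequence K" and g: "g \<in> carrier G" "odd (G.ord g)"
    and H: "H = (\<lambda>i::nat. g [^] i) ` UNIV"
  shows "involutive_sequence G"
proof -
  define q where "q = G.ord g"
  have q: "0 < q" "odd q" using g(2) by (auto simp: q_def intro: Nat.gr0I)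
  note geq = G.pow_eq_iff_cong[OF g(1), folded q_def, OF q(1)]
  have cardH: "card H = q"
    using G.card_powers[OF finite_G g(1)] H by (simp add: q_def)
  obtain \<iota> x l where K: "\<iota> \<in> carrier K" "\<iota> \<noteq> \<one>\<^bsub>K\<^esub>" "\<iota> \<otimes>\<^bsub>K\<^esub> \<iota> = \<one>\<^bsub>K\<^esub>" "order K = 2 * l"
     "\<And>i. i \<le> l \<Longrightarrow> x i \<in> carrier K" "x l = x 0 \<otimes>\<^bsub>K\<^esub> \<iota>"
     "inj_on (\<lambda>(i, b). x i \<otimes>\<^bsub>K\<^esub> \<iota> [^]\<^bsub>K\<^esub> b) ({..<l} \<times> {..<2::nat})"
     "inj_on (\<lambda>(i, b). x i \<otimes>\<^bsub>K\<^esub> x (i + b) \<otimes>\<^bsub>K\<^esub> \<iota>) ({..<l} \<times> {..<2})"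
    using K unfolding involutive_sequence_def by blast
  have l: "0 < l" using K(4) order_K_pos by simp
  obtain y where y: "y \<in> carrier G" "\<pi> y = \<iota>" using lift_exists[OF K(1)] by blast
  \<comment> \<open>An odd power of a lift of \<open>\<iota>\<close> still lies over
    \<open>\<iota>\<close>, and the exponent \<open>q\<close> kills \<open>y \<otimes> y\<close>,
    which is in \<open>H\<close>. So the lift becomes an involution.\<close>
  define \<kappa> where "\<kappa> = y [^] q"
  have \<kappa>G: "\<kappa> \<in> carrier G" using y by (simp add: \<kappa>_def)
  have p\<kappa>: "\<pi> \<kappa> = \<iota>"
    using y q(2) K(1,3) K.odd_pow_involution by (simp add: \<kappa>_def hom_nat_pow)
  have "\<pi> (y \<otimes> y) = \<one>\<^bsub>K\<^esub>" using y K(3) by simp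
  then have "y \<otimes> y \<in> H" using ker[of "y \<otimes> y"] y(1) by (metis G.m_closed)
  then obtain i :: nat where "y \<otimes> y = g [^] i" using H by blast
  then have "(y \<otimes> y) [^] q = \<one>" using g(1) by (simp add: G.nat_pow_pow G.pow_eq_id q_def)
  then have \<kappa>2: "\<kappa> \<otimes> \<kappa> = \<one>" using y(1) by (simp add: \<kappa>_def G.pow_mult_distrib G.m_comm)
  have \<kappa>1: "\<kappa> \<noteq> \<one>" using p\<kappa> K(2) by auto
  define u where "u i = (SOME z. z \<in> carrier G \<and> \<pi> z = x i)" for i
  have u: "u i \<in> carrier G" "\<pi> (u i) = x i" if "i < l" for i
    using someI_ex[OF lift_exists[OF K(5)[of i], unfolded Bex_def]] that by (auto simp: u_def)
  define h where "h = \<kappa> \<otimes> g"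
  have hG: "h \<in> carrier G" using \<kappa>G g(1) by (simp add: h_def)
  have pg: "\<pi> g = \<one>\<^bsub>K\<^esub>" using proj_H[of g] H G.nat_pow_eone[OF g(1)] by (metis rangeI)
  have ph: "\<pi> h = \<iota>" using \<kappa>G g(1) p\<kappa> pg K(1) by (simp add: h_def)
  have h_pow: "h [^] k = \<kappa> [^] k \<otimes> g [^] k" for k :: nat
    using \<kappa>G g(1) by (simp add: h_def G.pow_mult_distrib G.m_comm)
  have invol_pow: "\<kappa> [^] k = \<kappa> [^] (k mod 2)" "\<iota> [^]\<^bsub>K\<^esub> k = \<iota> [^]\<^bsub>K\<^esub> (k mod 2)" for k :: nat
  proof -
    have "k = 2 * (k div 2) + k mod 2" by simp
    then have "\<kappa> [^] k = (\<kappa> [^] (2::nat)) [^] (k div 2) \<otimes> \<kappa> [^] (k mod 2)"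
      "\<iota> [^]\<^bsub>K\<^esub> k = (\<iota> [^]\<^bsub>K\<^esub> (2::nat)) [^]\<^bsub>K\<^esub> (k div 2) \<otimes>\<^bsub>K\<^esub> \<iota> [^]\<^bsub>K\<^esub> (k mod 2)"
      using \<kappa>G K(1) by (simp_all add: G.nat_pow_pow G.nat_pow_mult K.nat_pow_pow K.nat_pow_mult)
    moreover have "\<kappa> [^] (2::nat) = \<one>" "\<iota> [^]\<^bsub>K\<^esub> (2::nat) = \<one>\<^bsub>K\<^esub>"
      using \<kappa>2 K(3) \<kappa>G K(1) by (simp_all add: numeral_2_eq_2)
    ultimately show "\<kappa> [^] k = \<kappa> [^] (k mod 2)" "\<iota> [^]\<^bsub>K\<^esub> k = \<iota> [^]\<^bsub>K\<^esub> (k mod 2)"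
      using \<kappa>G K(1) by simp_all
  qed
  have hq: "h [^] q = \<kappa>"
    using h_pow[of q] G.odd_pow_involution[OF \<kappa>G \<kappa>2 q(2)] \<kappa>G g(1) by (simp add: q_def)
  let ?L = "l * q"
  define z where "z t = u (t mod l) \<otimes> h [^] (t div l)" for t :: nat
  have ml: "t mod l < l" for t using l by simp
  have zG: "z t \<in> carrier G" for t using u(1)[OF ml] hG by (simp add: z_def)
  have n: "order G = 2 * ?L" using order_eq cardH K(4) by simp
  have zL: "z ?L = z 0 \<otimes> \<kappa>" using hq u(1)[OF l] l q(1) by (simp add: z_def)
  have div_lt: "t div l < q" if "t < ?L" for t using that by (simp add: less_mult_imp_div_less mult.commute)
  have t_eq: "t = t'" if "t mod l = t' mod l" "t div l = t' div l" for t t'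
    using that by (metis div_mult_mod_eq)
  have inj1: "inj_on (\<lambda>(t, b). z t \<otimes> \<kappa> [^] b) ({..<?L} \<times> {..<2::nat})"
  proof (rule inj_on_pairI)
    fix t b t' b' :: nat assume *: "t < ?L" "b < 2" "t' < ?L" "b' < 2"
      "z t \<otimes> \<kappa> [^] b = z t' \<otimes> \<kappa> [^] b'"
    \<comment> \<open>The power of \<open>\<kappa>\<close> matters only modulo 2. After projection
      it is the bit of an entry in the list of \<open>K\<close>; the remaining power of
      \<open>g\<close> identifies the pass.\<close>
    have zk: "z t \<otimes> \<kappa> [^] b = u (t mod l) \<otimes> (\<kappa> [^] ((t div l + b) mod 2) \<otimes> g [^] (t div l))" for t b
    proof -
      have "\<kappa> [^] (t div l) \<otimes> \<kappa> [^] b = \<kappa> [^] ((t div l + b) mod 2)"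
        using invol_pow(1)[of "t div l + b"] \<kappa>G by (simp add: G.nat_pow_mult)
      moreover have "z t \<otimes> \<kappa> [^] b = u (t mod l) \<otimes> ((\<kappa> [^] (t div l) \<otimes> \<kappa> [^] b) \<otimes> g [^] (t div l))"
        using u(1)[OF ml] \<kappa>G g(1) by (simp add: z_def h_pow G.m_ac)
      ultimately show ?thesis by simp
    qed
    have pz: "\<pi> (z t \<otimes> \<kappa> [^] b) = x (t mod l) \<otimes>\<^bsub>K\<^esub> \<iota> [^]\<^bsub>K\<^esub> ((t div l + b) mod 2)" for t b
      unfolding zk using u[OF ml] \<kappa>G g(1) p\<kappa> pg K(1) by (simp add: hom_nat_pow)
    have "x (t mod l) \<otimes>\<^bsub>K\<^esub> \<iota> [^]\<^bsub>K\<^esub> ((t div l + b) mod 2) = x (t' mod l) \<otimes>\<^bsub>K\<^esub> \<iota> [^]\<^bsub>K\<^esub> ((t' div l + b') mod 2)"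
      using arg_cong[OF *(5), of \<pi>] unfolding pz .
    then have "(t mod l, (t div l + b) mod 2) = (t' mod l, (t' div l + b') mod 2)"
      using inj_onD[OF K(7), of "(t mod l, (t div l + b) mod 2)" "(t' mod l, (t' div l + b') mod 2)"] ml
      by simp
    then have e: "t mod l = t' mod l" "(t div l + b) mod 2 = (t' div l + b') mod 2" by auto
    then have "g [^] (t div l) = g [^] (t' div l)"
      using *(5) u(1)[OF ml] \<kappa>G g(1) unfolding zk by simp
    then have d: "t div l = t' div l" using geq div_lt * by simp
    have bb: "b = b'" if "(j + b) mod 2 = (j + b') mod 2" "b < 2" "b' < 2" for j b b' :: nat
      using that by (auto simp: less_2_cases_iff mod_Suc split: if_splits)
    have "b = b'" by (rule bb[OF e(2)[unfolded d] *(2,4)])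
    then show "t = t' \<and> b = b'" using t_eq[OF e(1) d] by simp
  qed
  \<comment> \<open>\<open>E l\<close> represents \<open>x l\<close>: as \<open>h\<close> lies over
    \<open>\<iota>\<close>, the product \<open>u 0 \<otimes> h\<close> lies over
    \<open>x 0 \<otimes> \<iota>\<close>. The step into the next pass then has the same form as any
    other.\<close>
  define E where "E k = (if k < l then u k else u 0 \<otimes> h)" for k
  have E: "E k \<in> carrier G" "\<pi> (E k) = x k" if "k \<le> l" for k
  proof -
    have "k = l" if "\<not> k < l" using that \<open>k \<le> l\<close> by simp
    then show "E k \<in> carrier G" "\<pi> (E k) = x k"
      using u[of k] u[OF l] hG ph K(6) by (auto simp: E_def)
  qed
  have z_step: "z (t + b) = E (t mod l + b) \<otimes> h [^] (t div l)" if "b < 2" for t b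
  proof (cases "t mod l + b < l")
    case True
    have tb: "t + b = (t mod l + b) + (t div l) * l" by simp
    have "(t + b) mod l = ((t mod l + b) + (t div l) * l) mod l" by (rule arg_cong[OF tb])
    then have 1: "(t + b) mod l = t mod l + b" using True by (simp only: mod_mult_self1 mod_less)
    have "(t + b) div l = ((t mod l + b) + (t div l) * l) div l" by (rule arg_cong[OF tb])
    also have "\<dots> = t div l + (t mod l + b) div l" using l by (intro div_mult_self1) simp
    also have "\<dots> = t div l" using True by simp
    finally have "(t + b) div l = t div l" .
    with 1 have "(t + b) mod l = t mod l + b" "(t + b) div l = t div l" by blast+
    then show ?thesis using True by (simp add: z_def E_def)
  next
    case False
    then have b: "b = 1" "t mod l = l - 1" using that ml[of t] by linarith+
    then have "(t + b) mod l = 0" "(t + b) div l = Suc (t div l)"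
      using l by (simp_all add: mod_Suc div_Suc)
    then show ?thesis using False u(1)[OF l] hG by (simp add: z_def E_def G.m_ac)
  qed
  have inj2: "inj_on (\<lambda>(t, b). z t \<otimes> z (t + b) \<otimes> \<kappa>) ({..<?L} \<times> {..<2::nat})"
  proof (rule inj_on_pairI)
    fix t b t' b' :: nat assume *: "t < ?L" "b < 2" "t' < ?L" "b' < 2"
      "z t \<otimes> z (t + b) \<otimes> \<kappa> = z t' \<otimes> z (t' + b') \<otimes> \<kappa>"
    have kl: "t mod l + b \<le> l" if "b < 2" for t b using ml[of t] that by linarith
    \<comment> \<open>A sum contains the shift of its pass twice, so \<open>\<kappa>\<close> cancels
      there and an even power of \<open>g\<close> remains, which determines the pass because
      \<open>q\<close> is odd.\<close>
    have zz: "z t \<otimes> z (t + b) \<otimes> \<kappa> = u (t mod l) \<otimes> E (t mod l + b) \<otimes> \<kappa> \<otimes> g [^] (2 * (t div l))"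
      if "b < 2" for t b
    proof -
      have "h [^] (t div l) \<otimes> h [^] (t div l) = g [^] (2 * (t div l))"
        using h_pow[of "2 * (t div l)"] invol_pow(1)[of "2 * (t div l)"] hG g(1)
        by (simp add: G.nat_pow_mult mult_2)
      moreover have "z t \<otimes> z (t + b) \<otimes> \<kappa> =
          u (t mod l) \<otimes> E (t mod l + b) \<otimes> \<kappa> \<otimes> (h [^] (t div l) \<otimes> h [^] (t div l))"
        unfolding z_step[OF that] using u(1)[OF ml] E(1)[OF kl[OF that]] hG \<kappa>G by (simp add: z_def G.m_ac)
      ultimately show ?thesis by simp
    qed
    have pz: "\<pi> (z t \<otimes> z (t + b) \<otimes> \<kappa>) = x (t mod l) \<otimes>\<^bsub>K\<^esub> x (t mod l + b) \<otimes>\<^bsub>K\<^esub> \<iota>" if "b < 2" for t b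
      unfolding zz[OF that] using u[OF ml] E[OF kl[OF that]] \<kappa>G g(1) p\<kappa> pg K(1) K(5)[OF kl[OF that]] K(5)[OF less_imp_le[OF ml]]
      by (simp add: hom_nat_pow)
    have b2: "b < 2" "b' < 2" using * by auto
    have "x (t mod l) \<otimes>\<^bsub>K\<^esub> x (t mod l + b) \<otimes>\<^bsub>K\<^esub> \<iota> = x (t' mod l) \<otimes>\<^bsub>K\<^esub> x (t' mod l + b') \<otimes>\<^bsub>K\<^esub> \<iota>"
      using arg_cong[OF *(5), of \<pi>] unfolding pz[OF b2(1)] pz[OF b2(2)] .
    then have e: "t mod l = t' mod l" "b = b'"
      using inj_onD[OF K(8), of "(t mod l, b)" "(t' mod l, b')"] ml b2 by auto
    have "g [^] (2 * (t div l)) = g [^] (2 * (t' div l))"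
      using *(5) u(1)[OF ml] E(1)[OF kl[OF b2(2)]] \<kappa>G g(1) unfolding zz[OF b2(1)] zz[OF b2(2)] e by simp
    then have "t div l = t' div l"
      using odd_double_mod_cancel[OF q(2), of "t div l" 0 "t' div l"] geq div_lt * by simp
    then show "t = t' \<and> b = b'" using t_eq e by blast
  qed
  show ?thesis
    unfolding involutive_sequence_def
    by (rule exI[of _ \<kappa>], rule exI[of _ z], rule exI[of _ ?L])
      (use \<kappa>G \<kappa>1 \<kappa>2 n zG zL inj1 inj2 in simp)
qed

text \<open>Dividing by elements of odd order preserves the single involution; a 2-group with one
  involution is cyclic.\<close>

theorem single_involution_sequence:
  fixes G :: "'a monoid"
  assumes "comm_group G" "finite (carrier G)" "card (two_torsion G) = 2"
  shows "involutive_sequence G"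
  using assms
proof (induction "order G" arbitrary: G rule: less_induct)
  case less
  interpret comm_group G by (rule less.prems(1))
  note fin = less.prems(2)
  show ?case
  proof (cases "\<exists>g\<in>carrier G. odd (ord g) \<and> g \<noteq> \<one>\<^bsub>G\<^esub>")
    case True
    then obtain g where g: "g \<in> carrier G" "odd (ord g)" "g \<noteq> \<one>\<^bsub>G\<^esub>" by blast
    let ?H = "(\<lambda>i::nat. g [^]\<^bsub>G\<^esub> i) ` UNIV"
    obtain K :: "'a monoid" and \<pi> where "finite_quotient G K \<pi> ?H"
      using quotient_copy[OF fin subgroup_powers[OF fin g(1)]] .
    then interpret q: finite_quotient G K \<pi> ?H .
    have "card (two_torsion K) = 2"
      using q.two_torsion_odd_kernel[OF g(2) powers_pow_ord[OF g(1)]] less.prems(3) by (simp add: bij_betw_same_card)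
    moreover have "1 < ord g" using g ord_eq_1 ord_pos[OF fin g(1)] by (metis One_nat_def Suc_lessI)
    then have "order K < order G" using q.order_eq card_powers[OF fin g(1)] q.order_K_pos by simp
    ultimately have "involutive_sequence K" using less.hyps q.K.comm_group_axioms q.finite_K by blast
    then show ?thesis using q.involutive_sequence_odd_cyclic_kernel[OF _ g(1,2) refl] by blast
  next
    case False
    then have no_odd: "g = \<one>\<^bsub>G\<^esub>" if "g \<in> carrier G" "odd (ord g)" for g using that by blast
    obtain c where c: "c \<in> carrier G" "carrier G = (\<lambda>i::nat. c [^]\<^bsub>G\<^esub> i) ` UNIV"
      by (rule cyclic_of_small_two_torsion[OF fin no_odd]) (use less.prems(3) in auto)
    have "ord c = order G" using card_powers[OF fin c(1)] c(2) by (simp add: order_def)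
    moreover have "\<exists>e\<in>two_torsion G. e \<notin> {\<one>\<^bsub>G\<^esub>}"
    proof (rule ccontr)
      assume "\<not> ?thesis"
      then have "two_torsion G \<subseteq> {\<one>\<^bsub>G\<^esub>}" by blast
      then have "card (two_torsion G) \<le> 1" using card_mono[of "{\<one>\<^bsub>G\<^esub>}"] by simp
      then show False using less.prems(3) by simp
    qed
    then obtain e where e: "e \<in> two_torsion G" "e \<noteq> \<one>\<^bsub>G\<^esub>" by blast
    then have "2 dvd order G" using ord_dvd_group_order[of e] ord_involution[OF e] by (simp add: two_torsion_def)
    then obtain l where "order G = 2 * l" by (elim dvdE)
    moreover have "0 < order G" using order_gt_0_iff_finite fin by blast
    ultimately show ?thesis using involutive_sequence_cyclic[OF c(1)] by simp
  qed
qed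

section \<open>Elementary abelian two-groups\<close>

text \<open>In an elementary abelian 2-group sums and quotients agree, and this is an R-sequencing
  in the usual sense.\<close>

definition R_sequence :: "('a, 'b) monoid_scheme \<Rightarrow> (nat \<Rightarrow> 'a) \<Rightarrow> bool" where
  "R_sequence G a \<longleftrightarrow> (\<forall>i < order G - 1. a i \<in> carrier G - {\<one>\<^bsub>G\<^esub>}) \<and> inj_on a {..<order G - 1} \<and>
     inj_on (\<lambda>i. a i \<otimes>\<^bsub>G\<^esub> a (Suc i mod (order G - 1))) {..<order G - 1}"

text \<open>The R*-condition: a term is the product of its two neighbours, which in an elementary
  abelian 2-group says that three consecutive terms multiply to the identity. The index
  \<open>order G - 2\<close> is the last one, hence the cyclic predecessor of 0.\<close>

definition R_star :: "('a, 'b) monoid_scheme \<Rightarrow> bool" where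
  "R_star G \<longleftrightarrow> (\<exists>a. R_sequence G a \<and>
     a (order G - 2) \<otimes>\<^bsub>G\<^esub> a 0 \<otimes>\<^bsub>G\<^esub> a 1 = \<one>\<^bsub>G\<^esub>)"

text \<open>Moves three consecutive terms to the places around index 0 that \<open>R_star\<close>
  inspects.\<close>

lemma R_sequence_rotate:
  assumes "R_sequence G a" "1 < order G"
  shows "R_sequence G (\<lambda>i. a ((i + r) mod (order G - 1)))"
proof -
  let ?N = "order G - 1"
  have N: "0 < ?N" using assms(2) by simp
  let ?s = "\<lambda>i. (i + r) mod ?N"
  have lt: "?s i < ?N" for i using N by simp
  have inj: "inj_on ?s {..<?N}"
  proof (rule inj_onI)
    fix i j assume ij: "i \<in> {..<?N}" "j \<in> {..<?N}" "?s i = ?s j"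
    have "i = j" if "i \<le> j" "?s i = ?s j" "j < ?N" for i j
    proof -
      have "?N dvd (j + r) - (i + r)" using that by (metis add_le_mono1 mod_eq_dvd_iff_nat)
      then have "?N dvd j - i" by simp
      moreover have "j - i < ?N" using that(3) by simp
      ultimately have "j - i = 0" using nat_dvd_not_less by blast
      then show ?thesis using that(1) by simp
    qed
    from this[of i j] this[of j i] show "i = j" using ij by (cases "i \<le> j") auto
  qed
  have shift: "?s (Suc i mod ?N) = Suc (?s i) mod ?N" for i
    by (simp only: mod_Suc_eq mod_add_left_eq add_Suc)
  have "inj_on (\<lambda>i. a (?s i)) {..<?N}"
  proof (rule inj_onI)
    fix i j assume ij: "i \<in> {..<?N}" "j \<in> {..<?N}" "a (?s i) = a (?s j)"
    have "inj_on a {..<?N}" using assms(1) by (simp add: R_sequence_def)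
    from inj_onD[OF this ij(3)] lt have "?s i = ?s j" by simp
    from inj_onD[OF inj this ij(1,2)] show "i = j" .
  qed
  moreover have "inj_on (\<lambda>i. a (?s i) \<otimes>\<^bsub>G\<^esub> a (?s (Suc i mod ?N))) {..<?N}"
    unfolding shift
  proof (rule inj_onI)
    fix i j assume ij: "i \<in> {..<?N}" "j \<in> {..<?N}"
      "a (?s i) \<otimes>\<^bsub>G\<^esub> a (Suc (?s i) mod ?N) = a (?s j) \<otimes>\<^bsub>G\<^esub> a (Suc (?s j) mod ?N)"
    have "inj_on (\<lambda>i. a i \<otimes>\<^bsub>G\<^esub> a (Suc i mod ?N)) {..<?N}"
      using assms(1) by (simp add: R_sequence_def)
    from inj_onD[OF this ij(3)] lt have "?s i = ?s j" by simp
    from inj_onD[OF inj this ij(1,2)] show "i = j" .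
  qed
  moreover have "\<forall>i<?N. a (?s i) \<in> carrier G - {\<one>\<^bsub>G\<^esub>}"
    using assms(1) lt unfolding R_sequence_def by blast
  ultimately show ?thesis unfolding R_sequence_def by blast
qed

lemma (in comm_group) R_sequence_model:
  assumes \<phi>: "xor_model G d \<phi>" and n: "order G = 2 ^ d"
    and xs: "set xs \<subseteq> {1..<2 ^ d}" "length xs = 2 ^ d - 1" "distinct xs" "distinct (map2 (XOR) xs (rotate1 xs))"
  shows "R_sequence G (\<lambda>i. \<phi> (xs ! i))"
proof -
  let ?N = "order G - 1"
  have lt: "xs ! i \<in> {1..<2 ^ d}" if "i < ?N" for i
    using subsetD[OF xs(1) nth_mem[of i xs]] xs(2) n that by simp
  have suc: "Suc i mod ?N < ?N" if "i < ?N" for i using that by simp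
  note inj = cyclic_list_inj[OF xs(3,2,4)]
  note cl = xor_modelD(1)[OF \<phi>] and hom = xor_modelD(2)[OF \<phi>] and \<phi>inj = xor_modelD(3)[OF \<phi>]
    and \<phi>0 = xor_modelD(4)[OF \<phi>]
  have "\<phi> (xs ! i) \<in> carrier G - {\<one>}" if "i < ?N" for i
    using lt[OF that] cl \<phi>inj[of "xs ! i" 0] \<phi>0 by auto
  moreover have "inj_on (\<lambda>i. \<phi> (xs ! i)) {..<?N}"
  proof (rule inj_onI)
    fix i j assume ij: "i \<in> {..<?N}" "j \<in> {..<?N}" "\<phi> (xs ! i) = \<phi> (xs ! j)"
    then have "xs ! i = xs ! j" using \<phi>inj[of "xs ! i" "xs ! j"] lt[of i] lt[of j] by simp
    then show "i = j" using inj_onD[OF inj(1)] ij n by simp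
  qed
  moreover have "inj_on (\<lambda>i. \<phi> (xs ! i) \<otimes> \<phi> (xs ! (Suc i mod ?N))) {..<?N}"
  proof (rule inj_onI)
    fix i j assume ij: "i \<in> {..<?N}" "j \<in> {..<?N}"
      "\<phi> (xs ! i) \<otimes> \<phi> (xs ! (Suc i mod ?N)) = \<phi> (xs ! j) \<otimes> \<phi> (xs ! (Suc j mod ?N))"
    have l: "xs ! i < 2 ^ d" "xs ! j < 2 ^ d" "xs ! (Suc i mod ?N) < 2 ^ d" "xs ! (Suc j mod ?N) < 2 ^ d"
      using lt[of i] lt[of j] lt[OF suc, of i] lt[OF suc, of j] ij by auto
    have "\<phi> (xs ! i XOR xs ! (Suc i mod ?N)) = \<phi> (xs ! j XOR xs ! (Suc j mod ?N))"
      using ij(3) hom l by simp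
    then have "xs ! i XOR xs ! (Suc i mod ?N) = xs ! j XOR xs ! (Suc j mod ?N)"
      by (rule \<phi>inj) (rule xor_nat_less; rule l)+
    then show "i = j" using inj_onD[OF inj(2), of i j] ij n by simp
  qed
  ultimately show ?thesis unfolding R_sequence_def by blast
qed

text \<open>
  The lift follows a cycle \<open>a\<^sub>0, \<dots>, a\<^bsub>N-1\<^esub>\<close> of the nonzero cosets four times, inserting the three
  nonzero elements of the kernel between \<open>a\<^bsub>N-1\<^esub>\<close> and \<open>a\<^sub>1\<close> and visiting \<open>a\<^sub>0\<close> twice in a row in
  exchange. Since \<open>a\<^bsub>N-1\<^esub> + a\<^sub>0 + a\<^sub>1 = 0\<close>, the sum cosets \<open>a\<^bsub>N-1\<^esub>\<close> and \<open>a\<^sub>1\<close> gained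
  are those lost.
\<close>

lemma (in finite_quotient) R_star_lift:
  assumes K: "R_star K" "4 \<le> order K" "even (order K)"
    and elem: "\<And>x. x \<in> carrier G \<Longrightarrow> x \<otimes> x = \<one>"
    and \<phi>: "xor_model G 2 \<phi>" "H = \<phi> ` {..<2 ^ 2}"
  shows "R_star G"
proof -
  define N where "N = order K - 1"
  have N: "3 \<le> N" "odd N" using K(2,3) by (auto simp: N_def)
  obtain a where a: "R_sequence K a" "a (order K - 2) \<otimes>\<^bsub>K\<^esub> a 0 \<otimes>\<^bsub>K\<^esub> a 1 = \<one>\<^bsub>K\<^esub>"
    using K(1) unfolding R_star_def by blast
  have aK: "a i \<in> carrier K" "a i \<noteq> \<one>\<^bsub>K\<^esub>" if "i < N" for i
    using a(1) that unfolding R_sequence_def N_def by blast+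
  have a_inj: "inj_on a {..<N}" "inj_on (\<lambda>i. a i \<otimes>\<^bsub>K\<^esub> a (Suc i mod N)) {..<N}"
    using a(1) unfolding R_sequence_def N_def by blast+
  have a3: "a (N - 1) \<otimes>\<^bsub>K\<^esub> a 0 \<otimes>\<^bsub>K\<^esub> a 1 = \<one>\<^bsub>K\<^esub>"
    using a(2) by (simp add: N_def numeral_2_eq_2)
  have elemK: "y \<otimes>\<^bsub>K\<^esub> y = \<one>\<^bsub>K\<^esub>" if y: "y \<in> carrier K" for y
  proof -
    obtain x where "x \<in> carrier G" "\<pi> x = y" using lift_exists[OF y] by blast
    then show ?thesis using elem[of x] hom_mult[of x x] by simp
  qed
  define v where "v i = (SOME z. z \<in> carrier G \<and> \<pi> z = a i)" for i
  have v: "v i \<in> carrier G" "\<pi> (v i) = a i" if "i < N" for i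
    using someI_ex[OF lift_exists[OF aK(1)[OF that], unfolded Bex_def]] by (auto simp: v_def)
  \<comment> \<open>Index \<open>N\<close> stands for the kernel coset. The representative of
    \<open>a 0\<close> is taken as the product of those of its neighbours, so that the relation
    between the three cosets holds exactly in \<open>G\<close> and adds no stray label.\<close>
  define u where "u i = (if i = N then \<one> else if i = 0 then v (N - 1) \<otimes> v 1 else v i)" for i
  have a0: "a 0 = a (N - 1) \<otimes>\<^bsub>K\<^esub> a 1"
  proof -
    have k: "a (N - 1) \<in> carrier K" "a 0 \<in> carrier K" "a 1 \<in> carrier K" using aK(1) N(1) by auto
    have "a (N - 1) \<otimes>\<^bsub>K\<^esub> a 1 = (a (N - 1) \<otimes>\<^bsub>K\<^esub> a 1) \<otimes>\<^bsub>K\<^esub> (a 0 \<otimes>\<^bsub>K\<^esub> a 0)" using k elemK by simp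
    also have "\<dots> = (a (N - 1) \<otimes>\<^bsub>K\<^esub> a 0 \<otimes>\<^bsub>K\<^esub> a 1) \<otimes>\<^bsub>K\<^esub> a 0" using k by (simp add: K.m_ac)
    also have "\<dots> = a 0" using a3 k by simp
    finally show ?thesis by simp
  qed
  have u: "u i \<in> carrier G" "\<pi> (u i) = (if i = N then \<one>\<^bsub>K\<^esub> else a i)" if "i \<le> N" for i
    using that v[of i] v[of "N - 1"] v[of 1] N(1) a0 by (auto simp: u_def)
  define E where "E d = (if d = N then \<one> else u d \<otimes> u (Suc d mod N))" for d
  have E: "E d \<in> carrier G" "\<pi> (E d) = (if d = N then \<one>\<^bsub>K\<^esub> else a d \<otimes>\<^bsub>K\<^esub> a (Suc d mod N))" if "d \<le> N" for d
  proof -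
    have "Suc d mod N < N" using N(1) by simp
    then show "E d \<in> carrier G" "\<pi> (E d) = (if d = N then \<one>\<^bsub>K\<^esub> else a d \<otimes>\<^bsub>K\<^esub> a (Suc d mod N))"
      using u[of d] u[of "Suc d mod N"] that by (auto simp: E_def)
  qed
  have u_inj: "inj_on (\<lambda>p. \<pi> (u p)) {..N}"
  proof (rule inj_onI)
    fix p q assume pq: "p \<in> {..N}" "q \<in> {..N}" "\<pi> (u p) = \<pi> (u q)"
    then show "p = q"
      using u(2)[of p] u(2)[of q] aK(2)[of p] aK(2)[of q] inj_onD[OF a_inj(1), of p q]
      by (auto split: if_splits)
  qed
  have E_inj: "inj_on (\<lambda>p. \<pi> (E p)) {..N}"
  proof (rule inj_onI)
    fix p q assume pq: "p \<in> {..N}" "q \<in> {..N}" "\<pi> (E p) = \<pi> (E q)"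
    have ne: "a d \<otimes>\<^bsub>K\<^esub> a (Suc d mod N) \<noteq> \<one>\<^bsub>K\<^esub>" if d: "d < N" for d
    proof
      assume *: "a d \<otimes>\<^bsub>K\<^esub> a (Suc d mod N) = \<one>\<^bsub>K\<^esub>"
      have s: "Suc d mod N < N" "Suc d mod N \<noteq> d" using d N(1) by (auto simp: mod_Suc)
      have "a d \<otimes>\<^bsub>K\<^esub> a (Suc d mod N) = a d \<otimes>\<^bsub>K\<^esub> a d" using * elemK aK(1)[OF d] by simp
      then have "a (Suc d mod N) = a d" using aK(1)[OF d] aK(1)[OF s(1)] by simp
      then show False using inj_onD[OF a_inj(1)] s d by blast
    qed
    show "p = q"
      using pq E(2)[of p] E(2)[of q] ne[of p] ne[of q] inj_onD[OF a_inj(2), of p q]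
      by (auto split: if_splits)
  qed
  \<comment> \<open>Labels of coset \<open>c\<close> and of sum coset \<open>d\<close> at their
    \<open>s\<close>-th use. In the field with four elements the coset labels alternate between the
    factors 1 and 2, so sums get the factor 3. As \<open>N\<close> is odd, edge 0 is the only one
    joining cosets of the same kind and needs its own row. The fourth kernel entry, 0, is never
    reached: the identity stays out.\<close>
  define lb :: "nat \<Rightarrow> nat \<Rightarrow> nat" where
    "lb c s = (if c = N then [3, 1, 2, 0] else if c = 0 \<or> odd c then [0, 1, 2, 3] else [0, 2, 3, 1]) ! s" for c s
  define ml :: "nat \<Rightarrow> nat \<Rightarrow> nat" where
    "ml d s = (if d = N then [2, 3, 1, 0] else if d = 0 then [1, 3, 2, 0] else [0, 3, 1, 2]) ! s" for d s
  have lb: "lb c s < 4" "ml c s < 4" if "s < 4" for c s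
    using that by (auto simp: lb_def ml_def less_Suc_eq numeral_eq_Suc)
  have lb_inj: "inj_on (lb c) {..<4}" "inj_on (ml c) {..<4}" for c
    unfolding lb_def ml_def by (rule inj_on_nth_lessThan; simp)+
  define valid where "valid = (\<lambda>(s, i). s < (4::nat) \<and> i < N \<or> s = 4 \<and> i < (3::nat))"
  \<comment> \<open>Passes 0 to 2 visit the cosets 1, ..., \<open>N - 1\<close>, 0 and pass 3 visits
    0, ..., \<open>N - 1\<close>; this is where coset 0 comes twice in a row. Block 4 holds the
    three kernel elements and leads back to coset 1.\<close>
  define cs where "cs s i = (if s = 4 then N else if s = 3 then i else Suc i mod N)" for s i :: nat
  define st where "st s i = (if s = 4 then i else s)" for s i :: nat
  \<comment> \<open>The sums at the ends of block 4 lie in the cosets of \<open>a (N - 1)\<close>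
    and \<open>a 1\<close>, which are the edge sums with indices 0 and \<open>N - 1\<close>. They
    fill the slot of edge 0 freed by the repetition of coset 0, and that of edge
    \<open>N - 1\<close> left out by pass 3.\<close>
  define ds where "ds s i = (if s = 4 then (if i = 2 then N - 1 else N)
      else if s = 3 then (if i = N - 1 then 0 else i)
      else if i = N - 1 then (if s = 2 then N else 0) else Suc i)" for s i :: nat
  define ss where "ss s i = (if s = 4 then (if i = 2 then 3 else i)
      else if s = 3 then (if i = N - 1 then 2 else 3) else s)" for s i :: nat
  define nx where "nx s i = (if s = 4 \<and> i = 2 then (0, 0) else if Suc i < N then (s, Suc i) else (Suc s, 0))"
    for s i :: nat
  have bounds: "cs s i \<le> N" "st s i < 4" "ds s i \<le> N" "ss s i < 4" if "valid (s, i)" for s i :: nat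
    using that N(1) by (auto simp: valid_def cs_def st_def ds_def ss_def mod_Suc)
  have cs_inj: "s = s' \<and> i = i'"
    if "valid (s, i)" "valid (s', i')" "cs s i = cs s' i'" "st s i = st s' i'" for s i s' i' :: nat
    using that N(1) by (auto simp: valid_def cs_def st_def mod_Suc split: if_splits)
  have ds_inj: "s = s' \<and> i = i'"
    if "valid (s, i)" "valid (s', i')" "ds s i = ds s' i'" "ss s i = ss s' i'" for s i s' i' :: nat
    using that N(1) by (auto simp: valid_def ds_def ss_def split: if_splits)
  note hom = G.xor_modelD(2)[OF \<phi>(1), simplified] and \<phi>inj = G.xor_modelD(3)[OF \<phi>(1), simplified]
    and \<phi>G = G.xor_modelD(1)[OF \<phi>(1), simplified] and \<phi>0 = G.xor_modelD(4)[OF \<phi>(1)]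
  have \<phi>H: "\<phi> x \<in> H" if "x < 4" for x using \<phi>(2) that by auto
  define y where "y s i = u (cs s i) \<otimes> \<phi> (lb (cs s i) (st s i))" for s i :: nat
  have yG: "y s i \<in> carrier G" if "valid (s, i)" for s i :: nat
    using u(1) bounds[OF that] \<phi>G lb by (simp add: y_def)
  have u_rel: "u (N - 1) = u 0 \<otimes> u 1" "u 1 = u (N - 1) \<otimes> u 0"
  proof -
    have vv: "v (N - 1) \<in> carrier G" "v 1 \<in> carrier G" using v(1) N(1) by auto
    have "u (N - 1) = v (N - 1)" "u 1 = v 1" "u 0 = v (N - 1) \<otimes> v 1" using N(1) by (auto simp: u_def)
    moreover have "v (N - 1) \<otimes> v 1 \<otimes> v 1 = v (N - 1)" using vv elem by (simp add: G.m_assoc)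
    moreover have "v (N - 1) \<otimes> (v (N - 1) \<otimes> v 1) = v 1" using vv elem by (simp flip: G.m_assoc)
    ultimately show "u (N - 1) = u 0 \<otimes> u 1" "u 1 = u (N - 1) \<otimes> u 0" by simp_all
  qed
  have coset_step: "u (cs s i) \<otimes> u (cs s' i') = E (ds s i)"
    "lb (cs s i) (st s i) XOR lb (cs s' i') (st s' i') = ml (ds s i) (ss s i)"
    "valid (s', i')"
    if vi: "valid (s, i)" and nxt: "nx s i = (s', i')" for s i s' i' :: nat
  proof -
    have s3: "s = 0 \<or> s = 1 \<or> s = 2" if "s < 3" using that by auto
    have uG: "u 0 \<in> carrier G" "u 1 \<in> carrier G" "u (N - 1) \<in> carrier G" using u(1) N(1) by auto
    have si: "(s < 2 \<or> s = 2 \<or> s = 3) \<and> (Suc i < N \<or> Suc i = N) \<or> s = 4 \<and> (i = 0 \<or> i = 1 \<or> i = 2)"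
      using vi unfolding valid_def prod.case by linarith
    have s23: "s < 2 \<Longrightarrow> s < 3" "s = 2 \<Longrightarrow> s < 3" by simp_all
    consider (low) "s < 3" "Suc i < N" | (turn) "s < 2" "Suc i = N" | (stay) "s = 2" "Suc i = N"
      | (last) "s = 3" "Suc i < N" | (exit) "s = 3" "Suc i = N" | (in0) "s = 4" "i = 0"
      | (in1) "s = 4" "i = 1" | (in2) "s = 4" "i = 2"
      using si s23 by blast
    then have "u (cs s i) \<otimes> u (cs s' i') = E (ds s i) \<and>
      lb (cs s i) (st s i) XOR lb (cs s' i') (st s' i') = ml (ds s i) (ss s i) \<and> valid (s', i')"
    proof cases
      case low
      then have e: "s' = s" "i' = Suc i" "cs s i = Suc i" "cs s' i' = Suc (Suc i) mod N" "ds s i = Suc i"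
          "st s i = s" "st s' i' = s" "ss s i = s"
        using nxt by (auto simp: nx_def cs_def ds_def st_def ss_def)
      have par: "Suc (Suc i) mod N = 0 \<or> odd (Suc (Suc i) mod N) \<longleftrightarrow> \<not> odd (Suc i)"
      proof (cases "Suc (Suc i) = N")
        case True
        then show ?thesis using N(2) by auto
      qed (use low in auto)
      have neN: "Suc (Suc i) mod N \<noteq> N" "Suc i \<noteq> N" using low by (auto simp: mod_Suc)
      have "lb (Suc i) s XOR lb (Suc (Suc i) mod N) s = ml (Suc i) s"
        using s3[OF low(1)] neN par by (cases "odd (Suc i)") (auto simp: lb_def ml_def)
      then show ?thesis using e low by (auto simp: E_def valid_def)
    next
      case turn
      then have "s = 0 \<or> s = 1" by auto
      then show ?thesis
        using turn nxt N(1) by (auto simp: nx_def cs_def ds_def st_def ss_def lb_def ml_def E_def valid_def)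
    next
      case stay
      then show ?thesis
        using nxt N(1) elem uG by (auto simp: nx_def cs_def ds_def st_def ss_def lb_def ml_def E_def valid_def)
    next
      case last
      then show ?thesis
        using nxt N(1) by (auto intro: odd_pos simp: nx_def cs_def ds_def st_def ss_def lb_def ml_def E_def valid_def)
    next
      case exit
      then have i: "i = N - 1" "even (N - 1)" "N - 1 \<noteq> 0" using N by auto
      then show ?thesis
        using exit nxt N(1) u_rel(1) uG
        by (auto simp: nx_def cs_def ds_def st_def ss_def lb_def ml_def E_def valid_def u_def[of N])
    next
      case in0
      then show ?thesis
        using nxt N(1) by (auto simp: nx_def cs_def ds_def st_def ss_def lb_def ml_def E_def valid_def u_def[of N])
    next
      case in1
      then show ?thesis
        using nxt N(1) by (auto simp: nx_def cs_def ds_def st_def ss_def lb_def ml_def E_def valid_def u_def[of N])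
    next
      case in2
      have "Suc (N - 1) mod N = 0" using N(1) by simp
      then show ?thesis
        using in2 nxt N(1) u_rel(2) uG
        by (auto simp: nx_def cs_def ds_def st_def ss_def lb_def ml_def E_def valid_def u_def[of N])
    qed
    then show "u (cs s i) \<otimes> u (cs s' i') = E (ds s i)"
      "lb (cs s i) (st s i) XOR lb (cs s' i') (st s' i') = ml (ds s i) (ss s i)" "valid (s', i')" by auto
  qed
  have step: "y s i \<otimes> y s' i' = E (ds s i) \<otimes> \<phi> (ml (ds s i) (ss s i))"
    if vi: "valid (s, i)" "nx s i = (s', i')" for s i s' i' :: nat
  proof -
    note c = coset_step[OF vi]
    have l: "lb (cs s i) (st s i) < 4" "lb (cs s' i') (st s' i') < 4"
      using lb bounds[OF vi(1)] bounds[OF c(3)] by auto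
    have "y s i \<otimes> y s' i' = (u (cs s i) \<otimes> u (cs s' i')) \<otimes>
        (\<phi> (lb (cs s i) (st s i)) \<otimes> \<phi> (lb (cs s' i') (st s' i')))"
      using u(1) bounds[OF vi(1)] bounds[OF c(3)] \<phi>G l by (simp add: y_def G.m_ac)
    then show ?thesis using c(1,2) hom[OF l] by simp
  qed
  let ?M = "4 * N + 3"
  have cardH: "card H = 4"
    using \<phi> by (simp add: group_model_def card_image)
  have M: "order G - 1 = ?M" "order G - 2 = 4 * N + 2"
    using order_eq cardH K(2) by (auto simp: N_def)
  have N0: "0 < N" using N(1) by simp
  let ?f = "\<lambda>h j. h (j div N) (j mod N)"
  have last_block: "(k + 4 * N) div N = 4" "(k + 4 * N) mod N = k" if "k < 3" for k
    using that N(1) by simp_all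
  have val: "valid (j div N, j mod N)" if "j < ?M" for j
  proof (cases "j < 4 * N")
    case True
    then show ?thesis using N0 by (simp add: valid_def less_mult_imp_div_less)
  next
    case False
    define k where "k = j - 4 * N"
    have k: "j = k + 4 * N" "k < 3" using False that by (auto simp: k_def)
    then have "j div N = 4" "j mod N = k" using last_block by simp_all
    then show ?thesis using k by (simp add: valid_def)
  qed
  have nxt: "nx (j div N) (j mod N) = ((Suc j mod ?M) div N, (Suc j mod ?M) mod N)" if "j < ?M" for j
  proof (cases "Suc j = ?M")
    case True
    then have j: "j = 2 + 4 * N" by simp
    have jd: "j div N = 4" "j mod N = 2" unfolding j by (rule last_block; simp)+
    have "Suc j mod ?M = 0" unfolding True by simp
    then show ?thesis unfolding jd nx_def by (simp only:) simp
  next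
    case False
    then have sj: "Suc j mod ?M = Suc j" using that by simp
    have "\<not> (j div N = 4 \<and> j mod N = 2)"
    proof
      assume "j div N = 4 \<and> j mod N = 2"
      then have "j = 4 * N + 2" by (metis div_mult_mod_eq)
      then show False using False by simp
    qed
    moreover have "Suc (j mod N) = N \<or> Suc (j mod N) < N" using mod_less_divisor[OF N0, of j] by linarith
    ultimately show ?thesis
      using N0 unfolding sj by (elim disjE) (auto simp: nx_def div_Suc mod_Suc)
  qed
  have j_eq: "j = j'" if "j div N = j' div N \<and> j mod N = j' mod N" for j j'
    using that by (metis div_mult_mod_eq)
  let ?y = "?f y"
  have "inj_on ?y {..<?M}"
    unfolding y_def
  proof (rule coset_label_inj[where C = "{..N}" and u = u])
    show "inj_on (\<lambda>j. (?f cs j, \<phi> (lb (?f cs j) (?f st j)))) {..<?M}"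
    proof (rule inj_onI)
      fix j j' assume j: "j \<in> {..<?M}" "j' \<in> {..<?M}"
        "(?f cs j, \<phi> (lb (?f cs j) (?f st j))) = (?f cs j', \<phi> (lb (?f cs j') (?f st j')))"
      then have v: "valid (j div N, j mod N)" "valid (j' div N, j' mod N)" using val by auto
      have c: "?f cs j = ?f cs j'" using j(3) by simp
      then have "lb (?f cs j') (?f st j) = lb (?f cs j') (?f st j')"
        using j(3) lb bounds(2)[OF v(1)] bounds(2)[OF v(2)] by (intro \<phi>inj) auto
      then have "?f st j = ?f st j'"
        using inj_onD[OF lb_inj(1)] bounds(2)[OF v(1)] bounds(2)[OF v(2)] by blast
      then show "j = j'" using cs_inj[OF v c] j_eq by blast
    qed
  qed (use u(1) u_inj bounds val \<phi>H lb in auto)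
  moreover have "inj_on (\<lambda>j. ?y j \<otimes> ?y (Suc j mod ?M)) {..<?M}"
  proof -
    have inj: "inj_on (\<lambda>j. E (?f ds j) \<otimes> \<phi> (ml (?f ds j) (?f ss j))) {..<?M}"
    proof (rule coset_label_inj[where C = "{..N}" and u = E])
      show "inj_on (\<lambda>j. (?f ds j, \<phi> (ml (?f ds j) (?f ss j)))) {..<?M}"
      proof (rule inj_onI)
        fix j j' assume j: "j \<in> {..<?M}" "j' \<in> {..<?M}"
          "(?f ds j, \<phi> (ml (?f ds j) (?f ss j))) = (?f ds j', \<phi> (ml (?f ds j') (?f ss j')))"
        then have v: "valid (j div N, j mod N)" "valid (j' div N, j' mod N)" using val by auto
        have c: "?f ds j = ?f ds j'" using j(3) by simp
        then have "ml (?f ds j') (?f ss j) = ml (?f ds j') (?f ss j')"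
          using j(3) lb bounds(4)[OF v(1)] bounds(4)[OF v(2)] by (intro \<phi>inj) auto
        then have "?f ss j = ?f ss j'"
          using inj_onD[OF lb_inj(2)] bounds(4)[OF v(1)] bounds(4)[OF v(2)] by blast
        then show "j = j'" using ds_inj[OF v c] j_eq by blast
      qed
    qed (use E(1) E_inj bounds val \<phi>H lb in auto)
    have eq: "?y j \<otimes> ?y (Suc j mod ?M) = E (?f ds j) \<otimes> \<phi> (ml (?f ds j) (?f ss j))"
      if "j \<in> {..<?M}" for j
      using step[OF val nxt] that by simp
    show ?thesis by (rule iffD2[OF inj_on_cong[OF eq] inj])
  qed
  moreover have "?y j \<in> carrier G - {\<one>}" if j: "j < ?M" for j
  proof -
    have "?y j \<noteq> \<one>"
    proof
      assume "?y j = \<one>"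
      have l: "lb (?f cs j) (?f st j) < 4" using lb bounds[OF val[OF j]] by simp
      have "\<pi> (?y j) = \<pi> (u (?f cs j))"
        unfolding y_def using u(1)[OF bounds(1)[OF val[OF j]]] \<phi>G[OF l] proj_H[OF \<phi>H[OF l]] by simp
      then have "\<pi> (u (?f cs j)) = \<one>\<^bsub>K\<^esub>" using \<open>?y j = \<one>\<close> by simp
      then have N': "?f cs j = N"
        using u(2) bounds(1)[OF val[OF j]] aK(2) by (metis le_neq_implies_less)
      moreover have "j mod N \<noteq> N" using mod_less_divisor[OF N0, of j] by linarith
      ultimately have "j div N = 4"
        using val[OF j] N0 by (auto simp: cs_def valid_def mod_Suc split: if_splits)
      then have "?f st j < 3" using val[OF j] by (auto simp: st_def valid_def)
      then have "lb N (?f st j) \<noteq> 0" by (auto simp: lb_def less_Suc_eq numeral_eq_Suc)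
      moreover have "\<phi> (lb N (?f st j)) = \<one>"
        using \<open>?y j = \<one>\<close> N' \<phi>G lb bounds[OF val[OF j]] by (simp add: y_def u_def)
      ultimately show False
        using \<phi>inj[of "lb N (?f st j)" 0] \<phi>0 lb bounds[OF val[OF j]] by simp
    qed
    then show ?thesis using yG[OF val[OF j]] by simp
  qed
  ultimately have R: "R_sequence G ?y"
    unfolding R_sequence_def M(1) by blast
  \<comment> \<open>The shift puts the three kernel elements at the indices
    \<open>order G - 2\<close>, 0 and 1. Their labels 3, 1 and 2 cancel.\<close>
  define z where "z i = ?y ((i + (4 * N + 1)) mod ?M)" for i
  have "1 < order G" using M(1) by simp
  then have "R_sequence G z"
    using R_sequence_rotate[OF R, of "4 * N + 1"] unfolding M(1) z_def by blast
  moreover have "z (order G - 2) \<otimes> z 0 \<otimes> z 1 = \<one>"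
  proof -
    have e: "z (order G - 2) = y 4 0" "z 0 = y 4 1" "z 1 = y 4 2"
    proof -
      have "(4 * N + 2 + (4 * N + 1)) mod ?M = 4 * N"
      proof -
        have "4 * N + 2 + (4 * N + 1) = 4 * N + ?M" by simp
        then show ?thesis by (metis mod_add_self2 mod_less less_add_same_cancel1 zero_less_numeral)
      qed
      then show "z (order G - 2) = y 4 0" using N0 by (simp add: z_def M(2))
      have "z 0 = ?y (1 + 4 * N)" "z 1 = ?y (2 + 4 * N)" by (simp_all add: z_def)
      moreover have "?y (1 + 4 * N) = y 4 1" "?y (2 + 4 * N) = y 4 2"
        by (subst last_block, simp, subst last_block, simp, rule refl)+
      ultimately show "z 0 = y 4 1" "z 1 = y 4 2" by metis+
    qed
    have "\<phi> 3 \<otimes> \<phi> 1 \<otimes> \<phi> 2 = \<phi> ((3 XOR 1) XOR 2)"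
      using hom[of 3 1] hom[of 2 2] \<phi>G by simp
    then show ?thesis
      unfolding e using \<phi>0 \<phi>G by (simp add: y_def cs_def st_def lb_def u_def)
  qed
  ultimately show ?thesis unfolding R_star_def by blast
qed


lemma (in comm_group) R_star_model:
  fixes xs :: "nat list"
  assumes \<phi>: "xor_model G d \<phi>" and n: "order G = 2 ^ d" and d: "2 \<le> d"
    and xs: "set xs \<subseteq> {1..<2 ^ d}" "length xs = 2 ^ d - 1" "distinct xs" "distinct (map2 (XOR) xs (rotate1 xs))"
    and zero: "(xs ! (2 ^ d - 2) XOR xs ! 0) XOR xs ! 1 = 0"
  shows "R_star G"
proof -
  have four: "(4::nat) \<le> 2 ^ d" using power_increasing[OF d, of "2::nat"] by simp
  have lt: "xs ! i < 2 ^ d" if "i < 2 ^ d - 1" for i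
    using subsetD[OF xs(1) nth_mem[of i xs]] xs(2) that by simp
  note hom = xor_modelD(2)[OF \<phi>] and \<phi>0 = xor_modelD(4)[OF \<phi>]
  have l: "xs ! (2 ^ d - 2) < 2 ^ d" "xs ! 0 < 2 ^ d" "xs ! 1 < 2 ^ d"
    by (rule lt; use four in linarith)+
  have "\<phi> (xs ! (2 ^ d - 2)) \<otimes> \<phi> (xs ! 0) \<otimes> \<phi> (xs ! 1) = \<one>"
    using hom[OF l(1,2)] hom[OF xor_nat_less[OF l(1,2)] l(3)] zero \<phi>0 by simp
  moreover have "R_sequence G (\<lambda>i. \<phi> (xs ! i))"
    by (rule R_sequence_model[OF \<phi> n xs])
  ultimately show ?thesis unfolding R_star_def n by blast
qed

lemma (in comm_group) elementary_xor_model: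
  assumes "finite (carrier G)" "\<And>x. x \<in> carrier G \<Longrightarrow> x \<otimes> x = \<one>"
  obtains d \<phi> where "xor_model G d \<phi>" "order G = 2 ^ d"
proof -
  obtain d \<phi> where \<phi>: "xor_model G d \<phi>" "\<phi> ` {..<2 ^ d} = two_torsion G"
    using xor_model_two_torsion[OF assms(1)] .
  have "two_torsion G = carrier G" using assms(2) by (auto simp: two_torsion_def)
  then show thesis using that[OF \<phi>(1)] \<phi>(2) xor_modelD(5)[OF \<phi>(1)] by (simp add: order_def)
qed

text \<open>Order 8 is a genuine exception, so odd exponents start from an explicit sequence of order 32.\<close>

theorem elementary_R_star:
  fixes G :: "'a monoid"
  assumes "comm_group G" "finite (carrier G)" "\<And>x. x \<in> carrier G \<Longrightarrow> x \<otimes>\<^bsub>G\<^esub> x = \<one>\<^bsub>G\<^esub>"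
    "order G = 2 ^ k" "2 \<le> k" "k \<noteq> 3"
  shows "R_star G"
  using assms
proof (induction k arbitrary: G rule: less_induct)
  case (less k)
  interpret comm_group G by (rule less.prems(1))
  note fin = less.prems(2) and elem = less.prems(3) and n = less.prems(4)
  obtain d \<phi> where \<phi>: "xor_model G d \<phi>" "order G = 2 ^ d"
    using elementary_xor_model[OF fin elem] by blast
  then have dk: "d = k" using n by simp
  consider "k = 2" | "k = 5" | "2 \<le> k - 2" "k - 2 \<noteq> 3" "k = Suc (Suc (k - 2))"
    using less.prems(5,6) by linarith
  then show ?case
  proof cases
    case 1
    show ?thesis
      by (rule R_star_model[OF \<phi>, of "[2, 3, 1]"]) (use 1 dk in auto)
  next
    case 2
    show ?thesis
      by (rule R_star_model[OF \<phi>, of "[2, 3, 13, 6, 25, 11, 23, 7, 5, 28, 8, 15, 26, 12, 27, 10, 14, 16, 24,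
          21, 19, 22, 31, 4, 30, 20, 9, 17, 29, 18, 1]"]) (use 2 dk in simp_all)
  next
    case 3
    have V: "two_torsion G = carrier G" using elem by (auto simp: two_torsion_def)
    have "4 \<le> order G" using power_increasing[OF less.prems(5), of "2::nat"] n by simp
    then have c4: "4 \<le> card (carrier G)" by (simp add: order_def)
    have "\<exists>e\<in>carrier G. e \<notin> {\<one>\<^bsub>G\<^esub>}"
      using c4 card_mono[of "{\<one>\<^bsub>G\<^esub>}" "carrier G"] by force
    then obtain e where e: "e \<in> carrier G" "e \<noteq> \<one>\<^bsub>G\<^esub>" by blast
    have "\<exists>f\<in>carrier G. f \<notin> {\<one>\<^bsub>G\<^esub>, e}"
      using c4 card_mono[of "{\<one>\<^bsub>G\<^esub>, e}" "carrier G"] e(2) by force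
    then obtain f where f: "f \<in> carrier G" "f \<noteq> \<one>\<^bsub>G\<^esub>" "e \<noteq> f" by blast
    have ef: "e \<in> two_torsion G" "f \<in> two_torsion G" using e f V by auto
    note km = klein_model[OF ef e(2) f(2,3)]
    obtain K :: "'a monoid" and \<pi> where K: "finite_quotient G K \<pi> {\<one>\<^bsub>G\<^esub>, e, f, e \<otimes>\<^bsub>G\<^esub> f}" "order G = order K * 4"
      using klein_quotient[OF fin ef e(2) f(2,3)] .
    interpret q: finite_quotient G K \<pi> "{\<one>\<^bsub>G\<^esub>, e, f, e \<otimes>\<^bsub>G\<^esub> f}" by (rule K(1))
    have "(2::nat) ^ k = 2 ^ (k - 2) * 4" by (subst 3(3)) simp
    then have "order K * 4 = 2 ^ (k - 2) * 4" using K(2) n by simp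
    then have oK: "order K = 2 ^ (k - 2)" by simp
    have elemK: "y \<otimes>\<^bsub>K\<^esub> y = \<one>\<^bsub>K\<^esub>" if y: "y \<in> carrier K" for y
    proof -
      obtain x where "x \<in> carrier G" "\<pi> x = y" using q.lift_exists[OF y] by blast
      then show ?thesis using elem[of x] q.hom_mult[of x x] by simp
    qed
    have "R_star K"
      by (rule less.IH[of "k - 2" K]) (use less.prems(5) 3 q.K.comm_group_axioms q.finite_K elemK oK in auto)
    moreover have "4 \<le> order K" using power_increasing[OF 3(1), of "2::nat"] oK by simp
    moreover have "even (order K)" using oK 3(1) by simp
    ultimately show ?thesis using q.R_star_lift[OF _ _ _ elem km(1) km(2)[symmetric]] by blast
  qed
qed

text \<open>At order 8 a plain R-sequence is supplied, which suffices for inserting the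
  identity.\<close>

corollary elementary_R_sequence:
  fixes G :: "'a monoid"
  assumes G: "comm_group G" "finite (carrier G)" "\<And>x. x \<in> carrier G \<Longrightarrow> x \<otimes>\<^bsub>G\<^esub> x = \<one>\<^bsub>G\<^esub>"
    and n: "2 < order G"
  shows "\<exists>a. R_sequence G a"
proof -
  interpret comm_group G by (rule G(1))
  obtain d \<phi> where \<phi>: "xor_model G d \<phi>" "order G = 2 ^ d"
    using elementary_xor_model[OF G(2,3)] by blast
  have "d \<noteq> 0" "d \<noteq> 1" using n \<phi>(2) by (intro notI; simp)+
  then have d: "2 \<le> d" by linarith
  show ?thesis
  proof (cases "d = 3")
    case True
    have "R_sequence G (\<lambda>i. \<phi> ([1, 5, 7, 4, 2, 3, 6] ! i))"
      by (rule R_sequence_model[OF \<phi>]) (use True in simp_all)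
    then show ?thesis by blast
  next
    case False
    then show ?thesis using elementary_R_star[OF G \<phi>(2) d] unfolding R_star_def by blast
  qed
qed

section \<open>Sums along Hamiltonian cycles\<close>

text \<open>Applied twice: to inverses with \<open>w = \<one>\<close> outside the two-torsion, and
  to translation by an involution \<open>w\<close> inside it.\<close>

lemma (in comm_group) finprod_pairing:
  assumes "finite A" "A \<subseteq> carrier G" "w \<in> carrier G"
    and "\<And>x. x \<in> A \<Longrightarrow> f x \<in> A \<and> f (f x) = x \<and> f x \<noteq> x \<and> x \<otimes> f x = w"
  shows "even (card A) \<and> (\<Otimes>x\<in>A. x) = w [^] (card A div 2)"
  using assms
proof (induction "card A" arbitrary: A rule: less_induct)
  case less
  show ?case
  proof (cases "A = {}")
    case False
    then obtain a where a: "a \<in> A" by blast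
    let ?B = "A - {a, f a}"
    note pa = less.prems(4)[OF a]
    have fin: "finite ?B" using less.prems(1) by simp
    have A: "A = insert a (insert (f a) ?B)" using a pa by blast
    have B: "f x \<in> ?B \<and> f (f x) = x \<and> f x \<noteq> x \<and> x \<otimes> f x = w" if "x \<in> ?B" for x
      using less.prems(4)[of x] pa that by (metis Diff_iff insert_iff empty_iff)
    have new: "a \<notin> insert (f a) ?B" "f a \<notin> ?B" using pa by auto
    have "card A = card (insert a (insert (f a) ?B))" using A by (rule arg_cong)
    also have "\<dots> = Suc (Suc (card ?B))" using fin new by (metis card_insert_disjoint finite_insert)
    finally have card: "card A = Suc (Suc (card ?B))" .
    have IH: "even (card ?B) \<and> (\<Otimes>x\<in>?B. x) = w [^] (card ?B div 2)"
      by (rule less.hyps) (use card fin less.prems(2,3) B in auto)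
    have aG: "a \<in> carrier G" "f a \<in> carrier G" using a pa less.prems(2) by auto
    have BG: "(\<lambda>x. x) \<in> ?B \<rightarrow> carrier G" using less.prems(2) by auto
    have "(\<Otimes>x\<in>A. x) = a \<otimes> (\<Otimes>x\<in>insert (f a) ?B. x)"
      by (subst A, rule finprod_insert) (use fin aG BG pa in auto)
    also have "(\<Otimes>x\<in>insert (f a) ?B. x) = f a \<otimes> (\<Otimes>x\<in>?B. x)"
      by (rule finprod_insert) (use fin aG BG in auto)
    finally have "(\<Otimes>x\<in>A. x) = (a \<otimes> f a) \<otimes> w [^] (card ?B div 2)"
      using aG less.prems(3) IH by (simp add: m_assoc)
    also have "\<dots> = w [^] (card A div 2)"
      using pa less.prems(3) card by (simp add: m_comm)
    finally show ?thesis using IH card by simp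
  qed simp
qed

lemma (in comm_group) odd_part_pairing:
  assumes "finite (carrier G)"
  shows "even (card (carrier G - two_torsion G))" "(\<Otimes>x\<in>carrier G - two_torsion G. x) = \<one>"
proof -
  have "even (card (carrier G - two_torsion G)) \<and>
      (\<Otimes>x\<in>carrier G - two_torsion G. x) = \<one> [^] (card (carrier G - two_torsion G) div 2)"
  proof (rule finprod_pairing[where f = "\<lambda>x. inv x"])
    fix x assume x: "x \<in> carrier G - two_torsion G"
    then have "inv x \<notin> two_torsion G"
      using two_torsion_inv[of "inv x"] by auto
    moreover have "inv x \<noteq> x"
    proof
      assume "inv x = x"
      then have "x \<otimes> x = \<one>" using x r_inv[of x] by (metis DiffD1)
      then show False using x by (simp add: two_torsion_def)
    qed
    ultimately show "inv x \<in> carrier G - two_torsion G \<and> inv (inv x) = x \<and> inv x \<noteq> x \<and> x \<otimes> inv x = \<one>"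
      using x by simp
  qed (use assms in auto)
  then show "even (card (carrier G - two_torsion G))" "(\<Otimes>x\<in>carrier G - two_torsion G. x) = \<one>"
    by simp_all
qed

lemma (in comm_group) total_sum_two_torsion:
  assumes fin: "finite (carrier G)"
  shows "total_sum G = (\<Otimes>x\<in>two_torsion G. x)"
proof -
  have V: "two_torsion G \<subseteq> carrier G" by (auto simp: two_torsion_def)
  have "carrier G = two_torsion G \<union> (carrier G - two_torsion G)" using V by blast
  then have "total_sum G = (\<Otimes>x\<in>two_torsion G \<union> (carrier G - two_torsion G). x)"
    unfolding total_sum_def by (rule arg_cong)
  also have "\<dots> = (\<Otimes>x\<in>two_torsion G. x) \<otimes> (\<Otimes>x\<in>carrier G - two_torsion G. x)"
    by (rule finprod_Un_disjoint) (use fin V finite_subset in auto)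
  finally show ?thesis using odd_part_pairing(2)[OF fin] V by (auto simp: subset_iff)
qed

lemma (in comm_group) one_two_torsion: "\<one> \<in> two_torsion G"
  by (simp add: two_torsion_def)

text \<open>Outside the two-torsion, inverse pairs cancel. For \<open>d \<ge> 2\<close>, translation
  by an involution \<open>e\<close> yields \<open>e\<close> to an even power; only
  \<open>d = 1\<close> leaves a nontrivial product.\<close>

lemma (in comm_group) total_sum_eq_one_iff:
  assumes fin: "finite (carrier G)"
  shows "total_sum G = \<one> \<longleftrightarrow> card (two_torsion G) \<noteq> 2"
proof -
  have V: "two_torsion G \<subseteq> carrier G" by (auto simp: two_torsion_def)
  have finV: "finite (two_torsion G)" using V fin finite_subset by blast
  obtain d where d: "card (two_torsion G) = 2 ^ d" using card_two_torsion_power[OF fin] .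
  consider "d = 0" | "d = 1" | "2 \<le> d" by linarith
  then show ?thesis
  proof cases
    case 1
    then have "card (two_torsion G) = 1" using d by simp
    then have "two_torsion G = {\<one>}" using one_two_torsion by (metis card_1_singletonE singletonD)
    then show ?thesis using total_sum_two_torsion[OF fin] by simp
  next
    case 2
    then have c2: "card (two_torsion G) = 2" using d by simp
    then have "card (two_torsion G - {\<one>}) = 1" using one_two_torsion by simp
    then obtain t where t: "two_torsion G - {\<one>} = {t}" by (metis card_1_singletonE)
    then have tt: "two_torsion G = {\<one>, t}" "t \<noteq> \<one>" "t \<in> carrier G"
      using one_two_torsion V by auto
    then have "total_sum G = t" using total_sum_two_torsion[OF fin] by simp
    then show ?thesis using c2 tt(2) by simp
  next
    case 3
    have four: "4 \<le> card (two_torsion G)" using power_increasing[OF 3, of "2::nat"] d by simp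
    have "\<exists>e\<in>two_torsion G. e \<notin> {\<one>}" by (rule card_not_subset) (use four in auto)
    then obtain e where e: "e \<in> two_torsion G" "e \<noteq> \<one>" by blast
    have eG: "e \<in> carrier G" "e \<otimes> e = \<one>" using e by (auto simp: two_torsion_def)
    have "even (card (two_torsion G)) \<and> (\<Otimes>x\<in>two_torsion G. x) = e [^] (card (two_torsion G) div 2)"
    proof (rule finprod_pairing[where f = "\<lambda>x. x \<otimes> e"])
      fix x assume x: "x \<in> two_torsion G"
      then have xG: "x \<in> carrier G" "x \<otimes> x = \<one>" by (auto simp: two_torsion_def)
      have "x \<otimes> (x \<otimes> e) = e" using xG eG m_assoc[of x x e] by simp
      then show "x \<otimes> e \<in> two_torsion G \<and> x \<otimes> e \<otimes> e = x \<and> x \<otimes> e \<noteq> x \<and> x \<otimes> (x \<otimes> e) = e"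
        using subgroup.m_closed[OF subgroup_two_torsion x e(1)] xG eG e(2) by (simp add: m_assoc)
    qed (use finV V eG in auto)
    moreover obtain d' where "d = Suc (Suc d')" using 3 by (metis add_2_eq_Suc le_Suc_ex)
    then have "card (two_torsion G) div 2 = 2 * 2 ^ d'" using d by simp
    moreover have "e [^] (2 * k) = \<one>" for k :: nat
    proof -
      have "e [^] (2 * k) = (e [^] (2::nat)) [^] k" using eG by (simp add: nat_pow_pow)
      then show ?thesis using eG by (simp add: numeral_2_eq_2)
    qed
    ultimately have "total_sum G = \<one>" using total_sum_two_torsion[OF fin] by simp
    then show ?thesis using four by simp
  qed
qed

lemma elementary_iff:
  assumes "comm_group G"
  shows "elementary_abelian_2_group G \<longleftrightarrow> (\<forall>x\<in>carrier G. x \<otimes>\<^bsub>G\<^esub> x = \<one>\<^bsub>G\<^esub>)"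
proof -
  interpret comm_group G by (rule assms)
  have "ord x = 2 \<longleftrightarrow> x \<otimes>\<^bsub>G\<^esub> x = \<one>\<^bsub>G\<^esub>" if x: "x \<in> carrier G" "x \<noteq> \<one>\<^bsub>G\<^esub>" for x
  proof
    assume "ord x = 2"
    then show "x \<otimes>\<^bsub>G\<^esub> x = \<one>\<^bsub>G\<^esub>" using pow_ord_eq_1[OF x(1)] x(1) by (simp add: numeral_2_eq_2)
  next
    assume "x \<otimes>\<^bsub>G\<^esub> x = \<one>\<^bsub>G\<^esub>"
    then show "ord x = 2" using ord_involution[of x] x by (simp add: two_torsion_def)
  qed
  then show ?thesis
    using assms unfolding elementary_abelian_2_group_def by (metis one_closed r_one)
qed

section \<open>From sequences to cycles, and upper bounds\<close>

lemma group_cyclesD: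
  assumes "C \<in> group_cycles G"
  shows "distinct C" "set C = carrier G" "length C = order G"
    "i < length C \<Longrightarrow> C ! i \<noteq> C ! (Suc i mod length C)"
  using assms distinct_card[of C]
  by (auto simp: group_cycles_def hamiltonian_cycles_def complete_arcs_def order_def)

lemma cycle_sums_image:
  "cycle_sums G C = (\<lambda>i. C ! i \<otimes>\<^bsub>G\<^esub> C ! (Suc i mod length C)) ` {..<length C}"
  by (auto simp: cycle_sums_def)

text \<open>The index set \<open>J\<close> serves all three lower bounds: all indices, all but the
  closing one, and all but the last two.\<close>

lemma cycle_of_sequence:
  assumes fin: "finite (carrier G)" and n: "2 \<le> order G"
    and x: "\<And>i. i < order G \<Longrightarrow> x i \<in> carrier G" "inj_on x {..<order G}"
    and J: "J \<subseteq> {..<order G}" "inj_on (\<lambda>i. x i \<otimes>\<^bsub>G\<^esub> x (Suc i mod order G)) J"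
  shows "\<exists>C\<in>group_cycles G. card J \<le> card (cycle_sums G C)"
proof
  let ?n = "order G"
  let ?C = "map x [0..<?n]"
  have suc: "Suc i mod ?n < ?n" "Suc i mod ?n \<noteq> i" if "i < ?n" for i
    using that n by (auto simp: mod_Suc)
  have img: "x ` {..<?n} = carrier G"
    by (rule card_subset_eq) (use fin x in \<open>auto simp: card_image order_def\<close>)
  have C: "?C ! i = x i" "?C ! (Suc i mod length ?C) = x (Suc i mod ?n)" if "i < ?n" for i
    using that suc[OF that] by simp_all
  show "?C \<in> group_cycles G"
    using x(1) suc inj_onD[OF x(2)] img C x(2)
    by (auto simp: group_cycles_def hamiltonian_cycles_def complete_arcs_def distinct_map atLeast0LessThan
        simp del: nth_map; metis lessThan_iff)
  have "card J = card ((\<lambda>i. x i \<otimes>\<^bsub>G\<^esub> x (Suc i mod ?n)) ` J)"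
    using J(2) by (simp add: card_image)
  also have "\<dots> \<le> card (cycle_sums G ?C)"
    unfolding cycle_sums_image
    by (rule card_mono) (use J(1) C in \<open>auto intro!: rev_image_eqI\<close>)
  finally show "card J \<le> card (cycle_sums G ?C)" .
qed

lemma finite_group_cycles: "finite (carrier G) \<Longrightarrow> finite (group_cycles G)"
  by (rule finite_subset[of _ "{C. set C \<subseteq> carrier G \<and> length C = order G}"])
    (auto dest: group_cyclesD intro: finite_lists_length_eq)

lemma s_max_eqI:
  assumes "finite (carrier G)" "\<exists>C\<in>group_cycles G. b \<le> card (cycle_sums G C)"
    "\<And>C. C \<in> group_cycles G \<Longrightarrow> card (cycle_sums G C) \<le> b"
  shows "s_max G = b"
  unfolding s_max_def
proof (rule Max_eqI)
  show "finite ((\<lambda>C. card (cycle_sums G C)) ` group_cycles G)"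
    using finite_group_cycles[OF assms(1)] by simp
  obtain C where C: "C \<in> group_cycles G" "b \<le> card (cycle_sums G C)" using assms(2) by blast
  then have "card (cycle_sums G C) = b" using assms(3)[OF C(1)] by simp
  then show "b \<in> (\<lambda>C. card (cycle_sums G C)) ` group_cycles G" using C(1) by blast
qed (use assms(3) in auto)

lemma cycle_sums_le: "C \<in> group_cycles G \<Longrightarrow> card (cycle_sums G C) \<le> order G"
  unfolding cycle_sums_image using group_cyclesD(3) card_image_le[of "{..<length C}"]
  by (metis card_lessThan finite_lessThan)

text \<open>Every element enters two sums, once as the first and once as the second factor.\<close>

lemma (in comm_group) cycle_sums_product:
  assumes C: "C \<in> group_cycles G"
  shows "(\<Otimes>i\<in>{..<order G}. C ! i \<otimes> C ! (Suc i mod order G)) = total_sum G \<otimes> total_sum G"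
proof -
  let ?n = "order G"
  note c = group_cyclesD[OF C]
  have cl: "C ! i \<in> carrier G" if "i < ?n" for i using c that nth_mem by metis
  have total: "(\<Otimes>i\<in>{..<?n}. C ! i) = total_sum G"
  proof -
    have inj: "inj_on (\<lambda>i. C ! i) {..<?n}" using c(1,3) by (simp add: inj_on_nth)
    have img: "(\<lambda>i. C ! i) ` {..<?n} = carrier G"
      using c(2,3) by (auto simp: set_conv_nth)
    have "(\<Otimes>x\<in>(\<lambda>i. C ! i) ` {..<?n}. x) = (\<Otimes>i\<in>{..<?n}. C ! i)"
      by (rule finprod_reindex[OF _ inj]) (use img in auto)
    then show ?thesis by (simp add: total_sum_def img)
  qed
  let ?\<sigma> = "\<lambda>i. Suc i mod ?n"
  have inj: "inj_on ?\<sigma> {..<?n}" by (rule inj_onI) (auto simp: mod_Suc split: if_splits)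
  have img: "?\<sigma> ` {..<?n} = {..<?n}"
    by (rule card_subset_eq) (use inj in \<open>auto simp: card_image\<close>)
  have "(\<Otimes>i\<in>?\<sigma> ` {..<?n}. C ! i) = (\<Otimes>i\<in>{..<?n}. C ! ?\<sigma> i)"
    by (rule finprod_reindex[OF _ inj]) (use cl img in auto)
  then have "(\<Otimes>i\<in>{..<?n}. C ! ?\<sigma> i) = total_sum G" using img total by simp
  moreover have "(\<Otimes>i\<in>{..<?n}. C ! i \<otimes> C ! ?\<sigma> i) = (\<Otimes>i\<in>{..<?n}. C ! i) \<otimes> (\<Otimes>i\<in>{..<?n}. C ! ?\<sigma> i)"
    by (rule finprod_multf) (use cl in auto)
  ultimately show ?thesis using total by simp
qed

text \<open>If all sums were distinct, their product would be both \<open>total_sum G\<close> and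
  its square.\<close>

lemma (in comm_group) cycle_sums_nonzero_total:
  assumes fin: "finite (carrier G)" and C: "C \<in> group_cycles G" and tot: "total_sum G \<noteq> \<one>"
  shows "card (cycle_sums G C) \<le> order G - 1"
proof (rule ccontr)
  assume "\<not> card (cycle_sums G C) \<le> order G - 1"
  then have card: "card (cycle_sums G C) = order G" using cycle_sums_le[OF C] by linarith
  let ?n = "order G" and ?s = "\<lambda>i. C ! i \<otimes> C ! (Suc i mod order G)"
  note c = group_cyclesD[OF C]
  have S: "cycle_sums G C = ?s ` {..<?n}" using c(3) by (simp add: cycle_sums_image)
  have cl: "C ! i \<in> carrier G" if "i < ?n" for i using c that nth_mem by metis
  have sub: "?s ` {..<?n} \<subseteq> carrier G" using cl by auto
  have img: "?s ` {..<?n} = carrier G"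
    by (rule card_subset_eq[OF fin sub]) (use card S in \<open>simp add: order_def\<close>)
  have inj: "inj_on ?s {..<?n}"
    by (rule eq_card_imp_inj_on) (use card S in simp_all)
  have "(\<Otimes>x\<in>?s ` {..<?n}. x) = (\<Otimes>i\<in>{..<?n}. ?s i)"
    by (rule finprod_reindex[OF _ inj]) (use sub in auto)
  then have "total_sum G = total_sum G \<otimes> total_sum G"
    using cycle_sums_product[OF C] img by (simp add: total_sum_def)
  moreover have "total_sum G \<in> carrier G" unfolding total_sum_def by (rule finprod_closed) simp
  ultimately show False using tot by (metis r_cancel_one')
qed

text \<open>With \<open>order G - 1\<close> values the sums would be all nonidentity elements, one
  index \<open>i\<close> being redundant. The product of all sums and the product without
  \<open>i\<close> are both trivial, so the sum at \<open>i\<close> is the identity, impossible for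
  distinct neighbours.\<close>

lemma (in comm_group) cycle_sums_elementary:
  assumes fin: "finite (carrier G)" and C: "C \<in> group_cycles G"
    and elem: "\<And>x. x \<in> carrier G \<Longrightarrow> x \<otimes> x = \<one>" and tot: "total_sum G = \<one>"
  shows "card (cycle_sums G C) \<le> order G - 2"
proof (rule ccontr)
  assume not: "\<not> card (cycle_sums G C) \<le> order G - 2"
  let ?n = "order G" and ?s = "\<lambda>i. C ! i \<otimes> C ! (Suc i mod order G)"
  note c = group_cyclesD[OF C]
  have S: "cycle_sums G C = ?s ` {..<?n}" using c(3) by (simp add: cycle_sums_image)
  have cl: "C ! i \<in> carrier G" if "i < ?n" for i using c that nth_mem by metis
  have ne: "?s i \<noteq> \<one>" if i: "i < ?n" for i
  proof
    have i': "Suc i mod ?n < ?n" using i by simp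
    assume "?s i = \<one>"
    then have "?s i = C ! i \<otimes> C ! i" using elem cl[OF i] by simp
    then have "C ! (Suc i mod ?n) = C ! i" using cl[OF i] cl[OF i'] by simp
    then show False using c(3) c(4)[of i] i by simp
  qed
  have sub: "?s ` {..<?n} \<subseteq> carrier G - {\<one>}" using cl ne by auto
  have cardG: "card (carrier G - {\<one>}) = ?n - 1" by (simp add: order_def)
  have card: "card (?s ` {..<?n}) = ?n - 1"
    using card_mono[OF _ sub] fin cardG not S by simp
  have img: "?s ` {..<?n} = carrier G - {\<one>}"
    by (rule card_subset_eq[OF _ sub]) (use fin card cardG in auto)
  have n: "0 < ?n" using fin order_gt_0_iff_finite by blast
  have "\<not> inj_on ?s {..<?n}"
  proof
    assume "inj_on ?s {..<?n}"
    then have "card (?s ` {..<?n}) = ?n" by (simp only: card_image card_lessThan)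
    then show False using card n by linarith
  qed
  then obtain i j where ij: "i < ?n" "j < ?n" "i \<noteq> j" "?s i = ?s j" by (auto simp: inj_on_def)
  let ?D = "{..<?n} - {i}"
  have img': "?s ` ?D = carrier G - {\<one>}"
  proof -
    have "?s j \<in> ?s ` ?D" using ij(2,3) by (intro imageI) simp
    then have i: "?s i \<in> ?s ` ?D" by (simp only: ij(4))
    have "?s ` {..<?n} \<subseteq> ?s ` ?D"
    proof (rule image_subsetI)
      fix k assume "k \<in> {..<?n}"
      then show "?s k \<in> ?s ` ?D" using i by (cases "k = i") simp_all
    qed
    moreover have "?s ` ?D \<subseteq> ?s ` {..<?n}" by (rule image_mono) simp
    ultimately show ?thesis using img by simp
  qed
  have inj: "inj_on ?s ?D"
    by (rule eq_card_imp_inj_on) (use img' cardG ij in simp_all)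
  have "(\<Otimes>x\<in>?s ` ?D. x) = (\<Otimes>k\<in>?D. ?s k)"
    by (rule finprod_reindex[OF _ inj]) (use img' in auto)
  moreover have "total_sum G = \<one> \<otimes> (\<Otimes>x\<in>carrier G - {\<one>}. x)"
  proof -
    have "carrier G = insert \<one> (carrier G - {\<one>})" by blast
    then have "total_sum G = (\<Otimes>x\<in>insert \<one> (carrier G - {\<one>}). x)"
      unfolding total_sum_def by (rule arg_cong)
    also have "\<dots> = \<one> \<otimes> (\<Otimes>x\<in>carrier G - {\<one>}. x)"
      by (rule finprod_insert) (use fin in auto)
    finally show ?thesis .
  qed
  moreover have "(\<Otimes>x\<in>carrier G - {\<one>}. x) \<in> carrier G" by (rule finprod_closed) auto
  ultimately have rest: "(\<Otimes>k\<in>?D. ?s k) = \<one>" using tot img' by simp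
  have "{..<?n} = insert i ?D" using ij(1) by blast
  then have "(\<Otimes>k\<in>{..<?n}. ?s k) = (\<Otimes>k\<in>insert i ?D. ?s k)" by (rule arg_cong)
  also have "\<dots> = ?s i \<otimes> (\<Otimes>k\<in>?D. ?s k)"
    by (rule finprod_insert) (use cl ij in auto)
  finally have "?s i = \<one>" using rest cycle_sums_product[OF C] tot cl[OF ij(1)] cl[of "Suc i mod ?n"] n by simp
  then show False using ne[OF ij(1)] by simp
qed

text \<open>The inductions range over groups of type \<open>'a monoid\<close>; truncation drops the
  record extension so that they apply.\<close>

lemma truncate_comm_group: "comm_group G \<Longrightarrow> comm_group (monoid.truncate G)"
proof -
  assume "comm_group G"
  then interpret comm_group G .
  show ?thesis
  proof (rule comm_groupI)
    fix x assume "x \<in> carrier (monoid.truncate G)"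
    then show "\<exists>y\<in>carrier (monoid.truncate G). y \<otimes>\<^bsub>monoid.truncate G\<^esub> x = \<one>\<^bsub>monoid.truncate G\<^esub>"
      by (auto simp: monoid.defs intro: bexI[of _ "inv\<^bsub>G\<^esub> x"])
  qed (auto simp: monoid.defs m_ac)
qed

theorem theorem6:
  fixes G :: "('a, 'b) monoid_scheme" (structure)
  assumes "comm_group G"
    and "finite (carrier G)"
    and "carrier G \<noteq> {\<one>}"
  shows "(total_sum G = \<one> \<and> \<not> elementary_abelian_2_group G \<longrightarrow> s_max G = order G)
    \<and> (total_sum G \<noteq> \<one> \<longrightarrow> s_max G = order G - 1)
    \<and> (elementary_abelian_2_group G \<and> order G > 2 \<longrightarrow> s_max G = order G - 2)"
proof -
  interpret comm_group G by (rule assms(1))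
  note fin = assms(2)
  let ?T = "monoid.truncate G"
  have T: "comm_group ?T" "finite (carrier ?T)"
    using truncate_comm_group[OF assms(1)] fin by (simp_all add: monoid.defs)
  have T_simps: "order ?T = order G" "two_torsion ?T = two_torsion G" "carrier ?T = carrier G"
    "x \<otimes>\<^bsub>?T\<^esub> y = x \<otimes> y" "\<one>\<^bsub>?T\<^esub> = \<one>" for x y
    by (simp_all add: monoid.defs order_def two_torsion_def)
  have n0: "0 < order G" using fin order_gt_0_iff_finite by blast
  have "order G \<noteq> 1"
  proof
    assume "order G = 1"
    then obtain a where "carrier G = {a}" unfolding order_def by (metis card_1_singletonE)
    then show False using assms(3) one_closed by auto
  qed
  then have n2: "2 \<le> order G" using n0 by linarith
  \<comment> \<open>Elements outside the two-torsion pair off with their inverses, so the order has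
    the parity of the two-torsion.\<close>
  have V_odd: "odd (order G)" if "card (two_torsion G) = 1"
  proof -
    have V: "two_torsion G \<subseteq> carrier G" by (auto simp: two_torsion_def)
    then have "order G = card (two_torsion G) + card (carrier G - two_torsion G)"
      using fin unfolding order_def by (metis card_Diff_subset card_mono finite_subset le_add_diff_inverse)
    then show ?thesis using that odd_part_pairing(1)[OF fin] by simp
  qed
  have "s_max G = order G" if tot: "total_sum G = \<one>" and ne: "\<not> elementary_abelian_2_group G"
  proof -
    have nV: "card (two_torsion G) \<noteq> 2" using total_sum_eq_one_iff[OF fin] tot by simp
    obtain d where d: "card (two_torsion G) = 2 ^ d" using card_two_torsion_power[OF fin] .
    have "harmonious ?T"
    proof (cases "d = 0")
      case True
      then have "odd (order ?T)" using V_odd d T_simps by simp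
      then show ?thesis using odd_order_harmonious[OF T] by blast
    next
      case False
      then have "2 \<le> d" using nV d by (cases "d = 1") auto
      then have "4 \<le> card (two_torsion G)" using power_increasing[of 2 d "2::nat"] d by simp
      then have "many_involutions_nonelementary ?T"
        using ne elementary_iff[OF assms(1)] unfolding many_involutions_nonelementary_def T_simps by blast
      then show ?thesis using nonelementary_harmonious[OF T] by blast
    qed
    then obtain x where x: "\<forall>i < order G. x i \<in> carrier G" "inj_on x {..<order G}"
      "inj_on (\<lambda>i. x i \<otimes> x (Suc i mod order G)) {..<order G}"
      unfolding harmonious_def T_simps by blast
    have "\<exists>C\<in>group_cycles G. card {..<order G} \<le> card (cycle_sums G C)"
      by (rule cycle_of_sequence[OF fin n2 _ x(2) _ x(3)]) (use x(1) in auto)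
    then show ?thesis using cycle_sums_le by (intro s_max_eqI[OF fin]) auto
  qed
  moreover have "s_max G = order G - 1" if tot: "total_sum G \<noteq> \<one>"
  proof -
    have "card (two_torsion ?T) = 2" using total_sum_eq_one_iff[OF fin] tot T_simps by simp
    then have "involutive_sequence ?T" using single_involution_sequence[OF T] by blast
    then obtain \<iota> x l where I: "\<iota> \<in> carrier ?T" "\<iota> \<noteq> \<one>\<^bsub>?T\<^esub>" "\<iota> \<otimes>\<^bsub>?T\<^esub> \<iota> = \<one>\<^bsub>?T\<^esub>" "order ?T = 2 * l"
       "\<forall>i\<le>l. x i \<in> carrier ?T"
       "inj_on (\<lambda>(i, b). x i \<otimes>\<^bsub>?T\<^esub> \<iota> [^]\<^bsub>?T\<^esub> b) ({..<l} \<times> {..<2::nat})"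
       "inj_on (\<lambda>(i, b). x i \<otimes>\<^bsub>?T\<^esub> x (i + b) \<otimes>\<^bsub>?T\<^esub> \<iota>) ({..<l} \<times> {..<2})"
      unfolding involutive_sequence_def by blast
    interpret T: comm_group ?T by (rule T(1))
    define y where "y j = x (j div 2) \<otimes>\<^bsub>?T\<^esub> \<iota> [^]\<^bsub>?T\<^esub> (j mod 2)" for j :: nat
    have half: "j div 2 < l" "j mod 2 < 2" if "j < 2 * l" for j using that by auto
    have yG: "y j \<in> carrier G" if "j < order G" for j
      using I(1,4,5) half[of j] that unfolding y_def T_simps(3)[symmetric] T_simps(1) by simp
    have y_inj: "inj_on y {..<order G}"
    proof (rule inj_onI)
      fix i j assume ij: "i \<in> {..<order G}" "j \<in> {..<order G}" "y i = y j"
      then have "(i div 2, i mod 2) = (j div 2, j mod 2)"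
        using inj_onD[OF I(6), of "(i div 2, i mod 2)" "(j div 2, j mod 2)"] half I(4) T_simps(1)
        by (simp add: y_def)
      then show "i = j" by (metis div_mult_mod_eq prod.inject)
    qed
    \<comment> \<open>The closing index is left out: there the right-hand side involves
      \<open>x l\<close>, whereas the cycle returns to \<open>x 0\<close>.\<close>
    have y_sum: "y j \<otimes> y (Suc j mod order G) = x (j div 2) \<otimes>\<^bsub>?T\<^esub> x (j div 2 + j mod 2) \<otimes>\<^bsub>?T\<^esub> \<iota>"
      if j: "j < order G - 1" for j
    proof -
      have sj: "Suc j mod order G = Suc j" using j by simp
      have jl: "j < 2 * l - 1" using j I(4) T_simps(1) by simp
      have xx: "x (j div 2) \<in> carrier ?T" "x (Suc (j div 2)) \<in> carrier ?T" using I(5) jl by auto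
      show ?thesis
      proof (cases "even j")
        case True
        then have "Suc j div 2 = j div 2" "Suc j mod 2 = 1" "j mod 2 = 0" by presburger+
        then show ?thesis unfolding sj using xx I(1)
          by (simp add: y_def T.m_assoc flip: T_simps(4))
      next
        case False
        then have "Suc j div 2 = Suc (j div 2)" "Suc j mod 2 = 0" "j mod 2 = 1" by presburger+
        then show ?thesis unfolding sj using xx I(1)
          by (simp add: y_def T.m_assoc T.m_comm[of \<iota>] flip: T_simps(4))
      qed
    qed
    have s_inj: "inj_on (\<lambda>j. y j \<otimes> y (Suc j mod order G)) {..<order G - 1}"
    proof (rule inj_onI)
      fix i j assume ij: "i \<in> {..<order G - 1}" "j \<in> {..<order G - 1}"
        "y i \<otimes> y (Suc i mod order G) = y j \<otimes> y (Suc j mod order G)"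
      then have "(i div 2, i mod 2) = (j div 2, j mod 2)"
        using inj_onD[OF I(7), of "(i div 2, i mod 2)" "(j div 2, j mod 2)"] half I(4) T_simps(1) y_sum
        by simp
      then show "i = j" by (metis div_mult_mod_eq prod.inject)
    qed
    have "\<exists>C\<in>group_cycles G. card {..<order G - 1} \<le> card (cycle_sums G C)"
      by (rule cycle_of_sequence[OF fin n2 yG y_inj _ s_inj]) auto
    then show ?thesis using cycle_sums_nonzero_total[OF fin _ tot] by (intro s_max_eqI[OF fin]) auto
  qed
  moreover have "s_max G = order G - 2" if el: "elementary_abelian_2_group G" and n: "order G > 2"
  proof -
    have elem: "x \<otimes> x = \<one>" if "x \<in> carrier G" for x
      using el elementary_iff[OF assms(1)] that by blast
    then have "two_torsion G = carrier G" by (auto simp: two_torsion_def)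
    then have tot: "total_sum G = \<one>" using total_sum_eq_one_iff[OF fin] n by (simp add: order_def)
    obtain a where "R_sequence ?T a"
      using elementary_R_sequence[OF T] elem n T_simps by auto
    then have a: "a i \<in> carrier G" "a i \<noteq> \<one>" "inj_on a {..<order G - 1}"
      "inj_on (\<lambda>i. a i \<otimes> a (Suc i mod (order G - 1))) {..<order G - 1}" if "i < order G - 1" for i
      using that unfolding R_sequence_def T_simps by auto
    \<comment> \<open>The identity takes the last place, between the last and the first term of the
      R-sequence. The first \<open>order G - 2\<close> sums are sums of the R-sequence; the two sums
      next to the identity are not counted.\<close>
    define x where "x i = (if i < order G - 1 then a i else \<one>)" for i
    have N: "0 < order G - 1" using n by simp
    have xG: "x i \<in> carrier G" for i using a(1) by (simp add: x_def)
    have x_inj: "inj_on x {..<order G}"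
    proof (rule inj_onI)
      fix i j assume ij: "i \<in> {..<order G}" "j \<in> {..<order G}" "x i = x j"
      then show "i = j"
        using a(2)[of i] a(2)[of j] inj_onD[OF a(3)[OF N], of i j] by (auto simp: x_def split: if_splits)
    qed
    have s_inj: "inj_on (\<lambda>i. x i \<otimes> x (Suc i mod order G)) {..<order G - 2}"
    proof (rule inj_onI)
      fix i j assume ij: "i \<in> {..<order G - 2}" "j \<in> {..<order G - 2}"
        "x i \<otimes> x (Suc i mod order G) = x j \<otimes> x (Suc j mod order G)"
      have "x k \<otimes> x (Suc k mod order G) = a k \<otimes> a (Suc k mod (order G - 1))" if "k < order G - 2" for k
      proof -
        have "Suc k < order G - 1" using that by linarith
        then show ?thesis by (simp add: x_def)
      qed
      then show "i = j" using inj_onD[OF a(4)[OF N], of i j] ij by simp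
    qed
    have "\<exists>C\<in>group_cycles G. card {..<order G - 2} \<le> card (cycle_sums G C)"
      by (rule cycle_of_sequence[OF fin n2 xG x_inj _ s_inj]) auto
    then show ?thesis using cycle_sums_elementary[OF fin _ elem tot] by (intro s_max_eqI[OF fin]) auto
  qed
  ultimately show ?thesis by blast
qed

end
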